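(* Let $R$ be a regular local ring of dimension two. For a rank 1 valuation $\nu$ of the quotient field of $R$ dominating $R$, embed the value group of $\nu$ in $\mathbb R$ (as an ordered group) so that $1$ is the smallest nonzero element of $S^R(\nu)$, and let $\varphi_\nu(n)=|S^R(\nu)\cap(0,n)|$ for positive integers $n$. Then for every such $\nu$ the limit $$\lim_{n\to\infty}\frac{\varphi_\nu(n)}{n^2}$$ exists. The set of limits which are obtained by such valuations $\nu$ dominating $R$ is the real half open interval $[0,\tfrac12)$.
   Context: For a valuation $\nu$ of the quotient field of a local domain $R$ with maximal ideal $\mathfrak m_R$, with valuation ring $V_\nu$ and maximal ideal $\mathfrak m_\nu$ of $V_\nu$, $\nu$ dominates $R$ if $R\subset V_\nu$ and $\mathfrak m_\nu\cap R=\mathfrak m_R$. The semigroup of $\nu$ in $R$ is $S^R(\nu)=\{\nu(f)\mid f\in R\setminus\{0\}\}$; it is well ordered when $R$ is Noetherian. *)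

theory Defs
  imports
    Complex_Main
    "HOL-Library.Extended_Nat"
    "HOL-Computational_Algebra.Polynomial_Factorial"
begin

section \<open>Regular local rings\<close>

text \<open>A commutative ring is a module over itself via its multiplication; its ideals are the
  submodules, and the ideal generated by a set is its span.\<close>

definition is_ideal :: "'a::comm_ring_1 set \<Rightarrow> bool" where
  "is_ideal I \<longleftrightarrow> module.subspace (*) I"

definition ideal_gen :: "'a::comm_ring_1 set \<Rightarrow> 'a set" where
  "ideal_gen B = module.span (*) B"

definition is_prime_ideal :: "'a::comm_ring_1 set \<Rightarrow> bool" where
  "is_prime_ideal P \<longleftrightarrow>
     is_ideal P \<and> P \<noteq> UNIV \<and> (\<forall>a b. a * b \<in> P \<longrightarrow> a \<in> P \<or> b \<in> P)"

definition is_maximal_ideal :: "'a::comm_ring_1 set \<Rightarrow> bool" where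
  "is_maximal_ideal M \<longleftrightarrow>
     is_ideal M \<and> M \<noteq> UNIV \<and> (\<forall>J. is_ideal J \<and> M \<subseteq> J \<longrightarrow> J = M \<or> J = UNIV)"

definition is_noetherian :: "'a::comm_ring_1 itself \<Rightarrow> bool" where
  "is_noetherian _ \<longleftrightarrow>
     (\<forall>I :: 'a set. is_ideal I \<longrightarrow> (\<exists>B. finite B \<and> I = ideal_gen B))"

definition is_local :: "'a::comm_ring_1 itself \<Rightarrow> bool" where
  "is_local _ \<longleftrightarrow> (\<exists>!M :: 'a set. is_maximal_ideal M)"

text \<open>Meaningful for local rings only.\<close>

definition max_ideal :: "'a::comm_ring_1 set" where
  "max_ideal = (THE M. is_maximal_ideal M)"

definition krull_dim :: "'a::comm_ring_1 itself \<Rightarrow> enat" where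
  "krull_dim _ = Sup {enat n | n. \<exists>P :: nat \<Rightarrow> 'a set.
     (\<forall>i\<le>n. is_prime_ideal (P i)) \<and> (\<forall>i<n. P i \<subset> P (Suc i))}"

definition is_regular_local :: "'a::comm_ring_1 itself \<Rightarrow> bool" where
  "is_regular_local T \<longleftrightarrow> is_noetherian T \<and> is_local T \<and>
     (\<exists>B :: 'a set. finite B \<and> enat (card B) = krull_dim T \<and> ideal_gen B = max_ideal)"


section \<open>Valuations\<close>

text \<open>A valuation is defined on the nonzero elements of a field; the value assigned to \<open>0\<close>
  is junk and never used.  The value group is the image of the nonzero elements, which need
  not be all of the ordered group \<open>'g\<close>.\<close>

definition is_valuation :: "('k::field \<Rightarrow> 'g::linordered_ab_group_add) \<Rightarrow> bool" where
  "is_valuation \<nu> \<longleftrightarrow>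
     (\<forall>x y. x \<noteq> 0 \<longrightarrow> y \<noteq> 0 \<longrightarrow> \<nu> (x * y) = \<nu> x + \<nu> y) \<and>
     (\<forall>x y. x \<noteq> 0 \<longrightarrow> y \<noteq> 0 \<longrightarrow> x + y \<noteq> 0 \<longrightarrow> min (\<nu> x) (\<nu> y) \<le> \<nu> (x + y))"

definition value_group :: "('k::field \<Rightarrow> 'g::linordered_ab_group_add) \<Rightarrow> 'g set" where
  "value_group \<nu> = \<nu> ` (- {0})"

definition valuation_ring :: "('k::field \<Rightarrow> 'g::linordered_ab_group_add) \<Rightarrow> 'k set" where
  "valuation_ring \<nu> = {x. x = 0 \<or> 0 \<le> \<nu> x}"

definition valuation_ideal :: "('k::field \<Rightarrow> 'g::linordered_ab_group_add) \<Rightarrow> 'k set" where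
  "valuation_ideal \<nu> = {x. x = 0 \<or> 0 < \<nu> x}"

text \<open>Isolated (convex) subgroups \<open>H\<close> of an ordered group \<open>\<Gamma>\<close>.\<close>

definition isolated_subgroup :: "'g::linordered_ab_group_add set \<Rightarrow> 'g set \<Rightarrow> bool" where
  "isolated_subgroup H \<Gamma> \<longleftrightarrow> H \<subseteq> \<Gamma> \<and> 0 \<in> H \<and>
     (\<forall>a\<in>H. \<forall>b\<in>H. a + b \<in> H) \<and> (\<forall>a\<in>H. - a \<in> H) \<and>
     (\<forall>a\<in>\<Gamma>. \<forall>b\<in>H. 0 \<le> a \<and> a \<le> b \<longrightarrow> a \<in> H)"

text \<open>The rank of a valuation is the number of proper isolated subgroups of its value group.\<close>

definition has_rank_one :: "('k::field \<Rightarrow> 'g::linordered_ab_group_add) \<Rightarrow> bool" where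
  "has_rank_one \<nu> \<longleftrightarrow>
     card {H. isolated_subgroup H (value_group \<nu>) \<and> H \<noteq> value_group \<nu>} = 1"

text \<open>In the following, \<open>R\<close> is the type \<open>'a\<close>, a subring of its quotient field \<open>'a fract\<close>
  via \<^const>\<open>to_fract\<close>.\<close>

definition dominates :: "('a::idom fract \<Rightarrow> 'g::linordered_ab_group_add) \<Rightarrow> bool" where
  "dominates \<nu> \<longleftrightarrow> range to_fract \<subseteq> valuation_ring \<nu> \<and>
     valuation_ideal \<nu> \<inter> range to_fract = to_fract ` max_ideal"

definition value_semigroup :: "('a::idom fract \<Rightarrow> 'g::linordered_ab_group_add) \<Rightarrow> 'g set" where
  "value_semigroup \<nu> = {\<nu> (to_fract f) | f. f \<noteq> 0}"

text \<open>\<open>\<iota>\<close> embeds the value group into the reals as an ordered group, so that \<open>1\<close> is the least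
  nonzero element of the (image of the) semigroup.  Values of \<open>\<iota>\<close> outside the value group are
  irrelevant.\<close>

definition normalized_embedding ::
  "('a::idom fract \<Rightarrow> 'g::linordered_ab_group_add) \<Rightarrow> ('g \<Rightarrow> real) \<Rightarrow> bool" where
  "normalized_embedding \<nu> \<iota> \<longleftrightarrow>
     (\<forall>a\<in>value_group \<nu>. \<forall>b\<in>value_group \<nu>. \<iota> (a + b) = \<iota> a + \<iota> b) \<and>
     strict_mono_on (value_group \<nu>) \<iota> \<and>
     1 \<in> \<iota> ` value_semigroup \<nu> \<and>
     (\<forall>s\<in>\<iota> ` value_semigroup \<nu>. s \<noteq> 0 \<longrightarrow> 1 \<le> s)"

definition phi :: "('a::idom fract \<Rightarrow> 'g::linordered_ab_group_add) \<Rightarrow> ('g \<Rightarrow> real) \<Rightarrow> nat \<Rightarrow> nat"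
  where "phi \<nu> \<iota> n = card (\<iota> ` value_semigroup \<nu> \<inter> {0<..<real n})"

definition rank_one_dominating :: "('a::idom fract \<Rightarrow> 'g::linordered_ab_group_add) \<Rightarrow> bool" where
  "rank_one_dominating \<nu> \<longleftrightarrow> is_valuation \<nu> \<and> has_rank_one \<nu> \<and> dominates \<nu>"

text \<open>The limits obtained from the rank 1 valuations of \<open>'a fract\<close> dominating \<open>'a\<close> whose value
  group lies in the ordered group \<open>'g\<close>.\<close>

definition obtained_limits ::
  "'a::idom itself \<Rightarrow> 'g::linordered_ab_group_add itself \<Rightarrow> real set" where
  "obtained_limits _ _ = {L. \<exists>(\<nu> :: 'a fract \<Rightarrow> 'g) \<iota>.
     rank_one_dominating \<nu> \<and> normalized_embedding \<nu> \<iota> \<and>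
     (\<lambda>n. real (phi \<nu> \<iota> n) / (real n)\<^sup>2) \<longlonglongrightarrow> L}"

end

theory Submission
  imports Defs
begin

text \<open>Let \<open>m = (x, y)\<close> and let \<open>v\<close> be the normalized valuation, with \<open>v x = 1\<close>.  The order along
  \<open>x\<close> followed by the order of the restriction to \<open>x = 0\<close> is a rank two valuation with values in
  \<open>\<nat>\<^sup>2\<close> and residue field that of \<open>R\<close>.  The lattice points on whose fibers \<open>v\<close> has maximum \<open>l\<close>
  number \<open>\<delta> l\<close>, the dimension of the quotient of the valuation ideals at \<open>l\<close>; this is positive for
  \<open>l\<close> in the semigroup and nondecreasing under translation by it.  The number of lattice points on
  whose fibers \<open>v < n\<close> is the sum of \<open>\<delta> l\<close> over \<open>l < n\<close>, and is asymptotic to \<open>s n\<^sup>2 / 2\<close>, where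
  \<open>s \<le> 1\<close> is the infimum of \<open>ord (f | x = 0) / v f\<close>, because the maximum of \<open>v\<close> over elements of
  given order is superadditive.  Since \<open>\<delta>\<close> equals its supremum \<open>\<Delta>\<close> on a translate of the semigroup,
  the limit is \<open>s / (2 \<Delta>)\<close>, or \<open>0\<close> if \<open>\<delta>\<close> is unbounded; and \<open>s = 1\<close> forces \<open>\<Delta> \<ge> 2\<close>.

  Conversely, key elements \<open>P 0 = x\<close>, \<open>P 1 = y\<close>, \<open>P (k + 2) = P (k + 1) ^ n - x ^ a k * P k\<close> with
  weights \<open>\<beta> k\<close> such that \<open>\<beta> (k + 2) > n \<beta> (k + 1) = a k + \<beta> k\<close> define a valuation for which
  \<open>\<Delta> = 1\<close> and \<open>s = lim n ^ k / \<beta> (k + 1)\<close>, and the \<open>a k\<close> can be chosen so that \<open>s\<close> is any number in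
  \<open>[0, 1)\<close>.\<close>

section \<open>Parameters of two-dimensional regular local rings\<close>

text \<open>\<open>\<delta>\<close> exceeds 1 when the residue field of \<open>v\<close> is larger
  than that of \<open>R\<close>, so counting values is not the same as measuring lengths. The flag
  valuation supplies the lengths, because its graded pieces are one-dimensional over the residue
  field of \<open>R\<close>. Multiplication by an element of value \<open>k\<close> translates
  orders, but another element of the translated order may have larger \<open>v\<close>; so the
  monotonicity of \<open>\<delta>\<close> is derived from chains of ideals and not from a
  translation of lattice points. In the converse the residue field must not grow, so the weights of
  the standard monomials, one for each lattice point, have to be pairwise distinct. This is a
  congruence modulo \<open>n\<close>, secured by one divisibility condition on \<open>a 0\<close>.
  As \<open>R\<close> need not be complete or contain a field, elements are expanded only modulo a
  power of \<open>m\<close>, with units of \<open>R\<close> as coefficients, and the independence of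
  the standard monomials is read off from their initial forms \<open>x ^ i * y ^ d\<close>.\<close>

lemma module_self: "module ((*) :: 'a::comm_ring_1 \<Rightarrow> 'a \<Rightarrow> 'a)"
  by unfold_locales (auto simp: algebra_simps)

lemma is_ideal_iff:
  "is_ideal I \<longleftrightarrow> 0 \<in> I \<and> (\<forall>a\<in>I. \<forall>b\<in>I. a + b \<in> I) \<and> (\<forall>c. \<forall>a\<in>I. c * a \<in> I)"
  by (simp add: is_ideal_def module.subspace_def[OF module_self])

lemma is_idealI:
  assumes "0 \<in> I" "\<And>a b. a \<in> I \<Longrightarrow> b \<in> I \<Longrightarrow> a + b \<in> I" "\<And>c a. a \<in> I \<Longrightarrow> c * a \<in> I"
  shows "is_ideal I"
  using assms by (simp add: is_ideal_iff)

lemma ideal_zero: "is_ideal I \<Longrightarrow> 0 \<in> I"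
  and ideal_add: "is_ideal I \<Longrightarrow> a \<in> I \<Longrightarrow> b \<in> I \<Longrightarrow> a + b \<in> I"
  and ideal_mult: "is_ideal I \<Longrightarrow> a \<in> I \<Longrightarrow> c * a \<in> I"
  by (simp_all add: is_ideal_iff)

lemma is_ideal_diff: "is_ideal I \<Longrightarrow> a \<in> I \<Longrightarrow> b \<in> I \<Longrightarrow> a - b \<in> I"
  unfolding is_ideal_iff by (metis diff_conv_add_uminus mult_minus1)

lemma is_ideal_UNIV_iff: "is_ideal I \<Longrightarrow> I = UNIV \<longleftrightarrow> 1 \<in> I"
  unfolding is_ideal_iff by (metis UNIV_I UNIV_eq_I mult.right_neutral)

lemma prime_ideal_power:
  assumes "is_prime_ideal P" "a ^ n \<in> P"
  shows "a \<in> P"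
  using assms(2)
proof (induction n)
  case 0
  then show ?case using assms(1) is_ideal_UNIV_iff unfolding is_prime_ideal_def by auto
next
  case (Suc n)
  then show ?case using assms(1) unfolding is_prime_ideal_def by auto
qed

lemma is_ideal_ideal_gen: "is_ideal (ideal_gen B)"
  by (simp add: is_ideal_def ideal_gen_def module.subspace_span[OF module_self])

lemma ideal_gen_superset: "B \<subseteq> ideal_gen B"
  by (simp add: ideal_gen_def module.span_superset[OF module_self])

lemma ideal_gen_mono: "B \<subseteq> C \<Longrightarrow> ideal_gen B \<subseteq> ideal_gen C"
  by (simp add: ideal_gen_def module.span_mono[OF module_self])

lemma ideal_gen_minimal: "B \<subseteq> I \<Longrightarrow> is_ideal I \<Longrightarrow> ideal_gen B \<subseteq> I"
  by (simp add: ideal_gen_def is_ideal_def module.span_minimal[OF module_self])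

lemma generators_mem:
  fixes x y :: "'a::comm_ring_1"
  shows "x \<in> {a * x + b * y | a b. True}" "y \<in> {a * x + b * y | a b. True}"
proof -
  have "x = 1 * x + 0 * y" "y = 0 * x + 1 * y" by simp_all
  then show "x \<in> {a * x + b * y | a b. True}" "y \<in> {a * x + b * y | a b. True}" by blast+
qed

lemma ideal_gen_pair: "ideal_gen {x, y} = {a * x + b * y | a b. True}" for x y :: "'a::comm_ring_1"
proof
  show "ideal_gen {x, y} \<subseteq> {a * x + b * y | a b. True}"
  proof (rule ideal_gen_minimal)
    show "{x, y} \<subseteq> {a * x + b * y | a b. True}"
      using generators_mem by blast
    show "is_ideal {a * x + b * y | a b. True}"
    proof (rule is_idealI)
      show "0 \<in> {a * x + b * y | a b. True}"
        by (auto intro!: exI[of _ 0])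
    next
      fix p q assume "p \<in> {a * x + b * y | a b. True}" "q \<in> {a * x + b * y | a b. True}"
      then obtain a b c d where "p = a * x + b * y" "q = c * x + d * y" by auto
      then have "p + q = (a + c) * x + (b + d) * y" by (simp add: algebra_simps)
      then show "p + q \<in> {a * x + b * y | a b. True}" by blast
    next
      fix c p assume "p \<in> {a * x + b * y | a b. True}"
      then obtain a b where "p = a * x + b * y" by auto
      then have "c * p = (c * a) * x + (c * b) * y" by (simp add: algebra_simps)
      then show "c * p \<in> {a * x + b * y | a b. True}" by blast
    qed
  qed
next
  have "a * x + b * y \<in> ideal_gen {x, y}" for a b
    using ideal_gen_superset[of "{x, y}"]
    by (intro ideal_add ideal_mult is_ideal_ideal_gen) auto
  then show "{a * x + b * y | a b. True} \<subseteq> ideal_gen {x, y}" by blast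
qed

lemma proper_ideal_subset_maximal:
  assumes "is_ideal I" "I \<noteq> UNIV"
  obtains M where "is_maximal_ideal M" "I \<subseteq> M"
proof -
  \<comment> \<open>Properness is expressed by \<open>1 \<notin> J\<close>, a condition that unions
    of chains inherit.\<close>
  let ?A = "{J. is_ideal J \<and> 1 \<notin> J \<and> I \<subseteq> J}"
  have "\<exists>M\<in>?A. \<forall>X\<in>?A. M \<subseteq> X \<longrightarrow> X = M"
  proof (rule subset_Zorn_nonempty)
    show "?A \<noteq> {}" using assms is_ideal_UNIV_iff by blast
  next
    fix C assume C: "C \<noteq> {}" "subset.chain ?A C"
    then have sub: "C \<subseteq> ?A" and ch: "\<And>X Y. X \<in> C \<Longrightarrow> Y \<in> C \<Longrightarrow> X \<subseteq> Y \<or> Y \<subseteq> X"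
      by (auto simp: subset_chain_def)
    have "is_ideal (\<Union>C)"
    proof (rule is_idealI)
      show "0 \<in> \<Union>C" using C(1) sub by (auto simp: is_ideal_iff)
    next
      fix a b assume "a \<in> \<Union>C" "b \<in> \<Union>C"
      then obtain X Y where "X \<in> C" "Y \<in> C" "a \<in> X" "b \<in> Y" by blast
      then obtain Z where "Z \<in> C" "a \<in> Z" "b \<in> Z" using ch by blast
      moreover have "is_ideal Z" using sub \<open>Z \<in> C\<close> by blast
      ultimately show "a + b \<in> \<Union>C" unfolding is_ideal_iff by blast
    next
      fix c a assume "a \<in> \<Union>C"
      then obtain X where "a \<in> X" "X \<in> C" by blast
      moreover have "is_ideal X" using sub \<open>X \<in> C\<close> by blast
      ultimately show "c * a \<in> \<Union>C" unfolding is_ideal_iff by blast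
    qed
    then show "\<Union>C \<in> ?A" using C(1) sub by blast
  qed
  then obtain M where M: "is_ideal M" "1 \<notin> M" "I \<subseteq> M"
    and max: "\<And>X. is_ideal X \<Longrightarrow> 1 \<notin> X \<Longrightarrow> I \<subseteq> X \<Longrightarrow> M \<subseteq> X \<Longrightarrow> X = M" by auto
  have "is_maximal_ideal M"
    unfolding is_maximal_ideal_def using M max is_ideal_UNIV_iff by (metis order_trans)
  then show thesis using M that by blast
qed

lemma max_ideal_is_maximal: "is_local TYPE('a::comm_ring_1) \<Longrightarrow> is_maximal_ideal (max_ideal :: 'a set)"
  unfolding is_local_def max_ideal_def by (rule theI')

text \<open>The multiples of a nonunit form a proper ideal, and the only maximal ideal above it is
  \<open>max_ideal\<close>. Later arguments can therefore speak of nonunits.\<close>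

lemma mem_max_ideal_iff:
  assumes "is_local TYPE('a::comm_ring_1)"
  shows "(r :: 'a) \<in> max_ideal \<longleftrightarrow> \<not> r dvd 1"
proof
  have max: "is_maximal_ideal (max_ideal :: 'a set)" by (rule max_ideal_is_maximal[OF assms])
  then have ideal: "is_ideal (max_ideal :: 'a set)" and proper: "(max_ideal :: 'a set) \<noteq> UNIV"
    by (auto simp: is_maximal_ideal_def)
  show "\<not> r dvd 1" if "r \<in> max_ideal"
  proof
    assume "r dvd 1"
    then obtain s where "1 = s * r" by (metis dvdE mult.commute)
    then have "1 \<in> (max_ideal :: 'a set)" using ideal that unfolding is_ideal_iff by metis
    then show False using proper ideal is_ideal_UNIV_iff by blast
  qed
  assume r: "\<not> r dvd 1"
  have i: "is_ideal {s. r dvd s}" by (rule is_idealI) auto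
  have "{s. r dvd s} \<noteq> UNIV" using r by blast
  then obtain M where M: "is_maximal_ideal M" "{s. r dvd s} \<subseteq> M"
    using proper_ideal_subset_maximal[OF i] by blast
  then have "M = max_ideal" using max assms unfolding is_local_def by blast
  then show "r \<in> max_ideal" using M(2) by auto
qed

lemma prime_ideal_subset_max_ideal:
  assumes loc: "is_local TYPE('a::comm_ring_1)" and P: "is_prime_ideal (P :: 'a set)"
  shows "P \<subseteq> max_ideal"
proof
  fix p assume p: "p \<in> P"
  have "is_ideal P" "1 \<notin> P" using P is_ideal_UNIV_iff unfolding is_prime_ideal_def by blast+
  then have "\<not> p dvd 1" using p unfolding is_ideal_iff by (metis dvdE mult.commute)
  then show "p \<in> max_ideal" by (simp add: mem_max_ideal_iff[OF loc])
qed

section \<open>Krull's intersection theorem and the existence of regular parameters\<close>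

lemma noetherian_sequence:
  fixes h :: "nat \<Rightarrow> 'a::comm_ring_1"
  assumes "is_noetherian TYPE('a)"
  obtains n where "h n \<in> ideal_gen (h ` {..<n})"
proof -
  let ?J = "\<Union>n. ideal_gen (h ` {..<n})"
  have mono: "ideal_gen (h ` {..<m}) \<subseteq> ideal_gen (h ` {..<n})" if "m \<le> n" for m n
    using that by (intro ideal_gen_mono image_mono) auto
  have "is_ideal ?J"
  proof (rule is_idealI)
    show "0 \<in> ?J" using ideal_zero[OF is_ideal_ideal_gen] by blast
  next
    fix a b assume "a \<in> ?J" "b \<in> ?J"
    then obtain m n where "a \<in> ideal_gen (h ` {..<m})" "b \<in> ideal_gen (h ` {..<n})" by blast
    then have "a \<in> ideal_gen (h ` {..<max m n})" "b \<in> ideal_gen (h ` {..<max m n})"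
      using mono[of m "max m n"] mono[of n "max m n"] by auto
    then show "a + b \<in> ?J" using ideal_add[OF is_ideal_ideal_gen] by blast
  next
    fix c a assume "a \<in> ?J"
    then show "c * a \<in> ?J" using ideal_mult[OF is_ideal_ideal_gen] by blast
  qed
  then obtain B where B: "finite B" "?J = ideal_gen B" using assms unfolding is_noetherian_def by blast
  \<comment> \<open>The finitely many generators of the union all lie in one stage of the increasing
    chain, which is then stationary.\<close>
  have "\<exists>n. B' \<subseteq> ideal_gen (h ` {..<n})" if "finite B'" "B' \<subseteq> B" for B'
    using that
  proof (induction B')
    case (insert b B')
    then obtain n where n: "B' \<subseteq> ideal_gen (h ` {..<n})" by auto
    have "b \<in> ideal_gen B" using insert.prems ideal_gen_superset by blast
    then have "b \<in> ?J" by (simp only: B(2))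
    then obtain m where "b \<in> ideal_gen (h ` {..<m})" by blast
    then have "insert b B' \<subseteq> ideal_gen (h ` {..<max m n})"
      using n mono[of m "max m n"] mono[of n "max m n"] by auto
    then show ?case by blast
  qed auto
  then obtain n where "B \<subseteq> ideal_gen (h ` {..<n})" using B(1) by blast
  then have "?J \<subseteq> ideal_gen (h ` {..<n})" unfolding B(2) by (rule ideal_gen_minimal) (rule is_ideal_ideal_gen)
  moreover have "h n \<in> ?J" using ideal_gen_superset[of "h ` {..<Suc n}"] by auto
  ultimately show thesis using that by blast
qed

text \<open>Modulo \<open>I\<close> write \<open>f = z ^ d * h d\<close> for every \<open>d\<close>.
  Some \<open>h n\<close> is a combination of its predecessors, and
  \<open>z ^ n * h j = z ^ (n - j) * f\<close> with \<open>n - j > 0\<close>. So \<open>f\<close> is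
  congruent to \<open>z * t * f\<close>, and \<open>1 - z * t\<close> is a unit.\<close>

lemma krull_intersection:
  fixes I :: "'a::comm_ring_1 set"
  assumes "is_noetherian TYPE('a)" "is_local TYPE('a)" "is_ideal I" "z \<in> max_ideal"
    and ex: "\<And>d. \<exists>h. f - z ^ d * h \<in> I"
  shows "f \<in> I"
proof -
  obtain h where h: "\<And>d. f - z ^ d * h d \<in> I" using ex by metis
  obtain n where n: "h n \<in> ideal_gen (h ` {..<n})" using noetherian_sequence assms(1) by blast
  let ?Z = "{w. \<exists>t. z ^ n * w - z * t * f \<in> I}"
  have add: "a + b \<in> I" if "a \<in> I" "b \<in> I" for a b using assms(3) that by (auto simp: is_ideal_iff)
  have mul: "c * b \<in> I" if "b \<in> I" for b c using assms(3) that by (auto simp: is_ideal_iff)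
  have "ideal_gen (h ` {..<n}) \<subseteq> ?Z"
  proof (rule ideal_gen_minimal)
    show "h ` {..<n} \<subseteq> ?Z"
    proof clarify
      fix j assume "j < n"
      then have "z ^ n * h j - z * z ^ (n - j - 1) * f = - (z ^ (n - j)) * (f - z ^ j * h j)"
        by (simp add: algebra_simps flip: power_Suc power_add)
          (simp add: Suc_diff_Suc flip: mult.assoc power_Suc power_Suc2 power_add)
      then show "\<exists>t. z ^ n * h j - z * t * f \<in> I" using mul[OF h[of j]] by metis
    qed
    show "is_ideal ?Z"
    proof (rule is_idealI)
      show "0 \<in> ?Z" using assms(3) by (auto intro!: exI[of _ 0] simp: is_ideal_iff)
    next
      fix a b assume "a \<in> ?Z" "b \<in> ?Z"
      then obtain t s where "z ^ n * a - z * t * f \<in> I" "z ^ n * b - z * s * f \<in> I" by auto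
      then have "z ^ n * (a + b) - z * (t + s) * f \<in> I" using add by (fastforce simp: algebra_simps)
      then show "a + b \<in> ?Z" by blast
    next
      fix c a assume "a \<in> ?Z"
      then obtain t where "z ^ n * a - z * t * f \<in> I" by auto
      then have "z ^ n * (c * a) - z * (c * t) * f \<in> I" using mul[of _ c] by (fastforce simp: algebra_simps)
      then show "c * a \<in> ?Z" by blast
    qed
  qed
  then obtain t where t: "z ^ n * h n - z * t * f \<in> I" using n by blast
  have "(1 - z * t) * f \<in> I" using add[OF t h[of n]] by (simp add: algebra_simps)
  moreover have "(1 - z * t) dvd 1"
  proof (rule ccontr)
    assume "\<not> (1 - z * t) dvd 1"
    then have "1 - z * t \<in> max_ideal" by (simp add: mem_max_ideal_iff[OF assms(2)])
    moreover have i: "is_ideal (max_ideal :: 'a set)" using max_ideal_is_maximal[OF assms(2)] by (simp add: is_maximal_ideal_def)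
    then have "t * z \<in> max_ideal" using assms(4) by (auto simp: is_ideal_iff)
    ultimately have "(1 - z * t) + t * z \<in> max_ideal" using ideal_add[OF i] by blast
    moreover have "(1 - z * t) + t * z = 1" by (simp add: algebra_simps)
    ultimately have "1 \<in> (max_ideal :: 'a set)" by metis
    then show False using mem_max_ideal_iff[OF assms(2), of 1] by simp
  qed
  then obtain c where "1 = (1 - z * t) * c" by blast
  ultimately show "f \<in> I" using mul[of "(1 - z * t) * f" c]
    by (metis mult.assoc mult.commute mult_1)
qed

text \<open>The consequences of regularity on which everything else rests.
  \<open>not_dvd_power\<close> and \<open>y_adic\<close> say that \<open>R/(x)\<close> is a discrete
  valuation ring with uniformizer \<open>y\<close>; \<open>x_adic\<close> says that the powers of
  \<open>x\<close> intersect in zero. The pair is ordered: \<open>x\<close> is the parameter that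
  will have value 1.\<close>

locale regular_parameters =
  fixes x y :: "'a::idom"
  assumes nonunit_iff: "\<not> r dvd 1 \<longleftrightarrow> (\<exists>a b. r = a * x + b * y)"
    and x_nonzero: "x \<noteq> 0"
    and not_dvd_power: "\<not> x dvd y ^ d"
    and y_adic: "\<not> x dvd f \<Longrightarrow> \<exists>u d g. u dvd 1 \<and> f = u * y ^ d + x * g"
    and x_adic: "f \<noteq> 0 \<Longrightarrow> \<exists>i g. f = x ^ i * g \<and> \<not> x dvd g"

text \<open>Krull intersection modulo \<open>x\<close> gives a largest \<open>e\<close> with
  \<open>f\<close> in \<open>(y ^ e, x)\<close>. The cofactor of \<open>y ^ e\<close> is a unit,
  since a nonunit lies in \<open>(x, y)\<close> and would allow a larger \<open>e\<close>.\<close>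

lemma adic_expansion:
  fixes x y f :: "'a::idom"
  assumes noeth: "is_noetherian TYPE('a)" and loc: "is_local TYPE('a)"
    and m: "max_ideal = {a * x + b * y | a b. True}" and f: "\<not> x dvd f"
  shows "\<exists>u d g. u dvd 1 \<and> f = u * y ^ d + x * g"
proof -
  have "y \<in> max_ideal" using generators_mem(2) unfolding m .
  moreover have i: "is_ideal {s. x dvd s}" by (rule is_idealI) auto
  ultimately have "\<exists>d. \<not> (\<exists>h. f - y ^ d * h \<in> {s. x dvd s})"
    using krull_intersection[OF noeth loc i, of y f] f by blast
  then obtain d where d: "\<not> (\<exists>h. x dvd f - y ^ d * h)" and least: "\<And>e. e < d \<Longrightarrow> \<exists>h. x dvd f - y ^ e * h"
    using exists_least_iff[of "\<lambda>d. \<not> (\<exists>h. x dvd f - y ^ d * h)"] by auto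
  have "d \<noteq> 0" using d by (metis diff_self dvd_0_right mult_1 power_0)
  then obtain e where e: "d = Suc e" using not0_implies_Suc by blast
  then obtain h g where hg: "f - y ^ e * h = x * g" using least by blast
  have "h dvd 1"
  proof (rule ccontr)
    assume "\<not> h dvd 1"
    then have "h \<in> max_ideal" by (simp add: mem_max_ideal_iff[OF loc])
    then obtain a b where "h = a * x + b * y" unfolding m by blast
    then have "f - y ^ d * b = x * (g + y ^ e * a)" using hg unfolding e by (simp add: algebra_simps)
    then show False using d by (metis dvd_triv_left)
  qed
  moreover have "f = h * y ^ e + x * g" using hg by (simp add: algebra_simps)
  ultimately show ?thesis by blast
qed

text \<open>A variant of Krull's principal ideal theorem: the ideals containing \<open>x\<close> are generated by
  \<open>x\<close> and a power of \<open>y\<close>, so the descending chain \<open>Q n + (x)\<close> is stationary if \<open>x\<close> divides a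
  power of \<open>y\<close>.\<close>

lemma not_dvd_power_if_intermediate_prime:
  fixes x y f :: "'a::idom"
  assumes noeth: "is_noetherian TYPE('a)" and loc: "is_local TYPE('a)"
    and m: "max_ideal = {a * x + b * y | a b. True}"
    and P: "is_prime_ideal P" "P \<noteq> max_ideal" and f: "f \<in> P" "f \<noteq> 0"
  shows "\<not> x dvd y ^ e"
proof
  assume dvd: "x dvd y ^ e"
  have iP: "is_ideal P" and P1: "1 \<notin> P" and prime: "\<And>a b. a * b \<in> P \<Longrightarrow> a \<in> P \<or> b \<in> P"
    using P(1) is_ideal_UNIV_iff unfolding is_prime_ideal_def by blast+
  have sub: "P \<subseteq> max_ideal" by (rule prime_ideal_subset_max_ideal[OF loc P(1)])
  have xm: "x \<in> max_ideal" using generators_mem(1) unfolding m .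
  have xP: "x \<notin> P"
  proof
    assume x: "x \<in> P"
    then have ye: "y ^ e \<in> P" using dvd iP unfolding is_ideal_iff by (metis dvdE mult.commute)
    have "y \<in> P" using prime_ideal_power[OF P(1) ye] .
    then have "max_ideal \<subseteq> P" using x iP unfolding m is_ideal_iff by blast
    then show False using sub P(2) by blast
  qed
  \<comment> \<open>\<open>Q n\<close> is the contraction to \<open>R\<close> of the ideal generated
    by \<open>f ^ n\<close> in the localization at \<open>P\<close>.\<close>
  define Q where "Q n = {a. \<exists>s. s \<notin> P \<and> f ^ n dvd s * a}" for n
  have iQ: "is_ideal (Q n)" for n
  proof (rule is_idealI)
    show "0 \<in> Q n" using P1 by (auto simp: Q_def)
  next
    fix a b assume "a \<in> Q n" "b \<in> Q n"
    then obtain s t where st: "s \<notin> P" "t \<notin> P" "f ^ n dvd s * a" "f ^ n dvd t * b" unfolding Q_def by blast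
    have "(s * t) * (a + b) = t * (s * a) + s * (t * b)" by (simp add: algebra_simps)
    then have "f ^ n dvd (s * t) * (a + b)" using st by (metis dvd_add dvd_mult)
    moreover have "s * t \<notin> P" using prime st by blast
    ultimately show "a + b \<in> Q n" unfolding Q_def by blast
  next
    fix c a assume "a \<in> Q n"
    then obtain s where "s \<notin> P" "f ^ n dvd s * a" unfolding Q_def by blast
    then have "s \<notin> P" "f ^ n dvd c * (s * a)" by simp_all
    then show "c * a \<in> Q n" unfolding Q_def mem_Collect_eq by (metis mult.left_commute)
  qed
  have QSuc: "Q (Suc n) \<subseteq> Q n" for n unfolding Q_def power_Suc by (blast dest: dvd_mult_right)
  have Qx: "r \<in> Q n" if xr: "x * r \<in> Q n" for r n
  proof -
    obtain s where "s \<notin> P" "f ^ n dvd s * (x * r)" using xr unfolding Q_def by blast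
    then have "s * x \<notin> P" "f ^ n dvd (s * x) * r" using prime xP unfolding mult.assoc by blast+
    then show ?thesis unfolding Q_def by blast
  qed
  \<comment> \<open>The exponents \<open>j\<close> for which \<open>y ^ j\<close> lies in
    \<open>Q n + (x)\<close>. All of them include \<open>e\<close>, so the least exponents, which do
    not decrease with \<open>n\<close>, cannot grow at every step.\<close>
  define K where "K n = {j. \<exists>r. y ^ j + x * r \<in> Q n}" for n
  have "e \<in> K n" for n
  proof -
    obtain r where "y ^ e = x * r" using dvd by blast
    then have "y ^ e + x * (- r) = 0" by simp
    moreover have "0 \<in> Q n" using ideal_zero[OF iQ] .
    ultimately show ?thesis unfolding K_def mem_Collect_eq by metis
  qed
  define j where "j n = (LEAST j. j \<in> K n)" for n
  have jK: "j n \<in> K n" and je: "j n \<le> e" and jle: "\<And>i. i \<in> K n \<Longrightarrow> j n \<le> i" for n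
    unfolding j_def using \<open>e \<in> K n\<close> by (auto intro: LeastI Least_le)
  have jmono: "j n \<le> j (Suc n)" for n using jle jK[of "Suc n"] QSuc unfolding K_def by blast
  have "\<exists>n. j (Suc n) = j n"
  proof (rule ccontr)
    assume "\<not> ?thesis"
    then have "j n < j (Suc n)" for n using jmono[of n] by (metis le_neq_implies_less)
    then have "n \<le> j n" for n
    proof (induction n)
      case (Suc n) then show ?case by (metis Suc_leI le_less_trans)
    qed simp
    then show False using je[of "Suc e"] by (metis Suc_n_not_le_n order_trans)
  qed
  then obtain n where n: "j (Suc n) = j n" by blast
  obtain r where r: "y ^ j n + x * r \<in> Q (Suc n)" using jK[of "Suc n"] unfolding n K_def by blast
  \<comment> \<open>Equal least exponents give \<open>Q n = Q (Suc n) + x * Q n\<close>; the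
    cofactor stays in \<open>Q n\<close> because \<open>x\<close> lies outside \<open>P\<close> and
    can be cancelled.\<close>
  have step: "\<exists>b\<in>Q (Suc n). \<exists>c\<in>Q n. a = b + x * c" if a: "a \<in> Q n" for a
  proof (cases "x dvd a")
    case True
    then obtain r where r: "a = x * r" by blast
    moreover have "0 \<in> Q (Suc n)" using ideal_zero[OF iQ] .
    moreover have "r \<in> Q n" using a Qx unfolding r by blast
    ultimately show ?thesis by (metis add_0)
  next
    case False
    then obtain u l g where u: "u dvd 1" "a = u * y ^ l + x * g"
      using adic_expansion[OF noeth loc m] by blast
    then obtain u' where u': "u' * u = 1" by (metis dvdE mult.commute)
    have "u' * a = (u' * u) * y ^ l + x * (u' * g)" unfolding u(2) by (simp only: algebra_simps)
    then have "u' * a = y ^ l + x * (u' * g)" by (simp only: u' mult_1)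
    then have "y ^ l + x * (u' * g) \<in> Q n" using ideal_mult[OF iQ a] by metis
    then have l: "j n \<le> l" using jle unfolding K_def by blast
    let ?b = "(u * y ^ (l - j n)) * (y ^ j n + x * r)"
    have b: "?b \<in> Q (Suc n)" using ideal_mult[OF iQ r] .
    have "y ^ (l - j n) * y ^ j n = y ^ l" using l by (simp flip: power_add)
    then have eq: "a - ?b = x * (g - u * y ^ (l - j n) * r)" unfolding u(2) by (simp add: algebra_simps)
    have "a - ?b \<in> Q n" using a b QSuc is_ideal_diff[OF iQ] by blast
    then have "g - u * y ^ (l - j n) * r \<in> Q n" using eq Qx by simp
    then show ?thesis using b eq by (metis add.commute diff_add_cancel)
  qed
  have iter: "\<exists>c\<in>Q n. a - x ^ k * c \<in> Q (Suc n)" if "a \<in> Q n" for a k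
  proof (induction k)
    case 0
    then show ?case using that iQ[of "Suc n"] by (auto intro!: bexI[of _ a] simp: is_ideal_iff)
  next
    case (Suc k)
    then obtain c where c: "c \<in> Q n" "a - x ^ k * c \<in> Q (Suc n)" by blast
    then obtain b d where bd: "b \<in> Q (Suc n)" "d \<in> Q n" "c = b + x * d" using step by blast
    have "x ^ k * b \<in> Q (Suc n)" using ideal_mult[OF iQ bd(1)] .
    then have "(a - x ^ k * c) + x ^ k * b \<in> Q (Suc n)" using ideal_add[OF iQ c(2)] by blast
    then show ?case using bd by (auto intro!: bexI[of _ d] simp: algebra_simps)
  qed
  \<comment> \<open>By \<open>iter\<close>, \<open>f ^ n\<close> lies in
    \<open>Q (Suc n) + (x ^ k)\<close> for all \<open>k\<close>, hence in \<open>Q (Suc n)\<close>.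
    Locally at \<open>P\<close> it is then a multiple of \<open>f ^ Suc n\<close>, which would make
    \<open>f\<close> a unit there.\<close>
  have "f ^ n \<in> Q n" unfolding Q_def using P1 by (auto intro!: exI[of _ 1])
  then have "f ^ n \<in> Q (Suc n)"
    using krull_intersection[OF noeth loc iQ[of "Suc n"] xm, of "f ^ n"] iter by blast
  then obtain s where sP: "s \<notin> P" and dv: "f ^ Suc n dvd s * f ^ n" unfolding Q_def by blast
  then obtain t where "s * f ^ n = f ^ Suc n * t" by (elim dvdE)
  then have "s * f ^ n = (t * f) * f ^ n" by (simp add: algebra_simps)
  then have "s = t * f" using f by simp
  then show False using sP ideal_mult[OF iP f(1)] by blast
qed

lemma regular_parametersI:
  fixes x y f :: "'a::idom"
  assumes noeth: "is_noetherian TYPE('a)" and loc: "is_local TYPE('a)"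
    and m: "max_ideal = {a * x + b * y | a b. True}"
    and P: "is_prime_ideal P" "P \<noteq> max_ideal" and f: "f \<in> P" "f \<noteq> 0"
  shows "regular_parameters x y"
proof
  show not_dvd: "\<not> x dvd y ^ d" for d
    using not_dvd_power_if_intermediate_prime[OF assms] .
  show "\<not> r dvd 1 \<longleftrightarrow> (\<exists>a b. r = a * x + b * y)" for r
    using mem_max_ideal_iff[OF loc, of r] unfolding m by blast
  show "\<exists>u d g. u dvd 1 \<and> h = u * y ^ d + x * g" if "\<not> x dvd h" for h
    using adic_expansion[OF noeth loc m that] .
  \<comment> \<open>If \<open>x\<close> were zero, the element \<open>f\<close> of \<open>P\<close>
    would be a unit times a power of \<open>y\<close>. Then \<open>y\<close> lies in
    \<open>P\<close>, and \<open>P\<close> is the maximal ideal.\<close>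
  show "x \<noteq> 0"
  proof
    assume x: "x = 0"
    then obtain u d g where "u dvd 1" "f = u * y ^ d + x * g"
      using adic_expansion[OF noeth loc m, of f] f by auto
    then have "u * y ^ d \<in> P" "u dvd 1" using f x by auto
    then have "u \<in> P \<or> y ^ d \<in> P" using P(1) unfolding is_prime_ideal_def by blast
    moreover have iP: "is_ideal P" and P1: "1 \<notin> P"
      using P(1) is_ideal_UNIV_iff unfolding is_prime_ideal_def by blast+
    moreover have "u \<notin> P" using \<open>u dvd 1\<close> iP P1 unfolding is_ideal_iff by (metis dvdE mult.commute)
    ultimately have "y ^ d \<in> P" by blast
    then have "y \<in> P" using prime_ideal_power[OF P(1)] by blast
    then have sup: "max_ideal \<subseteq> P" using x iP unfolding m is_ideal_iff by auto
    have "P \<subseteq> max_ideal" by (rule prime_ideal_subset_max_ideal[OF loc P(1)])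
    then show False using sup P(2) by blast
  qed
  show "\<exists>i g. h = x ^ i * g \<and> \<not> x dvd g" if h: "h \<noteq> 0" for h
  proof -
    have xm: "x \<in> max_ideal" using generators_mem(1) unfolding m .
    have i: "is_ideal {0 :: 'a}" by (rule is_idealI) auto
    have "\<exists>d. \<not> x ^ d dvd h"
    proof (rule ccontr)
      assume "\<not> ?thesis"
      then have "\<exists>g. h - x ^ d * g \<in> {0}" for d by (metis dvdE eq_iff_diff_eq_0 singletonI)
      then show False using krull_intersection[OF noeth loc i xm, of h] h by blast
    qed
    then obtain d where d: "\<not> x ^ d dvd h" and least: "\<And>e. e < d \<Longrightarrow> x ^ e dvd h"
      using exists_least_iff[of "\<lambda>d. \<not> x ^ d dvd h"] by auto
    have "d \<noteq> 0" using d by (metis one_dvd power_0)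
    then obtain e where e: "d = Suc e" using not0_implies_Suc by blast
    then obtain g where g: "h = x ^ e * g" using least by blast
    then have "\<not> x dvd g" using d unfolding e by (metis dvd_triv_left mult_dvd_mono power_Suc2 dvd_refl)
    then show ?thesis using g by blast
  qed
qed

text \<open>The middle term of a chain of three primes. The dimension is a supremum, so such a chain
  is found by refuting that every chain has length at most 1.\<close>

lemma intermediate_prime:
  assumes loc: "is_local TYPE('a::idom)" and dim: "krull_dim TYPE('a) = 2"
  obtains P :: "'a::idom set" and f where "is_prime_ideal P" "P \<noteq> max_ideal" "f \<in> P" "f \<noteq> 0"
proof -
  let ?C = "\<lambda>n (P :: nat \<Rightarrow> 'a set). (\<forall>i\<le>n. is_prime_ideal (P i)) \<and> (\<forall>i<n. P i \<subset> P (Suc i))"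
  have "\<exists>n P. n \<ge> 2 \<and> ?C n P"
  proof (rule ccontr)
    assume no: "\<not> ?thesis"
    have "n \<le> 1" if P: "?C n P" for n P
    proof (rule ccontr)
      assume "\<not> n \<le> 1"
      then have "n \<ge> 2" by simp
      then show False using no P by blast
    qed
    then have "e \<le> 1" if e: "e \<in> {enat n | n. \<exists>P. ?C n P}" for e
      using e by (auto simp: one_enat_def)
    then have "Sup {enat n | n. \<exists>P. ?C n P} \<le> 1" by (rule Sup_least)
    then have "krull_dim TYPE('a) \<le> 1" unfolding krull_dim_def .
    then show False unfolding dim by (simp add: numeral_eq_enat one_enat_def)
  qed
  then obtain n P where nP: "n \<ge> 2" "?C n P" by blast
  have pr: "is_prime_ideal (P 0)" "is_prime_ideal (P 1)" "is_prime_ideal (P 2)"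
    using nP by auto
  have "P 0 \<subset> P (Suc 0)" "P (Suc 0) \<subset> P (Suc 1)" using nP by auto
  then have ch: "P 0 \<subset> P 1" "P 1 \<subset> P 2" by (simp_all add: numeral_2_eq_2)
  obtain f where f: "f \<in> P 1" "f \<notin> P 0" using ch by blast
  moreover have "f \<noteq> 0" using f(2) pr(1) unfolding is_prime_ideal_def is_ideal_iff by blast
  moreover have "P 1 \<noteq> max_ideal"
  proof
    assume "P 1 = max_ideal"
    moreover have "is_ideal (P 2)" "1 \<notin> P 2"
      using pr(3) is_ideal_UNIV_iff unfolding is_prime_ideal_def by blast+
    ultimately show False
      using ch(2) max_ideal_is_maximal[OF loc] unfolding is_maximal_ideal_def by blast
  qed
  ultimately show thesis using that pr(2) by blast
qed

text \<open>Both orders of the two generators are provided, since it depends on the valuation which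
  of them has the smallest value.\<close>

lemma regular_local_parameters:
  assumes reg: "is_regular_local TYPE('a::idom)" and dim: "krull_dim TYPE('a) = 2"
  obtains x y :: "'a::idom" where "max_ideal = {a * x + b * y | a b. True}"
    "regular_parameters x y" "regular_parameters y x"
proof -
  obtain B :: "'a set" where B: "finite B" "enat (card B) = 2" "ideal_gen B = max_ideal"
    and noeth: "is_noetherian TYPE('a)" and loc: "is_local TYPE('a)"
    using reg dim unfolding is_regular_local_def by auto
  have "card B = 2" using B(2) by (simp add: numeral_eq_enat)
  then obtain x y where xy: "B = {x, y}" by (auto simp: card_2_iff)
  have m: "max_ideal = {a * x + b * y | a b. True}" using B(3) ideal_gen_pair unfolding xy by metis
  then have m': "max_ideal = {a * y + b * x | a b. True}"
    unfolding m by (metis (lifting) add.commute)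
  obtain P :: "'a set" and f where "is_prime_ideal P" "P \<noteq> max_ideal" "f \<in> P" "f \<noteq> 0"
    using intermediate_prime[OF loc dim] .
  then show thesis
    using that[OF m] regular_parametersI[OF noeth loc m] regular_parametersI[OF noeth loc m'] by blast
qed

section \<open>The flag valuation\<close>

context regular_parameters
begin

lemma nonunit_combination: "\<not> (a * x + b * y) dvd 1"
  using nonunit_iff by blast

lemma y_nonzero: "y \<noteq> 0"
proof
  assume "y = 0"
  then have "x dvd y ^ 1" by simp
  then show False using not_dvd_power by blast
qed

lemma nonunit_x: "\<not> x dvd 1" and nonunit_y: "\<not> y dvd 1"
  using nonunit_combination[of 1 0] nonunit_combination[of 0 1] by simp_all

lemma unit_plus_nonunit:
  fixes u r :: 'a
  assumes u: "u dvd 1" and r: "\<not> r dvd 1"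
  shows "(u + r) dvd 1"
proof (rule ccontr)
  assume "\<not> (u + r) dvd 1"
  then obtain a b c d where "u + r = a * x + b * y" "r = c * x + d * y" using r nonunit_iff by metis
  then have "u = (a - c) * x + (b - d) * y" by (simp add: algebra_simps)
  then show False using u nonunit_iff by blast
qed

lemma nonunit_mult: "\<not> (a :: 'a) dvd 1 \<Longrightarrow> \<not> (a * b) dvd 1"
  by (metis dvd_mult_left)

lemma nonunit_xy: "\<not> (x * a) dvd 1" "\<not> (y * a) dvd 1"
  using nonunit_x nonunit_y nonunit_mult by blast+

lemma not_dvd_adic:
  assumes "u dvd 1"
  shows "\<not> x dvd u * y ^ d + x * g"
proof
  assume "x dvd u * y ^ d + x * g"
  then have "x dvd u * y ^ d" by (simp add: dvd_add_left_iff)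
  moreover obtain w where "1 = u * w" using assms by blast
  ultimately have "x dvd w * (u * y ^ d)" by simp
  moreover have "w * (u * y ^ d) = y ^ d" using \<open>1 = u * w\<close> by (metis mult.assoc mult.commute mult_1)
  ultimately show False using not_dvd_power by simp
qed

lemma adic_mult:
  assumes "f = u * y ^ d + x * g" "f' = u' * y ^ d' + x * g'"
  shows "f * f' = (u * u') * y ^ (d + d') + x * (g * (u' * y ^ d' + x * g') + u * y ^ d * g')"
  unfolding assms by (simp add: algebra_simps power_add)

text \<open>The product of two expansions \<open>u * y ^ d + x * g\<close> has again a unit times a
  power of \<open>y\<close> as its part outside \<open>(x)\<close>.\<close>

lemma prime_x: "x dvd a * b \<Longrightarrow> x dvd a \<or> x dvd b"
proof (rule ccontr)
  assume dvd: "x dvd a * b" and "\<not> (x dvd a \<or> x dvd b)"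
  then obtain u d g u' d' g' where u: "u dvd 1" "u' dvd 1" "a = u * y ^ d + x * g" "b = u' * y ^ d' + x * g'"
    using y_adic by meson
  then have "(u * u') dvd 1" using mult_dvd_mono[of u 1 u' 1] by simp
  then show False using not_dvd_adic dvd unfolding adic_mult[OF u(3,4)] by blast
qed

text \<open>\<open>flag f i d\<close> says that \<open>(i, d)\<close> is the value of \<open>f\<close> under the rank two valuation given by
  the order along \<open>x\<close> and then the order of the restriction to \<open>x = 0\<close>.\<close>

definition flag :: "'a \<Rightarrow> nat \<Rightarrow> nat \<Rightarrow> bool" where
  "flag f i d \<longleftrightarrow> (\<exists>u g. u dvd 1 \<and> f = x ^ i * (u * y ^ d + x * g))"

lemma flag_exists: "f \<noteq> 0 \<Longrightarrow> \<exists>i d. flag f i d"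
  using x_adic y_adic unfolding flag_def by metis

lemma flag_nonzero: "flag f i d \<Longrightarrow> f \<noteq> 0"
  unfolding flag_def using not_dvd_adic x_nonzero by (metis dvd_0_right mult_eq_0_iff power_not_zero)

lemma flag_mult: "flag f i d \<Longrightarrow> flag g j e \<Longrightarrow> flag (f * g) (i + j) (d + e)"
proof -
  assume "flag f i d" "flag g j e"
  then obtain u h u' h' where u: "u dvd 1" "f = x ^ i * (u * y ^ d + x * h)"
    "u' dvd 1" "g = x ^ j * (u' * y ^ e + x * h')" unfolding flag_def by blast
  have "f * g = x ^ (i + j) * ((u * y ^ d + x * h) * (u' * y ^ e + x * h'))"
    unfolding u(2,4) by (simp add: power_add algebra_simps)
  also have "\<dots> = x ^ (i + j) * ((u * u') * y ^ (d + e) + x * (h * (u' * y ^ e + x * h') + u * y ^ d * h'))"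
    by (simp only: adic_mult[OF refl refl])
  finally show ?thesis unfolding flag_def using u(1,3) by (metis mult_1 mult_dvd_mono)
qed

lemma flag_x: "flag x 1 0" and flag_y: "flag y 0 1" and flag_1: "flag 1 0 0"
  unfolding flag_def by (rule exI[of _ 1], rule exI[of _ 0], simp)+

lemma flag_power: "flag f i d \<Longrightarrow> flag (f ^ n) (i * n) (d * n)"
  by (induction n) (use flag_1 flag_mult in auto)

lemma flag_monomial: "flag (x ^ i * y ^ d) i d"
  using flag_mult[OF flag_power[OF flag_x, of i] flag_power[OF flag_y, of d]] by simp

text \<open>If two orders differed, cancelling the smaller power would leave an element of the form
  \<open>u * y ^ d + x * g\<close> with \<open>u\<close> a unit that is divisible by
  \<open>x\<close>.\<close>

lemma flag_unique:
  assumes "flag f i d" "flag f j e"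
  shows "i = j \<and> d = e"
proof -
  obtain u h u' h' where u: "u dvd 1" "f = x ^ i * (u * y ^ d + x * h)"
    "u' dvd 1" "f = x ^ j * (u' * y ^ e + x * h')" using assms unfolding flag_def by blast
  have le: "j \<le> i" if "p dvd 1" "q dvd 1" "x ^ i * (p * y ^ d + x * h) = x ^ j * (q * y ^ e + x * h')" for i j d e h h' p q
  proof (rule ccontr)
    assume "\<not> j \<le> i"
    then have "x ^ j = x ^ i * (x * x ^ (j - i - 1))" by (simp flip: power_add power_Suc)
    then have "x ^ i * (p * y ^ d + x * h) = x ^ i * (x * (x ^ (j - i - 1) * (q * y ^ e + x * h')))"
      using that(3) by (simp only: mult.assoc)
    then have "p * y ^ d + x * h = x * (x ^ (j - i - 1) * (q * y ^ e + x * h'))" using x_nonzero by simp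
    then show False using not_dvd_adic[OF that(1)] by (metis dvd_triv_left)
  qed
  have ij: "i = j" using le[of u u' i d h j e h'] le[of u' u j e h' i d h] u by simp
  then have eq: "u * y ^ d + x * h = u' * y ^ e + x * h'" using u x_nonzero by simp
  have le2: "e \<le> d" if "p dvd 1" "q dvd 1" "p * y ^ d + x * h = q * y ^ e + x * h'" for d e h h' p q
  proof (rule ccontr)
    assume "\<not> e \<le> d"
    then have e: "y ^ e = y ^ d * (y * y ^ (e - d - 1))" by (simp flip: power_add power_Suc)
    have "(p - q * (y * y ^ (e - d - 1))) * y ^ d + x * 0 = p * y ^ d - q * y ^ e"
      unfolding e by (simp add: algebra_simps)
    also have "\<dots> = x * (h' - h)" using that(3) by (simp add: algebra_simps)
    finally have eq: "(p - q * (y * y ^ (e - d - 1))) * y ^ d + x * 0 = x * (h' - h)" .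
    have "p - q * (y * y ^ (e - d - 1)) = p + y * (- q * y ^ (e - d - 1))" by (simp add: algebra_simps)
    then have "(p - q * (y * y ^ (e - d - 1))) dvd 1" using unit_plus_nonunit[OF that(1) nonunit_xy(2)] by metis
    then show False using not_dvd_adic eq by (metis dvd_triv_left)
  qed
  show ?thesis using ij le2[OF u(1,3) eq] le2[OF u(3,1) eq[symmetric]] by simp
qed

text \<open>Scaling by the quotient of the two units removes the whole term in \<open>y ^ d\<close>.
  So the order along \<open>x\<close> itself rises, and approximations can proceed by induction on
  powers of \<open>x\<close> alone.\<close>

lemma flag_cancel:
  assumes "flag f i d" "flag a i d"
  shows "\<exists>c. x ^ Suc i dvd f - c * a"
proof -
  obtain u h u' h' where u: "u dvd 1" "f = x ^ i * (u * y ^ d + x * h)"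
    "u' dvd 1" "a = x ^ i * (u' * y ^ d + x * h')" using assms unfolding flag_def by blast
  then obtain w where w: "1 = u' * w" by blast
  have "f - (u * w) * a = x ^ i * (u * y ^ d - u * (u' * w) * y ^ d + x * (h - u * w * h'))"
    unfolding u(2,4) by (simp add: algebra_simps)
  also have "\<dots> = x ^ Suc i * (h - u * w * h')" by (simp add: w[symmetric])
  finally show ?thesis by (metis dvd_triv_left)
qed

text \<open>If \<open>A\<close> attained every flag value of \<open>B\<close>, subtracting elements
  of \<open>A\<close> from \<open>b\<close> would raise the power of \<open>x\<close> dividing the
  remainder one step at a time. Once it reaches \<open>x ^ N\<close>, an element of
  \<open>A\<close>, this puts \<open>b\<close> into \<open>A\<close>.\<close>

lemma new_flag_value:
  assumes A: "is_ideal A" and B: "is_ideal B" and sub: "A \<subseteq> B" and N: "x ^ N \<in> A"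
    and b: "b \<in> B" "b \<notin> A"
  shows "\<exists>f i d. f \<in> B \<and> flag f i d \<and> (\<forall>a\<in>A. \<not> flag a i d)"
proof (rule ccontr)
  assume "\<not> ?thesis"
  then have ex: "\<exists>a\<in>A. flag a i d" if "f \<in> B" "flag f i d" for f i d using that by blast
  have step: "\<exists>a\<in>A. x ^ Suc i dvd f - a" if f: "f \<in> B" "x ^ i dvd f" for f i
  proof (cases "x ^ Suc i dvd f")
    case True
    then show ?thesis using ideal_zero[OF A] by (metis diff_zero)
  next
    case False
    obtain g where g: "f = x ^ i * g" using f by blast
    then have "\<not> x dvd g" using False by (metis mult_dvd_mono dvd_refl power_Suc2)
    then have "\<exists>d. flag f i d" using y_adic g unfolding flag_def by metis
    then obtain d a where "flag f i d" "a \<in> A" "flag a i d" using ex f by blast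
    then obtain c where "x ^ Suc i dvd f - c * a" using flag_cancel by blast
    then show ?thesis using ideal_mult[OF A \<open>a \<in> A\<close>] by blast
  qed
  have "\<exists>a\<in>A. x ^ k dvd b - a" for k
  proof (induction k)
    case 0
    then show ?case using ideal_zero[OF A] by auto
  next
    case (Suc k)
    then obtain a where a: "a \<in> A" "x ^ k dvd b - a" by blast
    then have "b - a \<in> B" using b sub is_ideal_diff[OF B] by blast
    then obtain a' where "a' \<in> A" "x ^ Suc k dvd (b - a) - a'" using step a by blast
    then have "a + a' \<in> A" "x ^ Suc k dvd b - (a + a')"
      using ideal_add[OF A a(1)] by (simp_all add: diff_diff_eq)
    then show ?case by blast
  qed
  then obtain a c where "a \<in> A" "b - a = x ^ N * c" by (metis dvdE)
  then have "b = c * x ^ N + a" by (simp add: algebra_simps)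
  moreover have "c * x ^ N + a \<in> A" by (rule ideal_add[OF A ideal_mult[OF A N] \<open>a \<in> A\<close>])
  ultimately show False using b by simp
qed

end

section \<open>Quadratic asymptotics of counting functions\<close>

lemma tendsto_shifted_quotient:
  fixes L :: "nat \<Rightarrow> real"
  assumes "(\<lambda>n. L n / (real n)\<^sup>2) \<longlonglongrightarrow> c"
  shows "(\<lambda>n. L (n + r) / (real n)\<^sup>2) \<longlonglongrightarrow> c"
proof -
  have "(\<lambda>n. real r * (1 / real n)) \<longlonglongrightarrow> real r * 0"
    by (intro tendsto_mult tendsto_const lim_1_over_n)
  then have "(\<lambda>n. (1 + real r * (1 / real n))\<^sup>2) \<longlonglongrightarrow> (1 + real r * 0)\<^sup>2"
    by (intro tendsto_power tendsto_add tendsto_const)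
  moreover have "(\<lambda>n. L (n + r) / (real (n + r))\<^sup>2) \<longlonglongrightarrow> c"
    using LIMSEQ_ignore_initial_segment[OF assms, of r] .
  ultimately have "(\<lambda>n. L (n + r) / (real (n + r))\<^sup>2 * (1 + real r * (1 / real n))\<^sup>2) \<longlonglongrightarrow> c * (1 + real r * 0)\<^sup>2"
    by (intro tendsto_mult)
  moreover have "L (n + r) / (real (n + r))\<^sup>2 * (1 + real r * (1 / real n))\<^sup>2 = L (n + r) / (real n)\<^sup>2"
    if "n \<ge> 1" for n
  proof -
    have "1 + real r * (1 / real n) = real (n + r) / real n" using that by (simp add: field_simps)
    then show ?thesis using that by (simp add: power_divide)
  qed
  then have "\<forall>\<^sub>F n in sequentially. L (n + r) / (real (n + r))\<^sup>2 * (1 + real r * (1 / real n))\<^sup>2 = L (n + r) / (real n)\<^sup>2"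
    by (auto simp: eventually_sequentially)
  ultimately show ?thesis by (auto dest: Lim_transform_eventually)
qed

text \<open>Serves to drop the value 0, which \<open>phi\<close> excludes but the lattice point
  \<open>(0, 0)\<close> contributes.\<close>

lemma tendsto_quotient_pred:
  fixes f g :: "nat \<Rightarrow> nat"
  assumes lim: "(\<lambda>n. real (f n) / (real n)\<^sup>2) \<longlonglongrightarrow> c" and Suc: "\<And>n. n \<ge> 1 \<Longrightarrow> f n = Suc (g n)"
  shows "(\<lambda>n. real (g n) / (real n)\<^sup>2) \<longlonglongrightarrow> c"
proof -
  have "(\<lambda>n. (1 / real n)\<^sup>2) \<longlonglongrightarrow> 0\<^sup>2" by (intro tendsto_power lim_1_over_n)
  with lim have "(\<lambda>n. real (f n) / (real n)\<^sup>2 - (1 / real n)\<^sup>2) \<longlonglongrightarrow> c - 0\<^sup>2"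
    by (rule tendsto_diff)
  moreover have "real (f n) / (real n)\<^sup>2 - (1 / real n)\<^sup>2 = real (g n) / (real n)\<^sup>2" if "n \<ge> 1" for n
    using Suc[OF that] by (simp add: power_divide add_divide_distrib)
  then have "\<forall>\<^sub>F n in sequentially. real (f n) / (real n)\<^sup>2 - (1 / real n)\<^sup>2 = real (g n) / (real n)\<^sup>2"
    by (auto simp: eventually_sequentially)
  ultimately show ?thesis by (auto dest: Lim_transform_eventually)
qed

lemma sum_descending: "(\<Sum>i<n. real n - real i) = real n * (real n + 1) / 2"
proof (induction n)
  case (Suc n)
  have "(\<Sum>i<Suc n. real (Suc n) - real i) = (\<Sum>i<n. (real n - real i) + 1) + 1"
    by (simp add: algebra_simps)
  also have "\<dots> = (\<Sum>i<n. real n - real i) + real n + 1" by (simp add: sum.distrib)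
  finally show ?case using Suc by (simp add: field_simps)
qed simp

text \<open>The set contains the lattice points of a triangle with legs \<open>n\<close> and
  \<open>s * n\<close>, and lies under staircases with steps of width \<open>m\<close> and height
  \<open>D\<close> whose slopes \<open>D / m\<close> come arbitrarily close to \<open>s\<close>.
  Both counts are governed by the area \<open>s * n\<^sup>2 / 2\<close>.\<close>

lemma lattice_count_limit:
  fixes A :: "nat \<Rightarrow> (nat \<times> nat) set"
  assumes s: "s \<ge> 0"
    and lower: "\<And>n i d. s * real i + real d < s * real n \<Longrightarrow> (i, d) \<in> A n"
    and upper: "\<And>\<epsilon>. \<epsilon> > 0 \<Longrightarrow> \<exists>D m. D \<ge> 1 \<and> m > 0 \<and> real D / m < s + \<epsilon> \<and>
      (\<forall>n i d. (i, d) \<in> A n \<longrightarrow> real i + real (d div D) * m < real n)"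
  shows "(\<lambda>n. real (card (A n)) / (real n)\<^sup>2) \<longlonglongrightarrow> s / 2"
proof -
  \<comment> \<open>Column \<open>i\<close> has fewer than \<open>(n - i) / m + 1\<close> blocks of
    \<open>D\<close> points; the rounding costs \<open>D * n\<close> in all, which is negligible
    against \<open>n\<^sup>2\<close>.\<close>
  have upper_card: "finite (A n) \<and> real (card (A n)) \<le> real D / m * (real n * (real n + 1) / 2) + real D * real n"
    if D: "D \<ge> 1" "m > 0" "\<forall>n i d. (i, d) \<in> A n \<longrightarrow> real i + real (d div D) * m < real n" for D m n
  proof -
    let ?B = "Sigma {..<n} (\<lambda>i. {..<D * nat \<lceil>(real n - real i) / m\<rceil>})"
    have sub: "A n \<subseteq> ?B"
    proof (rule subrelI)
      fix i d assume "(i, d) \<in> A n"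
      then have lt: "real i + real (d div D) * m < real n" using D by blast
      have "0 \<le> real (d div D) * m" using D by simp
      then have i: "i < n" using lt by linarith
      have "real (d div D) < (real n - real i) / m" using lt D by (simp add: field_simps)
      then have "d div D < nat \<lceil>(real n - real i) / m\<rceil>" by linarith
      then have "d < D * nat \<lceil>(real n - real i) / m\<rceil>"
        using D(1) by (simp add: div_less_iff_less_mult mult.commute)
      then show "(i, d) \<in> ?B" using i by simp
    qed
    have fin: "finite ?B" by auto
    have "real (card (A n)) \<le> real (card ?B)" using card_mono[OF fin sub] by (rule of_nat_mono)
    also have "\<dots> = (\<Sum>i<n. real D * real (nat \<lceil>(real n - real i) / m\<rceil>))" by simp
    also have "\<dots> \<le> (\<Sum>i<n. real D * ((real n - real i) / m + 1))"
    proof (intro sum_mono mult_left_mono)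
      fix i assume "i \<in> {..<n}"
      then have "0 \<le> (real n - real i) / m" using D by simp
      then show "real (nat \<lceil>(real n - real i) / m\<rceil>) \<le> (real n - real i) / m + 1" by linarith
    qed simp
    also have "\<dots> = real D / m * (\<Sum>i<n. real n - real i) + real D * real n"
      by (simp add: sum.distrib sum_distrib_left algebra_simps sum_divide_distrib sum_subtractf diff_divide_distrib)
    finally show ?thesis using finite_subset[OF sub fin] by (simp add: sum_descending)
  qed
  have lower_card: "s / 2 * (real n)\<^sup>2 \<le> real (card (A n))" for n
  proof -
    let ?B = "Sigma {..<n} (\<lambda>i. {..<nat \<lceil>s * (real n - real i)\<rceil>})"
    have "?B \<subseteq> A n"
    proof (rule subrelI)
      fix i d assume "(i, d) \<in> ?B"
      then have "d < nat \<lceil>s * (real n - real i)\<rceil>" by simp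
      then have "real d < s * (real n - real i)" by (simp add: less_ceiling_iff zless_nat_eq_int_zless)
      then show "(i, d) \<in> A n" using lower by (simp add: algebra_simps)
    qed
    moreover have "finite (A n)" using upper[of 1] upper_card by auto
    ultimately have "card ?B \<le> card (A n)" by (intro card_mono)
    moreover have "real (card ?B) = (\<Sum>i<n. real (nat \<lceil>s * (real n - real i)\<rceil>))" by simp
    moreover have "(\<Sum>i<n. s * (real n - real i)) \<le> (\<Sum>i<n. real (nat \<lceil>s * (real n - real i)\<rceil>))"
      by (intro sum_mono) linarith
    moreover have "(\<Sum>i<n. s * (real n - real i)) = s * (real n * (real n + 1) / 2)"
      by (simp add: sum_distrib_left[symmetric] sum_descending)
    moreover have "s / 2 * (real n)\<^sup>2 \<le> s * (real n * (real n + 1) / 2)"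
      using s by (simp add: power2_eq_square algebra_simps)
    ultimately show ?thesis by linarith
  qed
  show ?thesis
  proof (rule order_tendstoI)
    fix a assume a: "a < s / 2"
    have "a < real (card (A n)) / (real n)\<^sup>2" if "n \<ge> 1" for n
    proof -
      have "s / 2 \<le> real (card (A n)) / (real n)\<^sup>2" using lower_card[of n] that by (simp add: field_simps)
      then show ?thesis using a by linarith
    qed
    then show "\<forall>\<^sub>F n in sequentially. a < real (card (A n)) / (real n)\<^sup>2"
      by (auto simp: eventually_sequentially)
  next
    fix a assume "s / 2 < a"
    \<comment> \<open>This is the \<open>\<epsilon>\<close> for which
      \<open>(s + \<epsilon>) / 2\<close> equals \<open>a\<close>.\<close>
    then have "2 * a - s > 0" by simp
    then obtain D m where D: "D \<ge> 1" "m > 0" "real D / m < s + (2 * a - s)"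
      "\<forall>n i d. (i, d) \<in> A n \<longrightarrow> real i + real (d div D) * m < real n" using upper by blast
    have "(\<lambda>n. real D / m / 2 * (1 + 1 / real n) + real D * (1 / real n)) \<longlonglongrightarrow> real D / m / 2 * (1 + 0) + real D * 0"
      by (intro tendsto_intros lim_1_over_n)
    moreover have "real D / m / 2 * (1 + 0) + real D * 0 < a" using D(3) by simp
    ultimately have "\<forall>\<^sub>F n in sequentially. real D / m / 2 * (1 + 1 / real n) + real D * (1 / real n) < a"
      by (rule order_tendstoD(2))
    then show "\<forall>\<^sub>F n in sequentially. real (card (A n)) / (real n)\<^sup>2 < a"
      using eventually_ge_at_top[of 1]
    proof eventually_elim
      case (elim n)
      have "real (card (A n)) / (real n)\<^sup>2 \<le> (real D / m * (real n * (real n + 1) / 2) + real D * real n) / (real n)\<^sup>2"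
        using upper_card[OF D(1,2,4)] by (intro divide_right_mono) auto
      also have "\<dots> = real D / m / 2 * (1 + 1 / real n) + real D * (1 / real n)"
        using elim(2) D(2) by (simp add: field_simps power2_eq_square)
      finally show ?case using elim(1) by linarith
    qed
  qed
qed

section \<open>Counting values\<close>

text \<open>Values are recorded on \<open>R\<close> only and in the reals, so that the quotient
  field and abstract value groups enter only at the end.\<close>

locale dominating_valuation = regular_parameters x y for x y :: "'a::idom" +
  fixes v :: "'a \<Rightarrow> real"
  assumes v_mult: "f \<noteq> 0 \<Longrightarrow> g \<noteq> 0 \<Longrightarrow> v (f * g) = v f + v g"
    and v_add: "f \<noteq> 0 \<Longrightarrow> g \<noteq> 0 \<Longrightarrow> f + g \<noteq> 0 \<Longrightarrow> min (v f) (v g) \<le> v (f + g)"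
    and v_unit: "f dvd 1 \<Longrightarrow> v f = 0"
    and v_nonunit: "f \<noteq> 0 \<Longrightarrow> \<not> f dvd 1 \<Longrightarrow> 1 \<le> v f"
    and v_x: "v x = 1"
begin

lemma v_nonneg: "f \<noteq> 0 \<Longrightarrow> 0 \<le> v f"
  using v_unit[of f] v_nonunit[of f] by fastforce

lemma v_power: "f \<noteq> 0 \<Longrightarrow> v (f ^ n) = real n * v f"
proof (induction n)
  case 0
  then show ?case using v_unit[of 1] by simp
next
  case (Suc n)
  then show ?case by (simp add: v_mult algebra_simps)
qed

lemma v_y: "1 \<le> v y"
  using v_nonunit y_nonzero nonunit_y by blast

lemma v_monomial: "v (x ^ i * y ^ d) = real i + real d * v y"
  using x_nonzero y_nonzero by (simp add: v_mult v_power v_x)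

definition value_set :: "real set" where
  "value_set = v ` (- {0})"

text \<open>The flag values attained by the ideal \<open>v \<ge> l\<close> but not by the ideal
  \<open>v > l\<close>; their number is the \<open>\<delta> l\<close> of the overview.\<close>

definition fiber_max :: "real \<Rightarrow> (nat \<times> nat) set" where
  "fiber_max l = {(i, d). (\<exists>f. flag f i d \<and> v f = l) \<and> (\<forall>f. flag f i d \<longrightarrow> v f \<le> l)}"

text \<open>The flag values missed by the ideal \<open>v \<ge> n\<close>; their number is the length
  of the quotient of \<open>R\<close> by that ideal.\<close>

definition below :: "nat \<Rightarrow> (nat \<times> nat) set" where
  "below n = {(i, d). \<forall>f. flag f i d \<longrightarrow> v f < real n}"

lemma value_set_nonneg: "l \<in> value_set \<Longrightarrow> 0 \<le> l"
  unfolding value_set_def using v_nonneg by auto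

lemma value_set_add: "l \<in> value_set \<Longrightarrow> k \<in> value_set \<Longrightarrow> l + k \<in> value_set"
  unfolding value_set_def image_iff by (metis Compl_iff mult_eq_0_iff singletonD singletonI v_mult)

lemma is_ideal_ge: "is_ideal {f. f = 0 \<or> l \<le> v f}"
proof (rule is_idealI)
  fix a b assume "a \<in> {f. f = 0 \<or> l \<le> v f}" "b \<in> {f. f = 0 \<or> l \<le> v f}"
  then show "a + b \<in> {f. f = 0 \<or> l \<le> v f}" using v_add[of a b] by fastforce
next
  fix c a assume "a \<in> {f. f = 0 \<or> l \<le> v f}"
  then show "c * a \<in> {f. f = 0 \<or> l \<le> v f}" using v_mult[of c a] v_nonneg[of c] by fastforce
qed simp

lemma is_ideal_gt: "is_ideal {f. f = 0 \<or> l < v f}"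
proof (rule is_idealI)
  fix a b assume "a \<in> {f. f = 0 \<or> l < v f}" "b \<in> {f. f = 0 \<or> l < v f}"
  then show "a + b \<in> {f. f = 0 \<or> l < v f}" using v_add[of a b] by fastforce
next
  fix c a assume "a \<in> {f. f = 0 \<or> l < v f}"
  then show "c * a \<in> {f. f = 0 \<or> l < v f}" using v_mult[of c a] v_nonneg[of c] by fastforce
qed simp

lemma power_x_gt: "\<exists>N. l < v (x ^ N)"
  using x_nonzero by (simp add: v_power v_x reals_Archimedean2)

lemma below_bound: "(i, d) \<in> below n \<Longrightarrow> i + d < n"
proof -
  assume "(i, d) \<in> below n"
  then have "v (x ^ i * y ^ d) < real n" using flag_monomial unfolding below_def by blast
  moreover have "real d \<le> real d * v y" using v_y by (simp add: mult_le_cancel_left1)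
  ultimately have "real i + real d < real n" unfolding v_monomial by linarith
  then show ?thesis by linarith
qed

lemma finite_below: "finite (below n)"
proof (rule finite_subset)
  show "below n \<subseteq> {..<n} \<times> {..<n}" using below_bound by fastforce
qed simp

text \<open>An element of value \<open>l\<close> makes the inclusion of the two valuation ideals at
  \<open>l\<close> strict, and a strict inclusion shows in the flag values.\<close>

lemma fiber_max_nonempty: "l \<in> value_set \<Longrightarrow> fiber_max l \<noteq> {}"
proof -
  assume "l \<in> value_set"
  then obtain b where b: "b \<noteq> 0" "v b = l" unfolding value_set_def by auto
  obtain N where N: "l < v (x ^ N)" using power_x_gt by blast
  have "\<exists>f i d. f \<in> {f. f = 0 \<or> l \<le> v f} \<and> flag f i d \<and> (\<forall>a\<in>{f. f = 0 \<or> l < v f}. \<not> flag a i d)"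
    by (rule new_flag_value[OF is_ideal_gt is_ideal_ge, of l l N b]) (use b N in auto)
  then obtain f i d where f: "f = 0 \<or> l \<le> v f" "flag f i d" "\<And>a. l < v a \<Longrightarrow> \<not> flag a i d" by blast
  have "v f = l" using f flag_nonzero by force
  then have "(i, d) \<in> fiber_max l" unfolding fiber_max_def using f by force
  then show ?thesis by blast
qed

lemma fiber_max_subset_below: "l < real n \<Longrightarrow> fiber_max l \<subseteq> below n"
  unfolding fiber_max_def below_def by fastforce

lemma fiber_max_disjoint: "l \<noteq> k \<Longrightarrow> fiber_max l \<inter> fiber_max k = {}"
  unfolding fiber_max_def by fastforce

lemma finite_fiber_max: "finite (fiber_max l)"
  using finite_subset[OF fiber_max_subset_below finite_below] reals_Archimedean2[of l] by blast

text \<open>Distinct values have disjoint nonempty fibers in the finite set \<open>below n\<close>,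
  so the values are discrete.\<close>

lemma finite_value_set_less: "finite (value_set \<inter> {..<real n})"
proof -
  have "\<exists>p. p \<in> fiber_max l" if "l \<in> value_set" for l using fiber_max_nonempty[OF that] by blast
  then obtain p where p: "\<And>l. l \<in> value_set \<Longrightarrow> p l \<in> fiber_max l" by metis
  have "inj_on p (value_set \<inter> {..<real n})"
    using p fiber_max_disjoint by (intro inj_onI) (metis IntD1 disjoint_iff)
  moreover have "p ` (value_set \<inter> {..<real n}) \<subseteq> below n"
    using p fiber_max_subset_below by fastforce
  ultimately show ?thesis using finite_below inj_on_finite by blast
qed

lemma below_eq: "below n = (\<Union>l\<in>value_set \<inter> {..<real n}. fiber_max l)"
proof
  show "(\<Union>l\<in>value_set \<inter> {..<real n}. fiber_max l) \<subseteq> below n" using fiber_max_subset_below by auto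
  show "below n \<subseteq> (\<Union>l\<in>value_set \<inter> {..<real n}. fiber_max l)"
  proof (rule subrelI)
    fix i d assume b: "(i, d) \<in> below n"
    let ?V = "v ` {f. flag f i d}"
    \<comment> \<open>Only finitely many values lie under \<open>n\<close>, so \<open>v\<close>
      attains a maximum on the elements with flag value \<open>(i, d)\<close>; that maximum is the
      \<open>l\<close> to whose fiber the point belongs.\<close>
    have sub: "?V \<subseteq> value_set \<inter> {..<real n}"
      using b flag_nonzero unfolding below_def value_set_def by auto
    then have fin: "finite ?V" using finite_value_set_less finite_subset by blast
    have ne: "?V \<noteq> {}" using flag_monomial by blast
    have mem: "Max ?V \<in> ?V" using Max_in[OF fin ne] .
    have "v f \<le> Max ?V" if "flag f i d" for f using fin that by (intro Max_ge) auto
    then have "(i, d) \<in> fiber_max (Max ?V)" unfolding fiber_max_def using mem by fastforce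
    then show "(i, d) \<in> (\<Union>l\<in>value_set \<inter> {..<real n}. fiber_max l)" using mem sub by blast
  qed
qed

lemma card_below: "card (below n) = (\<Sum>l\<in>value_set \<inter> {..<real n}. card (fiber_max l))"
  unfolding below_eq using finite_value_set_less finite_fiber_max fiber_max_disjoint
  by (intro card_UN_disjoint) auto

text \<open>Multiplication by an element of value \<open>k\<close> maps the chain of ideals defined by the flag
  valuation between value_set \<open>> l\<close> and \<open>\<ge> l\<close> to a strict chain at \<open>l + k\<close>, and every strict
  step contributes a new flag value.\<close>

lemma card_fiber_max_mono:
  assumes k: "k \<in> value_set"
  shows "card (fiber_max l) \<le> card (fiber_max (l + k))"
proof -
  obtain h where h: "h \<noteq> 0" "v h = k" using k unfolding value_set_def by auto
  obtain N where N: "l + k < v (x ^ N)" using power_x_gt by blast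
  \<comment> \<open>\<open>U i d\<close> is the ideal of elements whose flag value is
    lexicographically at least \<open>(i, d)\<close>, together with 0. Replacing \<open>d\<close> by
    \<open>Suc d\<close> makes the inequality strict.\<close>
  define U where "U i d = {x ^ i * (r * y ^ d + x * s) | r s. True}" for i d
  have ideal_U: "is_ideal (U i d)" for i d
  proof (rule is_idealI)
    have "0 = x ^ i * (0 * y ^ d + x * 0)" by simp
    then show "0 \<in> U i d" unfolding U_def by blast
  next
    fix a b assume "a \<in> U i d" "b \<in> U i d"
    then obtain r s r' s' where "a = x ^ i * (r * y ^ d + x * s)" "b = x ^ i * (r' * y ^ d + x * s')"
      unfolding U_def by auto
    then have "a + b = x ^ i * ((r + r') * y ^ d + x * (s + s'))" by (simp add: algebra_simps)
    then show "a + b \<in> U i d" unfolding U_def by blast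
  next
    fix c a assume "a \<in> U i d"
    then obtain r s where "a = x ^ i * (r * y ^ d + x * s)" unfolding U_def by auto
    then have "c * a = x ^ i * ((c * r) * y ^ d + x * (c * s))" by (simp add: algebra_simps)
    then show "c * a \<in> U i d" unfolding U_def by blast
  qed
  have U_mono: "U i' d' \<subseteq> U i (Suc d)" if lt: "i < i' \<or> i = i' \<and> d < d'" for i d i' d'
  proof
    fix a assume "a \<in> U i' d'"
    then obtain r s where a: "a = x ^ i' * (r * y ^ d' + x * s)" unfolding U_def by auto
    show "a \<in> U i (Suc d)"
    proof (cases "i < i'")
      case True
      then have "x ^ i' = x ^ i * (x * x ^ (i' - i - 1))" by (simp flip: power_add power_Suc)
      then have "a = x ^ i * (0 * y ^ Suc d + x * (x ^ (i' - i - 1) * (r * y ^ d' + x * s)))"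
        unfolding a by (simp add: mult.assoc)
      then show ?thesis unfolding U_def by blast
    next
      case False
      then have e: "i' = i" "Suc d \<le> d'" using lt by auto
      then have "y ^ d' = y ^ (d' - Suc d) * y ^ Suc d" by (simp only: power_add[symmetric] le_add_diff_inverse2)
      then have "a = x ^ i * ((r * y ^ (d' - Suc d)) * y ^ Suc d + x * s)" unfolding a e(1) by (simp only: mult.assoc)
      then show ?thesis unfolding U_def by blast
    qed
  qed
  let ?G = "{f. f = 0 \<or> l + k < v f}" and ?J = "{f. f = 0 \<or> l \<le> v f}"
  \<comment> \<open>A chain of ideals between \<open>v > l + k\<close> and
    \<open>v \<ge> l + k\<close>, decreasing in the lexicographic order of \<open>(i, d)\<close>.
    Adding \<open>?G\<close> allows for elements of larger value that are not multiples of
    \<open>h\<close>.\<close>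
  define Y where "Y i d = {h * f + j | f j. f \<in> ?J \<inter> U i d \<and> j \<in> ?G}" for i d
  have ideal_Y: "is_ideal (Y i d)" for i d
  proof (rule is_idealI)
    have "0 = h * 0 + (0::'a)" "0 \<in> ?J \<inter> U i d" using ideal_zero[OF ideal_U] by auto
    then show "0 \<in> Y i d" unfolding Y_def by blast
  next
    fix a b assume "a \<in> Y i d" "b \<in> Y i d"
    then obtain f j f' j' where f: "a = h * f + j" "f \<in> ?J" "f \<in> U i d" "j \<in> ?G"
      "b = h * f' + j'" "f' \<in> ?J" "f' \<in> U i d" "j' \<in> ?G"
      unfolding Y_def by blast
    then have "a + b = h * (f + f') + (j + j')" by (simp add: algebra_simps)
    moreover have "f + f' \<in> ?J \<inter> U i d" "j + j' \<in> ?G"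
      using ideal_add[OF is_ideal_ge f(2,6)] ideal_add[OF ideal_U f(3,7)] ideal_add[OF is_ideal_gt f(4,8)]
      by blast+
    ultimately show "a + b \<in> Y i d" unfolding Y_def by blast
  next
    fix c a assume "a \<in> Y i d"
    then obtain f j where f: "a = h * f + j" "f \<in> ?J" "f \<in> U i d" "j \<in> ?G"
      unfolding Y_def by blast
    then have "c * a = h * (c * f) + c * j" by (simp add: algebra_simps)
    moreover have "c * f \<in> ?J \<inter> U i d" "c * j \<in> ?G"
      using ideal_mult[OF is_ideal_ge f(2)] ideal_mult[OF ideal_U f(3)] ideal_mult[OF is_ideal_gt f(4)]
      by blast+
    ultimately show "c * a \<in> Y i d" unfolding Y_def by blast
  qed
  have G_Y: "?G \<subseteq> Y i d" for i d
  proof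
    fix j assume "j \<in> ?G"
    moreover have "j = h * 0 + j" "0 \<in> ?J \<inter> U i d" using ideal_zero[OF ideal_U] by auto
    ultimately show "j \<in> Y i d" unfolding Y_def by blast
  qed
  have Y_mono: "Y i' d' \<subseteq> Y i (Suc d)" if lt: "i < i' \<or> i = i' \<and> d < d'" for i d i' d'
    unfolding Y_def using U_mono[OF lt] by blast
  have U_Suc: "U i (Suc d) \<subseteq> U i d" for i d
  proof
    fix a assume "a \<in> U i (Suc d)"
    then obtain r s where "a = x ^ i * (r * y ^ Suc d + x * s)" unfolding U_def by blast
    then have "a = x ^ i * ((r * y) * y ^ d + x * s)" by (simp add: mult.assoc)
    then show "a \<in> U i d" unfolding U_def by blast
  qed
  have Y_Suc: "Y i (Suc d) \<subseteq> Y i d" for i d unfolding Y_def using U_Suc by blast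
  have Y_ge: "f = 0 \<or> l + k \<le> v f" if "f \<in> Y i d" for f i d
  proof -
    obtain g j where g: "f = h * g + j" "g \<in> ?J" "j \<in> ?G" using \<open>f \<in> Y i d\<close> unfolding Y_def by blast
    have "h * g \<in> {f. f = 0 \<or> l + k \<le> v f}" using g(2) v_mult[of h g] h by (cases "g = 0") auto
    moreover have "j \<in> {f. f = 0 \<or> l + k \<le> v f}" using g(3) by auto
    ultimately have "h * g + j \<in> {f. f = 0 \<or> l + k \<le> v f}" by (rule ideal_add[OF is_ideal_ge])
    then show ?thesis using g(1) by simp
  qed
  have xN: "x ^ N \<in> Y i d" for i d using N G_Y by blast
  have ex: "\<exists>q. q \<in> fiber_max (l + k) \<and> (\<exists>f\<in>Y i d. flag f (fst q) (snd q)) \<and>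
      (\<forall>a\<in>Y i (Suc d). \<not> flag a (fst q) (snd q))" if p: "(i, d) \<in> fiber_max l" for i d
  proof -
    obtain g where g: "flag g i d" "v g = l" using p unfolding fiber_max_def by blast
    obtain u r where u: "u dvd 1" "g = x ^ i * (u * y ^ d + x * r)" using g(1) unfolding flag_def by blast
    then have "g \<in> ?J \<inter> U i d" unfolding U_def using g(2) by blast
    moreover have "h * g = h * g + 0" "0 \<in> ?G" by auto
    ultimately have hg: "h * g \<in> Y i d" unfolding Y_def by blast
    \<comment> \<open>The step is strict at a point of \<open>fiber_max l\<close>: membership would
      make \<open>h * (g - f)\<close> an element of value above \<open>l + k\<close>, but
      \<open>g - f\<close> keeps the flag value \<open>(i, d)\<close>, on which \<open>v\<close> is
      at most \<open>l\<close>.\<close>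
    have "h * g \<notin> Y i (Suc d)"
    proof
      assume "h * g \<in> Y i (Suc d)"
      then obtain f j where f: "h * g = h * f + j" "f \<in> U i (Suc d)" "j \<in> ?G" unfolding Y_def by blast
      then have j: "j = h * (g - f)" by (simp add: algebra_simps)
      obtain r' s' where r': "f = x ^ i * (r' * y ^ Suc d + x * s')" using f(2) unfolding U_def by blast
      have "g - f = x ^ i * ((u + y * (- r')) * y ^ d + x * (r - s'))"
        unfolding u(2) r' by (simp add: algebra_simps)
      moreover have "(u + y * (- r')) dvd 1" by (rule unit_plus_nonunit[OF u(1) nonunit_xy(2)])
      ultimately have fl: "flag (g - f) i d" unfolding flag_def by blast
      then have nz: "g - f \<noteq> 0" by (rule flag_nonzero)
      have le: "v (g - f) \<le> l" using p fl unfolding fiber_max_def by blast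
      have "j \<noteq> 0" using j h nz by simp
      then have "l + k < v j" using f(3) by blast
      then show False using le v_mult[OF h(1) nz] h(2) j by simp
    qed
    then obtain f i' d' where f: "f \<in> Y i d" "flag f i' d'" "\<forall>a\<in>Y i (Suc d). \<not> flag a i' d'"
      using new_flag_value[OF ideal_Y ideal_Y Y_Suc xN hg] by blast
    have "f \<noteq> 0" using flag_nonzero f(2) by blast
    have no: "\<not> l + k < v a" if a: "flag a i' d'" for a using f(3) G_Y[of i "Suc d"] a by blast
    then have "v f = l + k" using Y_ge[OF f(1)] \<open>f \<noteq> 0\<close> f(2) by force
    then have "(i', d') \<in> fiber_max (l + k)" unfolding fiber_max_def using f(2) no by force
    then show ?thesis using f by (intro exI[of _ "(i', d')"]) auto
  qed
  define good where "good p q \<longleftrightarrow> q \<in> fiber_max (l + k) \<and> (\<exists>f\<in>Y (fst p) (snd p). flag f (fst q) (snd q)) \<and>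
      (\<forall>a\<in>Y (fst p) (Suc (snd p)). \<not> flag a (fst q) (snd q))" for p q
  have "\<exists>q. good p q" if "p \<in> fiber_max l" for p
    unfolding good_def by (rule ex) (use that in simp)
  then obtain q where q: "\<And>p. p \<in> fiber_max l \<Longrightarrow> good p (q p)" by metis
  \<comment> \<open>For \<open>p\<close> before \<open>p'\<close>, the flag value
    \<open>q p'\<close> is attained in the ideal at \<open>p'\<close>, which lies in the ideal just
    after \<open>p\<close>, where \<open>q p\<close> is no longer attained.\<close>
  have ne: "q p \<noteq> q p'" if p: "p \<in> fiber_max l" "p' \<in> fiber_max l"
    and lt: "fst p < fst p' \<or> fst p = fst p' \<and> snd p < snd p'" for p p'
    using q[OF p(1)] q[OF p(2)] Y_mono[OF lt] unfolding good_def by auto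
  have "inj_on q (fiber_max l)"
  proof (rule inj_onI, rule ccontr)
    fix p p' assume p: "p \<in> fiber_max l" "p' \<in> fiber_max l" "q p = q p'" "p \<noteq> p'"
    then have "(fst p < fst p' \<or> fst p = fst p' \<and> snd p < snd p') \<or> (fst p' < fst p \<or> fst p' = fst p \<and> snd p' < snd p)"
      by (auto simp: prod_eq_iff)
    then show False using ne p by metis
  qed
  moreover have "q ` fiber_max l \<subseteq> fiber_max (l + k)" using q unfolding good_def by blast
  ultimately show ?thesis using finite_fiber_max by (rule card_inj_on_le)
qed

lemma zero_in_value_set: "0 \<in> value_set"
  unfolding value_set_def using v_unit[of 1] by (intro image_eqI[of _ _ 1]) auto

text \<open>Monotonicity of \<open>\<delta>\<close> gives each translate by \<open>l\<close> of a
  value below \<open>n\<close> a fiber of at least \<open>c\<close> points, and \<open>r\<close>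
  absorbs the translation.\<close>

lemma value_set_shift_count:
  assumes l: "l \<in> value_set" and c: "c \<le> card (fiber_max l)" and r: "l \<le> real r"
  shows "c * card (value_set \<inter> {..<real n}) \<le> card (below (n + r))"
proof -
  have "c * card (value_set \<inter> {..<real n}) = (\<Sum>k\<in>value_set \<inter> {..<real n}. c)" by simp
  also have "\<dots> \<le> (\<Sum>k\<in>value_set \<inter> {..<real n}. card (fiber_max (l + k)))"
    using c card_fiber_max_mono[of _ l] by (intro sum_mono) (meson IntD1 le_trans)
  also have "\<dots> = (\<Sum>k\<in>(+) l ` (value_set \<inter> {..<real n}). card (fiber_max k))"
    by (subst sum.reindex) auto
  also have "\<dots> \<le> (\<Sum>k\<in>value_set \<inter> {..<real (n + r)}. card (fiber_max k))"
    using l r by (intro sum_mono2 finite_value_set_less) (auto simp: value_set_add)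
  finally show ?thesis by (simp add: card_below)
qed

text \<open>Products of elements add flag values and values of \<open>v\<close>, so the largest
  \<open>v\<close> for flag value \<open>(0, d)\<close> is superadditive in \<open>d\<close> and the
  infimum of \<open>d / v f\<close> is its reciprocal growth rate. For fixed \<open>d\<close> the
  values \<open>v f\<close> may be unbounded; the slope is then 0.\<close>

definition slope :: real where
  "slope = Inf {real d / v f | f d. flag f 0 d \<and> d \<ge> 1}"

lemma v_flag_pos:
  assumes "flag f 0 d" "d \<ge> 1"
  shows "1 \<le> v f"
proof (rule v_nonunit)
  show "f \<noteq> 0" using assms flag_nonzero by blast
  show "\<not> f dvd 1"
  proof
    assume "f dvd 1"
    then have "flag f 0 0" unfolding flag_def by (intro exI[of _ f] exI[of _ 0]) simp
    then show False using flag_unique[OF assms(1)] assms(2) by fastforce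
  qed
qed

lemma slope_le:
  assumes "flag f 0 d" "d \<ge> 1"
  shows "slope * v f \<le> real d"
proof -
  have "slope \<le> real d / v f" unfolding slope_def
  proof (rule cInf_lower)
    show "bdd_below {real d / v f | f d. flag f 0 d \<and> d \<ge> 1}"
    proof (rule bdd_belowI[of _ 0])
      fix a assume "a \<in> {real d / v f | f d. flag f 0 d \<and> d \<ge> 1}"
      then obtain f d where "a = real d / v f" "flag f 0 d" "d \<ge> 1" by blast
      then show "0 \<le> a" using v_flag_pos[of f d] by simp
    qed
  qed (use assms in blast)
  then show ?thesis using v_flag_pos[OF assms] by (simp add: field_simps)
qed

lemma slope_nonneg: "0 \<le> slope"
  unfolding slope_def
proof (rule cInf_greatest)
  show "{real d / v f | f d. flag f 0 d \<and> d \<ge> 1} \<noteq> {}" using flag_y by blast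
  fix a assume "a \<in> {real d / v f | f d. flag f 0 d \<and> d \<ge> 1}"
  then obtain f d where "a = real d / v f" "flag f 0 d" "d \<ge> 1" by blast
  then show "0 \<le> a" using v_flag_pos[of f d] by simp
qed

text \<open>Writing an element as \<open>x ^ i * g\<close> bounds its value by
  \<open>i + d / slope\<close> when the slope is positive, which gives the triangle. An element that
  nearly attains the infimum gives the staircase through its powers.\<close>

lemma below_limit: "(\<lambda>n. real (card (below n)) / (real n)\<^sup>2) \<longlonglongrightarrow> slope / 2"
proof (rule lattice_count_limit[OF slope_nonneg])
  fix n i d assume lt: "slope * real i + real d < slope * real n"
  then have "slope \<noteq> 0" by auto
  then have pos: "slope > 0" using slope_nonneg by simp
  have "v f < real n" if f: "flag f i d" for f
  proof -
    obtain u g where u: "u dvd 1" "f = x ^ i * (u * y ^ d + x * g)" using f unfolding flag_def by blast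
    let ?g = "u * y ^ d + x * g"
    have fl: "flag ?g 0 d" unfolding flag_def using u(1) by auto
    have nz: "?g \<noteq> 0" using flag_nonzero[OF fl] .
    have vf: "v f = real i + v ?g" unfolding u(2) using v_mult[of "x ^ i" ?g] x_nonzero nz by (simp add: v_power v_x)
    have "slope * v ?g \<le> real d"
    proof (cases "d = 0")
      case True
      then have "?g dvd 1" using unit_plus_nonunit[OF u(1) nonunit_xy(1)] by simp
      then show ?thesis using v_unit by simp
    next
      case False
      then show ?thesis using slope_le[OF fl] by simp
    qed
    then have "slope * v f < slope * real n" unfolding vf using lt by (simp add: algebra_simps)
    then show ?thesis using pos by simp
  qed
  then show "(i, d) \<in> below n" unfolding below_def by blast
next
  fix \<epsilon> :: real assume "\<epsilon> > 0"
  then have lt: "Inf {real d / v f | f d. flag f 0 d \<and> d \<ge> 1} < slope + \<epsilon>" unfolding slope_def by simp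
  have ne: "{real d / v f | f d. flag f 0 d \<and> d \<ge> 1} \<noteq> {}" using flag_y by blast
  obtain f D where f: "flag f 0 D" "D \<ge> 1" "real D / v f < slope + \<epsilon>"
    using cInf_lessD[OF ne lt] by blast
  have "real i + real (d div D) * v f < real n" if b: "(i, d) \<in> below n" for n i d
  proof -
    \<comment> \<open>As many factors \<open>f\<close> as the order \<open>d\<close> permits, the
      rest filled up with \<open>y\<close>: an element of flag value \<open>(i, d)\<close> and large
      \<open>v\<close>.\<close>
    let ?g = "x ^ i * y ^ (d mod D) * f ^ (d div D)"
    have "flag ?g i d" using flag_mult[OF flag_monomial[of i "d mod D"] flag_power[OF f(1), of "d div D"]] by simp
    then have "v ?g < real n" using b unfolding below_def by blast
    moreover have "v ?g = real i + real (d mod D) * v y + real (d div D) * v f"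
      using flag_nonzero[OF f(1)] flag_nonzero[OF flag_monomial[of i "d mod D"]]
      by (subst v_mult) (auto simp: v_power v_monomial)
    moreover have "0 \<le> real (d mod D) * v y" using v_y by simp
    ultimately show ?thesis by linarith
  qed
  then show "\<exists>D m. D \<ge> 1 \<and> m > 0 \<and> real D / m < slope + \<epsilon> \<and>
      (\<forall>n i d. (i, d) \<in> below n \<longrightarrow> real i + real (d div D) * m < real n)"
    using f v_flag_pos[OF f(1,2)] by (intro exI[of _ D] exI[of _ "v f"]) auto
qed

lemma slope_le_1: "slope \<le> 1"
proof -
  have "slope * v y \<le> 1" using slope_le[OF flag_y] by simp
  moreover have "slope * 1 \<le> slope * v y" using slope_nonneg v_y by (intro mult_left_mono)
  ultimately show ?thesis by simp
qed

text \<open>This is why \<open>1/2\<close> is not a limit. With slope 1 no element of flag value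
  \<open>(0, 1)\<close> has value above 1, so \<open>x\<close> and \<open>y\<close> occupy two
  different points of the fiber over 1.\<close>

lemma two_le_card_fiber_max:
  assumes "slope = 1"
  shows "2 \<le> card (fiber_max 1)"
proof -
  have "v f \<le> 1" if "flag f 0 1" for f using slope_le[OF that] assms by simp
  moreover from this have "v y = 1" using flag_y v_y by force
  ultimately have "(0, 1) \<in> fiber_max 1" unfolding fiber_max_def using flag_y by blast
  moreover have "v f = 1" if f: "flag f 1 0" for f
  proof -
    obtain u g where u: "u dvd 1" "f = x * (u + x * g)" using f unfolding flag_def by auto
    have unit: "(u + x * g) dvd 1" using unit_plus_nonunit[OF u(1) nonunit_xy(1)] .
    then have "u + x * g \<noteq> 0" by auto
    then show ?thesis using v_mult[OF x_nonzero] v_unit[OF unit] u(2) v_x by simp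
  qed
  then have "(1, 0) \<in> fiber_max 1" unfolding fiber_max_def using flag_x v_x by force
  ultimately have "card {(0 :: nat, 1 :: nat), (1, 0)} \<le> card (fiber_max 1)"
    by (intro card_mono finite_fiber_max) auto
  then show ?thesis by simp
qed

lemma value_set_count_limit:
  obtains L where "0 \<le> L" "L < 1 / 2" "(\<lambda>n. real (card (value_set \<inter> {..<real n})) / (real n)\<^sup>2) \<longlonglongrightarrow> L"
proof (cases "\<exists>M. \<forall>l\<in>value_set. card (fiber_max l) \<le> M")
  case True
  then obtain M where M: "\<And>l. l \<in> value_set \<Longrightarrow> card (fiber_max l) \<le> M" by blast
  let ?C = "(\<lambda>l. card (fiber_max l)) ` value_set"
  have fin: "finite ?C" by (rule finite_subset[of _ "{..M}"]) (use M in auto)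
  have ne: "?C \<noteq> {}" using zero_in_value_set by blast
  define c where "c = Max ?C"
  have c_max: "card (fiber_max l) \<le> c" if "l \<in> value_set" for l
    unfolding c_def using fin that by (intro Max_ge) auto
  \<comment> \<open>At \<open>l\<close> the maximum \<open>c\<close> of \<open>\<delta>\<close> is
    attained, hence also on the translate of the semigroup by \<open>l\<close>. The value count is
    thus squeezed between \<open>1 / c\<close> times the lattice counts for \<open>n\<close> and for
    \<open>n + r\<close>.\<close>
  obtain l where l: "l \<in> value_set" "card (fiber_max l) = c" using Max_in[OF fin ne] unfolding c_def by force
  have c_pos: "c > 0" using l fiber_max_nonempty[OF l(1)] finite_fiber_max card_gt_0_iff by metis
  obtain r where r: "l \<le> real r" using real_arch_simple by blast
  have lo: "real (card (below n)) / (real n)\<^sup>2 / real c \<le> real (card (value_set \<inter> {..<real n})) / (real n)\<^sup>2" for n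
  proof -
    have "card (below n) \<le> (\<Sum>l\<in>value_set \<inter> {..<real n}. c)"
      unfolding card_below using c_max by (intro sum_mono) auto
    then have "card (below n) \<le> card (value_set \<inter> {..<real n}) * c" by simp
    then have "real (card (below n)) \<le> real (card (value_set \<inter> {..<real n})) * real c"
      by (metis of_nat_le_iff of_nat_mult)
    then have "real (card (below n)) / real c \<le> real (card (value_set \<inter> {..<real n}))"
      using c_pos by (simp add: field_simps)
    then have "real (card (below n)) / real c / (real n)\<^sup>2 \<le> real (card (value_set \<inter> {..<real n})) / (real n)\<^sup>2"
      by (intro divide_right_mono) auto
    then show ?thesis by (simp add: mult.commute)
  qed
  have up: "real (card (value_set \<inter> {..<real n})) / (real n)\<^sup>2 \<le> real (card (below (n + r))) / (real n)\<^sup>2 / real c" for n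
  proof -
    have "c * card (value_set \<inter> {..<real n}) \<le> card (below (n + r))"
      using value_set_shift_count[OF l(1) _ r] l(2) by simp
    then have "real c * real (card (value_set \<inter> {..<real n})) \<le> real (card (below (n + r)))"
      by (metis of_nat_le_iff of_nat_mult)
    then have "real (card (value_set \<inter> {..<real n})) \<le> real (card (below (n + r))) / real c"
      using c_pos by (simp add: field_simps)
    then have "real (card (value_set \<inter> {..<real n})) / (real n)\<^sup>2 \<le> real (card (below (n + r))) / real c / (real n)\<^sup>2"
      by (intro divide_right_mono) auto
    then show ?thesis by (simp add: mult.commute)
  qed
  have "(\<lambda>n. real (card (value_set \<inter> {..<real n})) / (real n)\<^sup>2) \<longlonglongrightarrow> slope / 2 / real c"
  proof (rule tendsto_sandwich[OF always_eventually always_eventually])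
    show "(\<lambda>n. real (card (below n)) / (real n)\<^sup>2 / real c) \<longlonglongrightarrow> slope / 2 / real c"
      using c_pos by (intro tendsto_divide below_limit tendsto_const) auto
    show "(\<lambda>n. real (card (below (n + r))) / (real n)\<^sup>2 / real c) \<longlonglongrightarrow> slope / 2 / real c"
      using c_pos by (intro tendsto_divide tendsto_shifted_quotient below_limit tendsto_const) auto
  qed (use lo up in auto)
  moreover have "slope / 2 / real c < 1 / 2"
  proof (cases "slope = 1")
    case True
    have "v x \<in> value_set" unfolding value_set_def using x_nonzero by blast
    then have "2 \<le> c" using two_le_card_fiber_max[OF True] c_max[of 1] by (simp add: v_x)
    then show ?thesis using True by (simp add: field_simps)
  next
    case False
    then have "slope / 2 < 1 / 2" using slope_le_1 by simp
    moreover have "slope / 2 / real c \<le> slope / 2 / 1" using c_pos slope_nonneg by (intro divide_left_mono) auto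
    ultimately show ?thesis by simp
  qed
  moreover have "0 \<le> slope / 2 / real c" using slope_nonneg by simp
  ultimately show thesis using that by blast
next
  case False
  have "(\<lambda>n. real (card (value_set \<inter> {..<real n})) / (real n)\<^sup>2) \<longlonglongrightarrow> 0"
  proof (rule order_tendstoI)
    fix a :: real assume "a < 0"
    moreover have "0 \<le> real (card (value_set \<inter> {..<real n})) / (real n)\<^sup>2" for n by simp
    ultimately have "a < real (card (value_set \<inter> {..<real n})) / (real n)\<^sup>2" for n by (rule less_le_trans)
    then show "\<forall>\<^sub>F n in sequentially. a < real (card (value_set \<inter> {..<real n})) / (real n)\<^sup>2"
      by (rule always_eventually[rule_format])
  next
    fix a :: real assume a: "0 < a"
    \<comment> \<open>The shifted lattice count over \<open>n\<^sup>2\<close> is eventually less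
      than \<open>slope / 2 + 1\<close>; fibers with at least \<open>c\<close> points then bring the
      value count over \<open>n\<^sup>2\<close> below \<open>a\<close>.\<close>
    obtain c where c: "slope / 2 + 1 < real c * a" using a reals_Archimedean3 by blast
    obtain l where l: "l \<in> value_set" "c \<le> card (fiber_max l)" using False by (meson linear)
    obtain r where r: "l \<le> real r" using real_arch_simple by blast
    have "c \<noteq> 0" using c slope_nonneg by (intro notI) simp
    then have "0 < real c" by simp
    have "\<forall>\<^sub>F n in sequentially. real (card (below (n + r))) / (real n)\<^sup>2 < slope / 2 + 1"
      using tendsto_shifted_quotient[OF below_limit] by (rule order_tendstoD) simp
    then show "\<forall>\<^sub>F n in sequentially. real (card (value_set \<inter> {..<real n})) / (real n)\<^sup>2 < a"
    proof eventually_elim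
      case (elim n)
      have "real c * real (card (value_set \<inter> {..<real n})) \<le> real (card (below (n + r)))"
        using value_set_shift_count[OF l r, of n] by (metis of_nat_le_iff of_nat_mult)
      then have "real c * real (card (value_set \<inter> {..<real n})) / (real n)\<^sup>2 \<le> real (card (below (n + r))) / (real n)\<^sup>2"
        by (intro divide_right_mono) auto
      then have "real c * (real (card (value_set \<inter> {..<real n})) / (real n)\<^sup>2) < real c * a"
        using elim c by simp
      then show ?case using \<open>0 < real c\<close> mult_less_cancel_left_pos[of "real c"] by blast
    qed
  qed
  then show thesis using that[of 0] by simp
qed

lemma positive_value_set_count_limit:
  obtains L where "0 \<le> L" "L < 1 / 2" "(\<lambda>n. real (card (value_set \<inter> {0<..<real n})) / (real n)\<^sup>2) \<longlonglongrightarrow> L"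
proof -
  obtain L where L: "0 \<le> L" "L < 1 / 2"
    "(\<lambda>n. real (card (value_set \<inter> {..<real n})) / (real n)\<^sup>2) \<longlonglongrightarrow> L" by (rule value_set_count_limit)
  have "card (value_set \<inter> {..<real n}) = Suc (card (value_set \<inter> {0<..<real n}))" if n: "n \<ge> 1" for n
  proof -
    have "value_set \<inter> {..<real n} = insert 0 (value_set \<inter> {0<..<real n})"
      using zero_in_value_set value_set_nonneg n by force
    moreover have "finite (value_set \<inter> {0<..<real n})"
      by (rule finite_subset[OF _ finite_value_set_less[of n]]) auto
    ultimately show ?thesis by simp
  qed
  with tendsto_quotient_pred[OF L(3)]
  have "(\<lambda>n. real (card (value_set \<inter> {0<..<real n})) / (real n)\<^sup>2) \<longlonglongrightarrow> L" .
  then show thesis using that L(1,2) by blast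
qed

end

section \<open>Valuations defined by key elements\<close>

lemma filter_replicate_mset_if:
  "filter_mset P (replicate_mset m c) = (if P c then replicate_mset m c else {#})"
  by (induction m) auto

section \<open>Powers of the maximal ideal and independence of monomials\<close>

context regular_parameters
begin

text \<open>The powers of the ideal \<open>(x, y)\<close>; the recursion on the two generators is
  what \<open>mpow_decompose\<close> unwinds.\<close>

primrec mpow :: "nat \<Rightarrow> 'a set" where
  "mpow 0 = UNIV"
| "mpow (Suc n) = {x * f + y * g | f g. f \<in> mpow n \<and> g \<in> mpow n}"

lemma is_ideal_mpow: "is_ideal (mpow n)"
proof (induction n)
  case 0
  show ?case by (simp add: is_ideal_iff)
next
  case (Suc n)
  show ?case
  proof (rule is_idealI)
    have "0 = x * 0 + y * 0" by simp
    then show "0 \<in> mpow (Suc n)" using ideal_zero[OF Suc] unfolding mpow.simps by blast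
  next
    fix a b assume "a \<in> mpow (Suc n)" "b \<in> mpow (Suc n)"
    then obtain f g f' g' where f: "a = x * f + y * g" "b = x * f' + y * g'"
      "f \<in> mpow n" "g \<in> mpow n" "f' \<in> mpow n" "g' \<in> mpow n" by auto
    then have "a + b = x * (f + f') + y * (g + g')" by (simp add: algebra_simps)
    then show "a + b \<in> mpow (Suc n)"
      using ideal_add[OF Suc f(3,5)] ideal_add[OF Suc f(4,6)] unfolding mpow.simps by blast
  next
    fix c a assume "a \<in> mpow (Suc n)"
    then obtain f g where f: "a = x * f + y * g" "f \<in> mpow n" "g \<in> mpow n" by auto
    then have "c * a = x * (c * f) + y * (c * g)" by (simp add: algebra_simps)
    then show "c * a \<in> mpow (Suc n)"
      using ideal_mult[OF Suc f(2)] ideal_mult[OF Suc f(3)] unfolding mpow.simps by blast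
  qed
qed

lemma mpow_Suc_subset: "mpow (Suc n) \<subseteq> mpow n"
proof (induction n)
  case (Suc n)
  show ?case
  proof
    fix a assume "a \<in> mpow (Suc (Suc n))"
    then obtain f g where f: "a = x * f + y * g" "f \<in> mpow (Suc n)" "g \<in> mpow (Suc n)"
      unfolding mpow.simps(2)[of "Suc n"] by blast
    then have "f \<in> mpow n" "g \<in> mpow n" using Suc by blast+
    then show "a \<in> mpow (Suc n)" using f(1) unfolding mpow.simps by blast
  qed
qed simp

lemma mpow_antimono: "m \<le> n \<Longrightarrow> mpow n \<subseteq> mpow m"
  using lift_Suc_antimono_le[of mpow m n] mpow_Suc_subset by blast

lemma mpow_mult: "f \<in> mpow m \<Longrightarrow> g \<in> mpow n \<Longrightarrow> f * g \<in> mpow (m + n)"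
proof (induction m arbitrary: f)
  case 0
  then show ?case using ideal_mult[OF is_ideal_mpow] by simp
next
  case (Suc m)
  then obtain h k where f: "f = x * h + y * k" "h \<in> mpow m" "k \<in> mpow m" by auto
  then have "f * g = x * (h * g) + y * (k * g)" by (simp add: algebra_simps)
  then show ?case using Suc.IH[OF f(2) Suc.prems(2)] Suc.IH[OF f(3) Suc.prems(2)] by auto
qed

lemma x_in_mpow: "x \<in> mpow 1" and y_in_mpow: "y \<in> mpow 1"
proof -
  have "x = x * 1 + y * 0" "y = x * 0 + y * 1" by simp_all
  then show "x \<in> mpow 1" "y \<in> mpow 1" unfolding One_nat_def mpow.simps by blast+
qed

lemma power_in_mpow: "f \<in> mpow m \<Longrightarrow> f ^ k \<in> mpow (k * m)"
proof (induction k)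
  case (Suc k)
  then show ?case using mpow_mult[of f m "f ^ k" "k * m"] by simp
qed simp

text \<open>Among the monomials of degree \<open>Suc n\<close> only \<open>y ^ Suc n\<close> is not
  divisible by \<open>x\<close>.\<close>

lemma mpow_decompose: "f \<in> mpow (Suc n) \<Longrightarrow> \<exists>g r. g \<in> mpow n \<and> f = x * g + r * y ^ Suc n"
proof (induction n arbitrary: f)
  case 0
  then show ?case by (auto simp: mult.commute)
next
  case (Suc n)
  then obtain g h where f: "f = x * g + y * h" "g \<in> mpow (Suc n)" "h \<in> mpow (Suc n)"
    unfolding mpow.simps(2)[of "Suc n"] by blast
  then obtain k r where h: "k \<in> mpow n" "h = x * k + r * y ^ Suc n" using Suc.IH by blast
  have "y * k \<in> mpow (Suc n)" using mpow_mult[OF y_in_mpow h(1)] by simp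
  then have "g + y * k \<in> mpow (Suc n)" by (rule ideal_add[OF is_ideal_mpow f(2)])
  moreover have "f = x * (g + y * k) + r * y ^ Suc (Suc n)" unfolding f(1) h(2) by (simp add: algebra_simps)
  ultimately show ?case by blast
qed

declare mpow.simps(2) [simp del]

text \<open>In \<open>x * f = x * g + r * y ^ Suc n\<close> the prime \<open>x\<close> must divide
  \<open>r\<close>. In other words, the initial form of \<open>x\<close> is not a zero divisor in
  the associated graded ring.\<close>

lemma mpow_cancel_x: "x * f \<in> mpow (Suc n) \<Longrightarrow> f \<in> mpow n"
proof -
  assume "x * f \<in> mpow (Suc n)"
  then obtain g r where g: "g \<in> mpow n" "x * f = x * g + r * y ^ Suc n" using mpow_decompose by blast
  then have "x * (f - g) = r * y ^ Suc n" by (simp add: algebra_simps)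
  then have "x dvd r * y ^ Suc n" by (metis dvd_triv_left)
  then have "x dvd r" using prime_x not_dvd_power by blast
  then obtain r' where "r = x * r'" by blast
  then have "x * (f - g) = x * (r' * y ^ Suc n)" using \<open>x * (f - g) = r * y ^ Suc n\<close> by (simp only: mult.assoc)
  then have "f - g = r' * y ^ Suc n" using x_nonzero by simp
  moreover have "y ^ Suc n \<in> mpow (Suc n)"
    using power_in_mpow[OF y_in_mpow, of "Suc n"] by (simp only: mult_1_right)
  then have "r' * y ^ Suc n \<in> mpow n"
    using mpow_Suc_subset[of n] by (intro ideal_mult is_ideal_mpow) blast
  ultimately show ?thesis using ideal_add[OF is_ideal_mpow g(1)] by (metis add.commute diff_add_cancel)
qed

lemma mpow_cancel_power_x: "x ^ k * f \<in> mpow (k + n) \<Longrightarrow> f \<in> mpow n"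
proof (induction k)
  case (Suc k)
  then show ?case using mpow_cancel_x[of "x ^ k * f" "k + n"] by (simp add: mult.assoc)
qed simp

lemma unit_power_y_notin_mpow:
  assumes "u dvd 1"
  shows "u * y ^ e + x * g \<notin> mpow (Suc e)"
proof
  assume "u * y ^ e + x * g \<in> mpow (Suc e)"
  then obtain h r where "u * y ^ e + x * g = x * h + r * y ^ Suc e" using mpow_decompose by blast
  then have eq: "(u + y * (- r)) * y ^ e + x * (g - h) = 0" by (simp add: algebra_simps)
  have "(u + y * (- r)) dvd 1" using unit_plus_nonunit[OF assms nonunit_xy(2)] .
  then show False using not_dvd_adic[of "u + y * (- r)" e "g - h"] eq by simp
qed

text \<open>The smallest power of \<open>x\<close> occurs in a single term; after cancelling it a
  unit times a power of \<open>y\<close> remains modulo \<open>x\<close>. This is the independence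
  of monomials over the residue field, with units standing for nonzero residue classes.\<close>

lemma homogeneous_notin_mpow:
  assumes fin: "finite F" and ne: "F \<noteq> {}" and deg: "\<And>p. p \<in> F \<Longrightarrow> fst p + snd p = D"
    and unit: "\<And>p. p \<in> F \<Longrightarrow> u p dvd 1"
  shows "(\<Sum>p\<in>F. u p * (x ^ fst p * y ^ snd p)) \<notin> mpow (Suc D)"
proof
  assume mem: "(\<Sum>p\<in>F. u p * (x ^ fst p * y ^ snd p)) \<in> mpow (Suc D)"
  define i where "i = Min (fst ` F)"
  have "i \<in> fst ` F" unfolding i_def using fin ne by (intro Min_in) auto
  then obtain p where p: "p \<in> F" "fst p = i" by auto
  have le: "i \<le> fst q" if "q \<in> F" for q unfolding i_def using fin that by (intro Min_le) auto
  have lt: "i < fst q" if "q \<in> F" "q \<noteq> p" for q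
  proof -
    have "fst q \<noteq> i" using deg[OF p(1)] deg[OF that(1)] that(2) p(2) by (metis add_left_cancel prod_eqI)
    then show ?thesis using le[OF that(1)] by simp
  qed
  define g where "g = (\<Sum>q\<in>F - {p}. u q * (x ^ (fst q - i - 1) * y ^ snd q))"
  have "(\<Sum>q\<in>F - {p}. u q * (x ^ fst q * y ^ snd q)) = (\<Sum>q\<in>F - {p}. x ^ Suc i * (u q * (x ^ (fst q - i - 1) * y ^ snd q)))"
  proof (rule sum.cong[OF refl])
    fix q assume "q \<in> F - {p}"
    then have "fst q = Suc i + (fst q - i - 1)" using lt[of q] by auto
    then have "x ^ fst q = x ^ Suc i * x ^ (fst q - i - 1)" by (metis power_add)
    then show "u q * (x ^ fst q * y ^ snd q) = x ^ Suc i * (u q * (x ^ (fst q - i - 1) * y ^ snd q))"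
      by (simp add: mult_ac)
  qed
  also have "\<dots> = x ^ Suc i * g" unfolding g_def by (simp only: sum_distrib_left)
  finally have "(\<Sum>p\<in>F. u p * (x ^ fst p * y ^ snd p)) = u p * (x ^ i * y ^ snd p) + x ^ Suc i * g"
    using sum.remove[OF fin p(1), of "\<lambda>p. u p * (x ^ fst p * y ^ snd p)"] p(2) by simp
  also have "\<dots> = x ^ i * (u p * y ^ snd p + x * g)" by (simp add: algebra_simps)
  finally have "x ^ i * (u p * y ^ snd p + x * g) \<in> mpow (i + Suc (snd p))"
    using mem deg[OF p(1)] p(2) by simp
  then show False using mpow_cancel_power_x unit_power_y_notin_mpow[OF unit[OF p(1)]] by blast
qed

lemma ideal_sum: "is_ideal I \<Longrightarrow> (\<And>p. p \<in> F \<Longrightarrow> f p \<in> I) \<Longrightarrow> sum f F \<in> I"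
  for I :: "'b::comm_ring_1 set"
  by (induction F rule: infinite_finite_induct) (auto intro: ideal_zero ideal_add)

lemma monomial_in_mpow: "x ^ i * y ^ d \<in> mpow (i + d)"
  using mpow_mult[OF power_in_mpow[OF x_in_mpow, of i] power_in_mpow[OF y_in_mpow, of d]] by simp

text \<open>Only the terms of least degree \<open>D\<close> survive modulo
  \<open>mpow (Suc D)\<close>, and there they agree with true monomials. The intended
  \<open>f p\<close> are standard monomials in key elements.\<close>

lemma perturbed_monomials_notin_mpow:
  assumes fin: "finite F" and p: "p \<in> F" "fst p + snd p < N"
    and unit: "\<And>p. p \<in> F \<Longrightarrow> u p dvd 1"
    and near: "\<And>p. p \<in> F \<Longrightarrow> f p - x ^ fst p * y ^ snd p \<in> mpow (Suc (fst p + snd p))"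
  shows "(\<Sum>p\<in>F. u p * f p) \<notin> mpow N"
proof
  assume mem: "(\<Sum>p\<in>F. u p * f p) \<in> mpow N"
  let ?deg = "\<lambda>p. fst p + snd p" and ?m = "\<lambda>p. x ^ fst p * y ^ snd p"
  define D where "D = Min (?deg ` F)"
  have "D \<in> ?deg ` F" unfolding D_def using fin p by (intro Min_in) auto
  then obtain q where q: "q \<in> F" "?deg q = D" by auto
  have le: "D \<le> ?deg r" if "r \<in> F" for r unfolding D_def using fin that by (intro Min_le) auto
  let ?F = "{r \<in> F. ?deg r = D}"
  have DN: "Suc D \<le> N" using le[OF p(1)] p(2) by simp
  then have sum: "(\<Sum>p\<in>F. u p * f p) \<in> mpow (Suc D)" using mem mpow_antimono by blast
  have "(\<Sum>r\<in>F. u r * f r) - (\<Sum>r\<in>?F. u r * ?m r) = (\<Sum>r\<in>F. u r * f r - (if ?deg r = D then u r * ?m r else 0))"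
    using fin by (simp add: sum_subtractf sum.inter_filter)
  also have "\<dots> \<in> mpow (Suc D)"
  proof (rule ideal_sum[OF is_ideal_mpow])
    fix r assume r: "r \<in> F"
    show "u r * f r - (if ?deg r = D then u r * ?m r else 0) \<in> mpow (Suc D)"
    proof (cases "?deg r = D")
      case True
      then have "u r * (f r - ?m r) \<in> mpow (Suc D)" using ideal_mult[OF is_ideal_mpow near[OF r]] by simp
      then show ?thesis using True by (simp add: right_diff_distrib)
    next
      case False
      then have "Suc D \<le> ?deg r" using le[OF r] by simp
      then have "?m r \<in> mpow (Suc D)" "f r - ?m r \<in> mpow (Suc D)"
        using mpow_antimono[of "Suc D" "?deg r"] mpow_antimono[of "Suc D" "Suc (?deg r)"] monomial_in_mpow near[OF r]
        by auto
      then have "(f r - ?m r) + ?m r \<in> mpow (Suc D)" using ideal_add[OF is_ideal_mpow] by blast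
      then show ?thesis using False ideal_mult[OF is_ideal_mpow] by simp
    qed
  qed
  finally have "(\<Sum>r\<in>?F. u r * ?m r) \<in> mpow (Suc D)"
    using is_ideal_diff[OF is_ideal_mpow sum] by fastforce
  moreover have "(\<Sum>r\<in>?F. u r * ?m r) \<notin> mpow (Suc D)"
  proof (rule homogeneous_notin_mpow)
    show "finite ?F" using fin by simp
    show "?F \<noteq> {}" using q by blast
  qed (use unit in blast)+
  ultimately show False by blast
qed

lemma mpow_separated: "f \<noteq> 0 \<Longrightarrow> \<exists>N. f \<notin> mpow N"
proof -
  assume "f \<noteq> 0"
  then obtain i d u g where "u dvd 1" "f = x ^ i * (u * y ^ d + x * g)" using flag_exists unfolding flag_def by blast
  then have "f \<notin> mpow (i + Suc d)" using mpow_cancel_power_x unit_power_y_notin_mpow by blast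
  then show ?thesis by blast
qed

end

text \<open>\<open>\<beta>_rec\<close> says that the two terms of the next key element have equal
  weight, and \<open>\<beta>_growth\<close> that their difference is assigned a larger one.
  \<open>dvd_a_0\<close> keeps \<open>n ^ k * \<beta> k\<close> congruent to 1 modulo
  \<open>n\<close>, so that a new denominator appears at every step.\<close>

locale key_sequence = regular_parameters x y for x y :: "'a::idom" +
  fixes n :: nat and a :: "nat \<Rightarrow> nat" and \<beta> :: "nat \<Rightarrow> real"
  assumes n_ge_2: "2 \<le> n"
    and \<beta>_0: "\<beta> 0 = 1"
    and \<beta>_rec: "real n * \<beta> (Suc k) = real (a k) + \<beta> k"
    and \<beta>_1: "1 < \<beta> 1"
    and \<beta>_growth: "real n * \<beta> (Suc k) < \<beta> (Suc (Suc k))"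
    and dvd_a_0: "n dvd a 0"
begin

section \<open>Key elements, base \<open>n\<close> digits and weights\<close>

fun key :: "nat \<Rightarrow> 'a" where
  "key 0 = x"
| "key (Suc 0) = y"
| "key (Suc (Suc k)) = key (Suc k) ^ n - x ^ a k * key k"

text \<open>The order of \<open>key k\<close> with respect to the powers of the maximal ideal; for
  \<open>Suc k\<close> the initial form is \<open>y ^ (n ^ k)\<close>.\<close>

fun kdeg :: "nat \<Rightarrow> nat" where
  "kdeg 0 = 1"
| "kdeg (Suc k) = n ^ k"

text \<open>The base \<open>n\<close> expansion of \<open>d\<close>, with the digit at position
  \<open>j\<close> stored as the multiplicity of the index \<open>k + j\<close>. With
  \<open>k = 1\<close> these are the exponents of the key elements after \<open>x\<close>.\<close>

function digits :: "nat \<Rightarrow> nat \<Rightarrow> nat multiset" where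
  "digits k d = (if d = 0 then {#} else replicate_mset (d mod n) k + digits (Suc k) (d div n))"
  by auto
termination
  by (relation "measure snd") (use n_ge_2 in auto)

declare digits.simps [simp del]

definition mon :: "nat multiset \<Rightarrow> 'a" where "mon M = prod_mset (image_mset key M)"
definition wt :: "nat multiset \<Rightarrow> real" where "wt M = sum_mset (image_mset \<beta> M)"
definition mdeg :: "nat multiset \<Rightarrow> nat" where "mdeg M = sum_mset (image_mset kdeg M)"

text \<open>The standard monomials: the power of \<open>x\<close> is free, the exponents of all
  other key elements are less than \<open>n\<close>. The digits are those of \<open>snd p\<close>,
  so the initial form is \<open>x ^ fst p * y ^ snd p\<close>.\<close>

definition std :: "nat \<times> nat \<Rightarrow> nat multiset" where
  "std p = replicate_mset (fst p) 0 + digits 1 (snd p)"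

lemma mon_simps [simp]: "mon {#} = 1" "mon (add_mset j M) = key j * mon M" "mon (M + M') = mon M * mon M'"
  "mon (replicate_mset m j) = key j ^ m"
  by (simp_all add: mon_def)

lemma wt_simps [simp]: "wt {#} = 0" "wt (add_mset j M) = \<beta> j + wt M" "wt (M + M') = wt M + wt M'"
  "wt (replicate_mset m j) = real m * \<beta> j"
  by (simp_all add: wt_def)

lemma mdeg_simps [simp]: "mdeg {#} = 0" "mdeg (add_mset j M) = kdeg j + mdeg M" "mdeg (M + M') = mdeg M + mdeg M'"
  "mdeg (replicate_mset m j) = m * kdeg j"
  by (simp_all add: mdeg_def)

lemma n_pos: "0 < n" using n_ge_2 by simp

lemma digits_0 [simp]: "digits k 0 = {#}" by (simp add: digits.simps)

lemma digits_step: "digits k d = replicate_mset (d mod n) k + digits (Suc k) (d div n)"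
  by (cases "d = 0") (simp_all add: digits.simps[of k d])

lemma digits_induct:
  assumes "\<And>k. Q k 0" "\<And>k d. d \<noteq> 0 \<Longrightarrow> Q (Suc k) (d div n) \<Longrightarrow> Q k d"
  shows "Q k d"
  using assms by (induction k d rule: digits.induct) metis

lemma kdeg_less_\<beta>: "real (kdeg (Suc k)) < \<beta> (Suc k)"
proof (induction k)
  case 0
  then show ?case using \<beta>_1 by simp
next
  case (Suc k)
  have "real (kdeg (Suc (Suc k))) = real n * real (kdeg (Suc k))" by simp
  also have "\<dots> < real n * \<beta> (Suc k)" using Suc n_pos by simp
  also have "\<dots> < \<beta> (Suc (Suc k))" by (rule \<beta>_growth)
  finally show ?case .
qed

lemma kdeg_le_\<beta>: "real (kdeg k) \<le> \<beta> k"
  using kdeg_less_\<beta> \<beta>_0 by (cases k) (auto intro: less_imp_le)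

lemma kdeg_pos: "0 < kdeg k"
  using n_pos by (cases k) auto

lemma \<beta>_pos: "0 < \<beta> k"
  using kdeg_le_\<beta>[of k] kdeg_pos[of k] by linarith

lemma wt_nonneg: "0 \<le> wt M"
  by (induction M) (use \<beta>_pos in \<open>auto intro: add_nonneg_nonneg less_imp_le\<close>)

lemma mdeg_le_wt: "real (mdeg M) \<le> wt M"
  by (induction M) (use kdeg_le_\<beta> in \<open>auto intro: add_mono\<close>)

lemma size_le_mdeg: "size M \<le> mdeg M"
proof (induction M)
  case (add j M)
  then show ?case using kdeg_pos[of j] by simp
qed simp

lemma mdeg_digits: "mdeg (digits (Suc k) d) = n ^ k * d"
proof -
  have "\<forall>j. k = Suc j \<longrightarrow> mdeg (digits k d) = n ^ j * d" for k
  proof (induction k d rule: digits_induct)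
    case (2 k d)
    show ?case
    proof (intro allI impI)
      fix j assume k: "k = Suc j"
      have "mdeg (digits k d) = (d mod n) * n ^ j + n ^ Suc j * (d div n)"
        using 2(2) k by (subst digits_step) simp
      also have "\<dots> = n ^ j * (d mod n + n * (d div n))" by (simp only: algebra_simps power_Suc)
      finally show "mdeg (digits k d) = n ^ j * d" by (simp only: mod_mult_div_eq)
    qed
  qed simp
  then show ?thesis by blast
qed

lemma mdeg_std: "mdeg (std p) = fst p + snd p"
  using mdeg_digits[of 0] by (simp add: std_def)

lemma wt_std: "wt (std p) = real (fst p) + wt (digits 1 (snd p))"
  by (simp add: std_def \<beta>_0)

text \<open>By \<open>\<beta>_growth\<close>, trading \<open>n\<close> copies of an index for one
  copy of the next never lowers the weight.\<close>

lemma wt_digits_ge: "real d * \<beta> (Suc k) \<le> wt (digits (Suc k) d)"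
proof -
  have "\<forall>j. k = Suc j \<longrightarrow> real d * \<beta> k \<le> wt (digits k d)" for k
  proof (induction k d rule: digits_induct)
    case (2 k d)
    show ?case
    proof (intro allI impI)
      fix j assume k: "k = Suc j"
      have "real (d mod n) * \<beta> k + real (d div n) * (real n * \<beta> k) \<le> real (d mod n) * \<beta> k + real (d div n) * \<beta> (Suc k)"
        using \<beta>_growth[of j] k by (intro add_left_mono mult_left_mono) auto
      also have "\<dots> \<le> wt (digits k d)" using 2(2) by (subst digits_step) simp
      finally have "real (d mod n + n * (d div n)) * \<beta> k \<le> wt (digits k d)"
        by (simp only: of_nat_add of_nat_mult algebra_simps)
      then show "real d * \<beta> k \<le> wt (digits k d)" by (simp only: mod_mult_div_eq)
    qed
  qed simp
  then show ?thesis by blast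
qed

lemma wt_digits_shift: "wt (digits (k + l) (d div n ^ l)) \<le> wt (digits k d)"
proof (induction l arbitrary: k d)
  case (Suc l)
  have "wt (digits (k + Suc l) (d div n ^ Suc l)) = wt (digits (Suc k + l) (d div n div n ^ l))"
    by (simp add: div_mult2_eq)
  also have "\<dots> \<le> wt (digits (Suc k) (d div n))" by (rule Suc)
  also have "\<dots> \<le> wt (digits k d)" using \<beta>_pos[of k] by (subst (2) digits_step) simp
  finally show ?case .
qed simp

text \<open>The bound holds index by index, and the degrees \<open>n ^ j\<close> of the digits add
  up exactly to \<open>n ^ k * d\<close>.\<close>

lemma wt_digits_le:
  assumes s: "\<And>j. s * \<beta> (Suc j) \<le> real (n ^ j)"
  shows "s * wt (digits (Suc k) d) \<le> real (n ^ k) * real d"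
proof -
  have "\<forall>j. k = Suc j \<longrightarrow> s * wt (digits k d) \<le> real (n ^ j) * real d" for k
  proof (induction k d rule: digits_induct)
    case (2 k d)
    show ?case
    proof (intro allI impI)
      fix j assume k: "k = Suc j"
      have "s * wt (digits k d) = real (d mod n) * (s * \<beta> (Suc j)) + s * wt (digits (Suc k) (d div n))"
        unfolding k by (subst digits_step) (simp add: algebra_simps)
      also have "\<dots> \<le> real (d mod n) * real (n ^ j) + real (n ^ Suc j) * real (d div n)"
        using 2(2) k s by (intro add_mono mult_left_mono) auto
      also have "\<dots> = real (n ^ j) * real (d mod n + n * (d div n))"
        by (simp only: of_nat_add of_nat_mult power_Suc algebra_simps)
      finally show "s * wt (digits k d) \<le> real (n ^ j) * real d" by (simp only: mod_mult_div_eq)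
    qed
  qed simp
  then show ?thesis by blast
qed

text \<open>The correction \<open>x ^ a k * key k\<close> vanishes to higher order than the power it
  is subtracted from, hence leaves the initial form alone. The excess of \<open>\<beta>\<close> over
  \<open>kdeg\<close> is positive and more than multiplied by \<open>n\<close> at each step; the
  recursion turns this into the bound on \<open>a k\<close>.\<close>

lemma a_large: "n ^ Suc k < a k + kdeg k"
proof (cases k)
  case 0
  have "real n * 1 < real n * \<beta> 1" using \<beta>_1 n_pos by (intro mult_strict_left_mono) auto
  then have "real n < real (a 0) + 1" using \<beta>_rec[of 0] \<beta>_0 by simp
  then show ?thesis using 0 by simp
next
  case (Suc j)
  let ?e = "\<beta> (Suc j) - real (n ^ j)"
  have e: "0 < ?e" using kdeg_less_\<beta>[of j] by simp
  have "?e \<le> real n * (real n * ?e)"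
  proof -
    have "1 \<le> real n * real n" using n_pos by (metis mult_le_mono nat_mult_1 of_nat_1 of_nat_le_iff of_nat_mult Suc_leI One_nat_def)
    then have "1 * ?e \<le> (real n * real n) * ?e" using e by (intro mult_right_mono) auto
    then show ?thesis by (simp only: mult.assoc mult_1)
  qed
  also have "real n * (real n * ?e) < real n * (\<beta> (Suc (Suc j)) - real (n ^ Suc j))"
    using \<beta>_growth[of j] n_pos by (intro mult_strict_left_mono) (auto simp: algebra_simps)
  also have "\<dots> = real (a k) + \<beta> (Suc j) - real (n ^ Suc k)"
    using \<beta>_rec[of k] Suc by (simp add: algebra_simps)
  finally have "real (n ^ Suc k) < real (a k) + real (n ^ j)" by simp
  then have "n ^ Suc k < a k + n ^ j" by (metis of_nat_add of_nat_less_iff)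
  then show ?thesis using Suc by simp
qed

section \<open>Initial forms of key elements and standard monomials\<close>

fun init :: "nat \<Rightarrow> 'a" where
  "init 0 = x"
| "init (Suc k) = y ^ (n ^ k)"

text \<open>Equality of the classes of \<open>f\<close> and \<open>g\<close> in degree
  \<open>e\<close> of the associated graded ring.\<close>

definition approx :: "'a \<Rightarrow> 'a \<Rightarrow> nat \<Rightarrow> bool" where
  "approx f g e \<longleftrightarrow> g \<in> mpow e \<and> f - g \<in> mpow (Suc e)"

lemma approx_mem: "approx f g e \<Longrightarrow> f \<in> mpow e"
  unfolding approx_def using ideal_add[OF is_ideal_mpow, of "f - g" e g] mpow_Suc_subset[of e] by auto

lemma approx_mult:
  assumes "approx f g e" "approx f' g' e'"
  shows "approx (f * f') (g * g') (e + e')"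
proof -
  have "(f - g) * f' \<in> mpow (Suc (e + e'))"
    using mpow_mult[of "f - g" "Suc e" f' e'] assms(1) approx_mem[OF assms(2)] unfolding approx_def by simp
  moreover have "g * (f' - g') \<in> mpow (Suc (e + e'))"
    using mpow_mult[of g e "f' - g'" "Suc e'"] assms unfolding approx_def by simp
  ultimately have "(f - g) * f' + g * (f' - g') \<in> mpow (Suc (e + e'))" by (rule ideal_add[OF is_ideal_mpow])
  then have "f * f' - g * g' \<in> mpow (Suc (e + e'))" by (simp add: algebra_simps)
  then show ?thesis using assms mpow_mult unfolding approx_def by blast
qed

lemma approx_1: "approx 1 1 0"
  unfolding approx_def using ideal_zero[OF is_ideal_mpow] by simp

lemma approx_power: "approx f g e \<Longrightarrow> approx (f ^ m) (g ^ m) (m * e)"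
  by (induction m) (use approx_1 approx_mult in auto)

text \<open>By induction the \<open>n\<close>-th power has the right initial form, and by
  \<open>a_large\<close> the subtracted term lies in the next power of the maximal ideal.\<close>

lemma approx_key: "approx (key k) (init k) (kdeg k)"
proof (induction k rule: key.induct)
  case 1
  show ?case unfolding approx_def using x_in_mpow ideal_zero[OF is_ideal_mpow] by simp
next
  case 2
  show ?case unfolding approx_def using y_in_mpow ideal_zero[OF is_ideal_mpow] by simp
next
  case (3 k)
  have ap: "approx (key (Suc k) ^ n) (init (Suc (Suc k))) (kdeg (Suc (Suc k)))"
    using approx_power[OF 3(1), of n] by (simp add: power_mult[symmetric] mult.commute)
  have "x ^ a k * key k \<in> mpow (a k + kdeg k)"
    using mpow_mult[OF power_in_mpow[OF x_in_mpow, of "a k"] approx_mem[OF 3(2)]] by simp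
  then have "x ^ a k * key k \<in> mpow (Suc (n ^ Suc k))"
    using mpow_antimono[of "Suc (n ^ Suc k)" "a k + kdeg k"] a_large[of k] by auto
  moreover have "key (Suc k) ^ n - init (Suc (Suc k)) \<in> mpow (Suc (n ^ Suc k))"
    using ap unfolding approx_def kdeg.simps by blast
  ultimately have "(key (Suc k) ^ n - init (Suc (Suc k))) - x ^ a k * key k \<in> mpow (Suc (n ^ Suc k))"
    using is_ideal_diff[OF is_ideal_mpow] by blast
  moreover have "(key (Suc k) ^ n - init (Suc (Suc k))) - x ^ a k * key k = key (Suc (Suc k)) - init (Suc (Suc k))"
    by simp
  ultimately show ?case using ap unfolding approx_def kdeg.simps by metis
qed

lemma approx_mon: "approx (mon M) (prod_mset (image_mset init M)) (mdeg M)"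
proof (induction M)
  case empty
  then show ?case using approx_1 by simp
next
  case (add j M)
  then show ?case using approx_mult[OF approx_key[of j] add] by simp
qed

lemma init_digits: "prod_mset (image_mset init (digits (Suc k) d)) = y ^ (n ^ k * d)"
proof -
  have "\<forall>j. k = Suc j \<longrightarrow> prod_mset (image_mset init (digits k d)) = y ^ (n ^ j * d)" for k
  proof (induction k d rule: digits_induct)
    case (2 k d)
    show ?case
    proof (intro allI impI)
      fix j assume k: "k = Suc j"
      have "prod_mset (image_mset init (digits k d)) = (y ^ n ^ j) ^ (d mod n) * y ^ (n ^ Suc j * (d div n))"
        using 2(2) k by (subst digits_step) simp
      also have "\<dots> = y ^ (n ^ j * (d mod n + n * (d div n)))"
        by (simp only: power_mult[symmetric] power_add[symmetric] power_Suc algebra_simps)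
      finally show "prod_mset (image_mset init (digits k d)) = y ^ (n ^ j * d)" by (simp only: mod_mult_div_eq)
    qed
  qed simp
  then show ?thesis by blast
qed

lemma mon_std_near: "mon (std p) - x ^ fst p * y ^ snd p \<in> mpow (Suc (fst p + snd p))"
proof -
  have "prod_mset (image_mset init (std p)) = x ^ fst p * y ^ snd p"
    using init_digits[of 0] by (simp add: std_def)
  then show ?thesis using approx_mon[of "std p"] unfolding approx_def mdeg_std by simp
qed

subsection \<open>Distinct standard monomials have distinct weights\<close>

text \<open>The numerator of \<open>\<beta> k\<close> over \<open>n ^ k\<close>, obtained by
  multiplying \<open>\<beta>_rec\<close> by \<open>n ^ k\<close>.\<close>

primrec num :: "nat \<Rightarrow> int" where
  "num 0 = 1"
| "num (Suc k) = int n ^ k * int (a k) + num k"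

lemma num_\<beta>: "real n ^ k * \<beta> k = of_int (num k)"
proof (induction k)
  case (Suc k)
  have "real n ^ Suc k * \<beta> (Suc k) = real n ^ k * (real n * \<beta> (Suc k))" by simp
  also have "\<dots> = real n ^ k * real (a k) + real n ^ k * \<beta> k" by (simp add: \<beta>_rec algebra_simps)
  finally show ?case using Suc by simp
qed (simp add: \<beta>_0)

text \<open>The increment carries a factor \<open>n\<close> as soon as \<open>k > 0\<close>; at
  \<open>k = 0\<close> it is \<open>a 0\<close>, a multiple of \<open>n\<close> by
  assumption.\<close>

lemma num_mod: "\<exists>z. num k = 1 + int n * z"
proof (induction k)
  case 0
  then show ?case by (intro exI[of _ 0]) simp
next
  case (Suc k)
  then obtain z where z: "num k = 1 + int n * z" by blast
  have "int n dvd int n ^ k * int (a k)"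
  proof (cases k)
    case 0
    then show ?thesis using dvd_a_0 by simp
  qed simp
  then obtain w where "int n ^ k * int (a k) = int n * w" by blast
  then have "num (Suc k) = 1 + int n * (z + w)" using z by (simp add: algebra_simps)
  then show ?case by blast
qed

text \<open>\<open>digits\<close> peels off the lowest digit, whereas the comparison of denominators
  needs the highest one in isolation.\<close>

lemma wt_digits_top:
  assumes "d < n ^ K" "c < n"
  shows "wt (digits k (c * n ^ K + d)) = real c * \<beta> (k + K) + wt (digits k d)"
  using assms(1)
proof (induction K arbitrary: k d)
  case 0
  then show ?case using assms(2) by (subst digits_step) simp
next
  case (Suc K)
  have e: "c * n ^ Suc K + d = d + n * (c * n ^ K)" by simp
  have m: "(c * n ^ Suc K + d) mod n = d mod n" unfolding e by (rule mod_mult_self2)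
  have "(c * n ^ Suc K + d) div n = c * n ^ K + d div n" unfolding e using n_pos by (intro div_mult_self2) simp
  moreover have "d div n < n ^ K" using Suc.prems n_pos by (simp add: div_less_iff_less_mult mult.commute)
  ultimately show ?case using Suc.IH[of "d div n" "Suc k"] m
    by (subst (1 2) digits_step) simp
qed

lemma wt_digits_int: "d < n ^ K \<Longrightarrow> \<exists>z::int. real n ^ K * wt (digits 1 d) = of_int z"
proof (induction K arbitrary: d)
  case 0
  then show ?case by (auto intro: exI[of _ 0])
next
  case (Suc K)
  let ?c = "d div n ^ K" and ?d = "d mod n ^ K"
  have c: "?c < n" using Suc.prems n_pos by (simp add: div_less_iff_less_mult)
  have d: "?d < n ^ K" using n_pos by simp
  obtain z :: int where z: "real n ^ K * wt (digits 1 ?d) = of_int z" using Suc.IH[OF d] by blast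
  have "wt (digits 1 d) = real ?c * \<beta> (Suc K) + wt (digits 1 ?d)"
    using wt_digits_top[OF d c, of 1] by (simp only: div_mult_mod_eq plus_1_eq_Suc)
  then have "real n ^ Suc K * wt (digits 1 d) = real ?c * (real n ^ Suc K * \<beta> (Suc K)) + real n * (real n ^ K * wt (digits 1 ?d))"
    by (simp add: algebra_simps)
  also have "\<dots> = of_int (int ?c * num (Suc K) + int n * z)"
    unfolding num_\<beta> z by simp
  finally show ?case by blast
qed

text \<open>After multiplication by \<open>n ^ Suc K\<close> everything is divisible by
  \<open>n\<close> except the top digit times \<open>num (Suc K)\<close>, and the latter factor is 1
  modulo \<open>n\<close>. So the top digits agree modulo \<open>n\<close>, hence agree, and can be
  removed.\<close>

lemma wt_std_inj_bounded:
  "d < n ^ K \<Longrightarrow> d' < n ^ K \<Longrightarrow> real i + wt (digits 1 d) = real i' + wt (digits 1 d') \<Longrightarrow> i = i' \<and> d = d'"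
proof (induction K arbitrary: d d')
  case 0
  then show ?case by simp
next
  case (Suc K)
  let ?c = "d div n ^ K" and ?d = "d mod n ^ K" and ?c' = "d' div n ^ K" and ?d' = "d' mod n ^ K"
  have c: "?c < n" "?c' < n" using Suc.prems n_pos by (simp_all add: div_less_iff_less_mult)
  have d: "?d < n ^ K" "?d' < n ^ K" using n_pos by simp_all
  have w: "wt (digits 1 d) = real ?c * \<beta> (Suc K) + wt (digits 1 ?d)"
    "wt (digits 1 d') = real ?c' * \<beta> (Suc K) + wt (digits 1 ?d')"
    using wt_digits_top[OF d(1) c(1), of 1] wt_digits_top[OF d(2) c(2), of 1]
    by (simp_all only: div_mult_mod_eq plus_1_eq_Suc)
  obtain z z' :: int where z: "real n ^ K * wt (digits 1 ?d) = of_int z" "real n ^ K * wt (digits 1 ?d') = of_int z'"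
    using wt_digits_int[OF d(1)] wt_digits_int[OF d(2)] by blast
  have expand: "real n ^ Suc K * (real j + (real b * \<beta> (Suc K) + w)) =
      of_int (int n ^ Suc K * int j + int b * num (Suc K) + int n * z)"
    if "real n ^ K * w = of_int z" for j b w z
  proof -
    have "real n ^ Suc K * (real j + (real b * \<beta> (Suc K) + w)) =
        real n ^ Suc K * real j + real b * (real n ^ Suc K * \<beta> (Suc K)) + real n * (real n ^ K * w)"
      by (simp add: algebra_simps)
    also have "\<dots> = of_int (int n ^ Suc K * int j + int b * num (Suc K) + int n * z)"
      unfolding num_\<beta> that by simp
    finally show ?thesis .
  qed
  have "int n ^ Suc K * int i + int ?c * num (Suc K) + int n * z =
      int n ^ Suc K * int i' + int ?c' * num (Suc K) + int n * z'"
    using Suc.prems(3) expand[OF z(1), of i ?c] expand[OF z(2), of i' ?c'] unfolding w by (metis of_int_eq_iff)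
  moreover obtain r where r: "num (Suc K) = 1 + int n * r" using num_mod by blast
  ultimately have "int ?c - int ?c' = int n * (int n ^ K * (int i' - int i) + (int ?c' - int ?c) * r + z' - z)"
    unfolding r by (simp add: algebra_simps)
  then have "int n dvd int ?c - int ?c'" by (metis dvd_triv_left)
  then have "int ?c mod int n = int ?c' mod int n" by (simp add: mod_eq_dvd_iff)
  then have cc: "?c = ?c'" using c by simp
  then have "real i + wt (digits 1 ?d) = real i' + wt (digits 1 ?d')" using Suc.prems(3) unfolding w by simp
  then have "i = i' \<and> ?d = ?d'" using Suc.IH[OF d] by blast
  then show ?case using cc by (metis div_mult_mod_eq)
qed

lemma wt_std_inj: "wt (std p) = wt (std q) \<longleftrightarrow> p = q"
proof
  assume eq: "wt (std p) = wt (std q)"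
  \<comment> \<open>Serves to find a common number of digits for both second coordinates: their
    maximum.\<close>
  have "m < n ^ m" for m using n_ge_2 by (intro power_gt_expt) simp
  then have le: "m < n ^ max m m'" "m < n ^ max m' m" for m m'
    using n_pos power_increasing[of m "max m m'" n] power_increasing[of m "max m' m" n] by (metis Suc_leI One_nat_def less_le_trans max.cobounded1, metis Suc_leI One_nat_def less_le_trans max.cobounded2)
  show "p = q"
    using wt_std_inj_bounded[OF le(1)[of "snd p" "snd q"] le(2)[of "snd q" "snd p"]] eq
    unfolding wt_std by (metis prod_eqI)
qed simp

lemma deg_le_wt_std: "real (fst p + snd p) \<le> wt (std p)"
  using mdeg_le_wt[of "std p"] unfolding mdeg_std .

lemma finite_wt_std_le: "finite {p. wt (std p) \<le> l}"
proof -
  obtain m :: nat where m: "l \<le> real m" using real_arch_simple by blast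
  have "{p. wt (std p) \<le> l} \<subseteq> {..m} \<times> {..m}"
  proof
    fix p assume "p \<in> {p. wt (std p) \<le> l}"
    then have "real (fst p + snd p) \<le> real m" using deg_le_wt_std[of p] m by simp
    then have "fst p + snd p \<le> m" by (simp only: of_nat_le_iff)
    then show "p \<in> {..m} \<times> {..m}" by (simp add: mem_Times_iff)
  qed
  then show ?thesis by (rule finite_subset) simp
qed

subsection \<open>The filtration by weights\<close>

definition Igt :: "real \<Rightarrow> 'a set" where
  "Igt l = ideal_gen {mon M | M. l < wt M}"

lemma is_ideal_Igt: "is_ideal (Igt l)"
  unfolding Igt_def by (rule is_ideal_ideal_gen)

lemma mon_in_Igt: "l < wt M \<Longrightarrow> mon M \<in> Igt l"
  unfolding Igt_def by (rule subsetD[OF ideal_gen_superset]) blast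

lemma Igt_minimal: "is_ideal I \<Longrightarrow> (\<And>M. l < wt M \<Longrightarrow> mon M \<in> I) \<Longrightarrow> Igt l \<subseteq> I"
  unfolding Igt_def by (rule ideal_gen_minimal) blast+

lemma Igt_antimono: "l \<le> k \<Longrightarrow> Igt k \<subseteq> Igt l"
  by (rule Igt_minimal[OF is_ideal_Igt]) (simp add: mon_in_Igt)

lemma mon_Igt_mult:
  assumes "f \<in> Igt l"
  shows "mon M * f \<in> Igt (wt M + l)"
proof -
  have "is_ideal {f. mon M * f \<in> Igt (wt M + l)}"
  proof (rule is_idealI)
    show "0 \<in> {f. mon M * f \<in> Igt (wt M + l)}" using ideal_zero[OF is_ideal_Igt] by simp
  next
    fix a b assume "a \<in> {f. mon M * f \<in> Igt (wt M + l)}" "b \<in> {f. mon M * f \<in> Igt (wt M + l)}"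
    then show "a + b \<in> {f. mon M * f \<in> Igt (wt M + l)}"
      using ideal_add[OF is_ideal_Igt] by (simp add: distrib_left)
  next
    fix c a assume "a \<in> {f. mon M * f \<in> Igt (wt M + l)}"
    then show "c * a \<in> {f. mon M * f \<in> Igt (wt M + l)}"
      using ideal_mult[OF is_ideal_Igt] by (simp add: mult.left_commute)
  qed
  then have "Igt l \<subseteq> {f. mon M * f \<in> Igt (wt M + l)}"
  proof (rule Igt_minimal)
    fix M' assume "l < wt M'"
    then have "mon (M + M') \<in> Igt (wt M + l)" by (intro mon_in_Igt) simp
    then show "mon M' \<in> {f. mon M * f \<in> Igt (wt M + l)}" by simp
  qed
  then show ?thesis using assms by blast
qed

text \<open>A nonunit is a combination of \<open>x\<close> and \<open>y\<close>, that is, of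
  \<open>key 0\<close> and \<open>key 1\<close>, which have positive weight.\<close>

lemma nonunit_mult_mon: "\<not> r dvd 1 \<Longrightarrow> r * mon M \<in> Igt (wt M)"
proof -
  assume "\<not> r dvd 1"
  then obtain c d where r: "r = c * x + d * y" using nonunit_iff by blast
  have "mon (add_mset 0 M) \<in> Igt (wt M)" "mon (add_mset 1 M) \<in> Igt (wt M)"
    using \<beta>_pos by (auto intro!: mon_in_Igt simp del: mon_simps)
  then have "c * mon (add_mset 0 M) + d * mon (add_mset 1 M) \<in> Igt (wt M)"
    by (intro ideal_add ideal_mult is_ideal_Igt)
  then show ?thesis unfolding r by (simp add: algebra_simps)
qed

text \<open>The multiplicity of \<open>k\<close> is the lowest digit. The bound \<open>l\<close> on
  the range of indices only drives the induction.\<close>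

lemma reduced_digits:
  assumes "\<forall>j. count M j < n" "\<forall>j\<in>#M. k \<le> j \<and> j < k + l"
  shows "\<exists>d. M = digits k d"
  using assms
proof (induction l arbitrary: M k)
  case 0
  then have "M = {#}" by (metis add.right_neutral leD multiset_nonemptyE)
  then show ?case by (metis digits_0)
next
  case (Suc l)
  let ?M = "filter_mset (\<lambda>j. j \<noteq> k) M"
  have "\<forall>j. count ?M j < n" using Suc.prems(1) n_pos by simp
  moreover have "\<forall>j\<in>#?M. Suc k \<le> j \<and> j < Suc k + l" using Suc.prems(2) by force
  ultimately obtain d where d: "?M = digits (Suc k) d" using Suc.IH by blast
  let ?d = "count M k + n * d"
  have "count M k < n" using Suc.prems by blast
  then have "?d mod n = count M k" "?d div n = d" by simp_all
  then have "digits k ?d = replicate_mset (count M k) k + ?M" using digits_step[of k ?d] d by simp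
  also have "\<dots> = M" by (rule multiset_eqI) simp
  finally show ?case by metis
qed

text \<open>Replace \<open>key (Suc k) ^ n\<close> by
  \<open>key (Suc (Suc k)) + x ^ a k * key k\<close>: the first term has larger weight, the second
  the same. The number of factors other than \<open>x\<close> drops, since \<open>n \<ge> 2\<close>
  of them give way to at most one.\<close>

lemma reduce_mon: "\<exists>p. wt (std p) = wt M \<and> mon M - mon (std p) \<in> Igt (wt M)"
proof (induction "size (filter_mset (\<lambda>j. j \<noteq> 0) M)" arbitrary: M rule: less_induct)
  case less
  show ?case
  proof (cases "\<forall>j. j \<noteq> 0 \<longrightarrow> count M j < n")
    case True
    let ?M = "filter_mset (\<lambda>j. j \<noteq> 0) M"
    have "\<forall>j. count ?M j < n" using True n_pos by simp
    moreover have "\<exists>m. \<forall>j\<in>#?M. 1 \<le> j \<and> j < 1 + m"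
    proof -
      have "j \<le> Max (set_mset M)" if "j \<in># M" for j using that by (intro Max_ge) auto
      then obtain m where "\<And>j. j \<in># M \<Longrightarrow> j \<le> m" by blast
      then have "\<forall>j\<in>#?M. 1 \<le> j \<and> j < 1 + Suc m" by (fastforce simp: Suc_le_eq)
      then show ?thesis by blast
    qed
    ultimately obtain d where d: "?M = digits 1 d" using reduced_digits by blast
    have "M = replicate_mset (count M 0) 0 + ?M" by (rule multiset_eqI) simp
    then have "M = std (count M 0, d)" unfolding std_def using d by simp
    then show ?thesis using ideal_zero[OF is_ideal_Igt] by (metis diff_self)
  next
    case False
    then obtain j where "j \<noteq> 0" and cj: "n \<le> count M j" by auto
    then obtain k where k: "j = Suc k" using not0_implies_Suc by blast
    define M' where "M' = M - replicate_mset n (Suc k)"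
    have "replicate_mset n (Suc k) \<subseteq># M" using cj k by (simp add: count_le_replicate_mset_subset_eq)
    then have M: "M = replicate_mset n (Suc k) + M'" unfolding M'_def by simp
    let ?A = "add_mset (Suc (Suc k)) M'" and ?B = "replicate_mset (a k) 0 + add_mset k M'"
    have mon: "mon M = mon ?A + mon ?B" unfolding M by (simp add: algebra_simps)
    have wB: "wt ?B = wt M" unfolding M using \<beta>_rec[of k] \<beta>_0 by simp
    have wA: "wt M < wt ?A" unfolding M using \<beta>_growth[of k] by simp
    have z: "filter_mset (\<lambda>j. j \<noteq> 0) (replicate_mset (a k) 0) = {#}"
      by (simp only: filter_replicate_mset_if not_True_eq_False simp_thms if_False)
    have nz: "filter_mset (\<lambda>j. j \<noteq> 0) (replicate_mset n (Suc k)) = replicate_mset n (Suc k)"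
      by (simp only: filter_replicate_mset_if nat.distinct simp_thms if_True)
    have "size (filter_mset (\<lambda>j. j \<noteq> 0) ?B) = size (filter_mset (\<lambda>j. j \<noteq> 0) (add_mset k M'))"
      by (simp only: filter_union_mset z add_0)
    also have "\<dots> \<le> Suc (size (filter_mset (\<lambda>j. j \<noteq> 0) M'))" by simp
    also have "\<dots> < n + size (filter_mset (\<lambda>j. j \<noteq> 0) M')" using n_ge_2 by simp
    also have "\<dots> = size (filter_mset (\<lambda>j. j \<noteq> 0) M)"
      unfolding M by (simp only: filter_union_mset nz size_union size_replicate_mset)
    finally obtain p where p: "wt (std p) = wt ?B" "mon ?B - mon (std p) \<in> Igt (wt ?B)"
      using less[of ?B] by blast
    have "mon ?A + (mon ?B - mon (std p)) \<in> Igt (wt M)"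
      using ideal_add[OF is_ideal_Igt mon_in_Igt[OF wA]] p(2) unfolding wB by blast
    then show ?thesis using p(1) wB unfolding mon by (metis add_diff_eq)
  qed
qed

text \<open>Weights are discrete, and each belongs to just one standard monomial, so a single
  generator leads from \<open>Igt l\<close> to the next smaller ideal. This is what makes
  \<open>\<Delta> = 1\<close>.\<close>

lemma next_weight:
  "\<exists>b. l < wt (std b) \<and> (\<forall>p. l < wt (std p) \<longrightarrow> wt (std b) \<le> wt (std p)) \<and>
    (\<forall>f\<in>Igt l. \<exists>r. f - r * mon (std b) \<in> Igt (wt (std b)))"
proof -
  obtain m where m: "l < real m" using reals_Archimedean2 by blast
  let ?q = "(m, 0 :: nat)"
  have q: "l < wt (std ?q)" using m deg_le_wt_std[of ?q] by simp
  let ?S = "{p. l < wt (std p) \<and> wt (std p) \<le> wt (std ?q)}"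
  have fin: "finite ?S" by (rule finite_subset[OF _ finite_wt_std_le[of "wt (std ?q)"]]) auto
  have ne: "?S \<noteq> {}" using q by blast
  let ?m = "Min ((\<lambda>p. wt (std p)) ` ?S)"
  have "?m \<in> (\<lambda>p. wt (std p)) ` ?S" using fin ne by (intro Min_in) auto
  then obtain b where b: "b \<in> ?S" "wt (std b) = ?m" by auto
  have min: "wt (std b) \<le> wt (std p)" if "l < wt (std p)" for p
  proof (cases "wt (std p) \<le> wt (std ?q)")
    case True
    then show ?thesis unfolding b(2) using that fin by (intro Min_le) auto
  next
    case False
    then show ?thesis using b(1) by simp
  qed
  let ?E = "{f. \<exists>r. f - r * mon (std b) \<in> Igt (wt (std b))}"
  have "is_ideal ?E"
  proof (rule is_idealI)
    have "0 - 0 * mon (std b) \<in> Igt (wt (std b))" using ideal_zero[OF is_ideal_Igt] by simp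
    then show "0 \<in> ?E" by blast
  next
    fix f g assume "f \<in> ?E" "g \<in> ?E"
    then obtain r s where "f - r * mon (std b) \<in> Igt (wt (std b))" "g - s * mon (std b) \<in> Igt (wt (std b))" by blast
    from ideal_add[OF is_ideal_Igt this] have "(f + g) - (r + s) * mon (std b) \<in> Igt (wt (std b))"
      by (simp add: algebra_simps)
    then show "f + g \<in> ?E" by blast
  next
    fix c f assume "f \<in> ?E"
    then obtain r where "f - r * mon (std b) \<in> Igt (wt (std b))" by blast
    from ideal_mult[OF is_ideal_Igt this, of c] have "c * f - (c * r) * mon (std b) \<in> Igt (wt (std b))"
      by (simp add: algebra_simps)
    then show "c * f \<in> ?E" by blast
  qed
  then have "Igt l \<subseteq> ?E"
  proof (rule Igt_minimal)
    fix M assume M: "l < wt M"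
    obtain p where p: "wt (std p) = wt M" "mon M - mon (std p) \<in> Igt (wt M)" using reduce_mon by blast
    show "mon M \<in> ?E"
    proof (cases "p = b")
      case True
      then have "mon M - 1 * mon (std b) \<in> Igt (wt (std b))" using p by simp
      then show ?thesis by blast
    next
      case False
      then have "wt (std b) \<noteq> wt (std p)" using wt_std_inj[of b p] by simp
      then have "wt (std b) < wt M" using min[of p] M p(1) by simp
      then have "mon M \<in> Igt (wt (std b))" by (rule mon_in_Igt)
      then have "mon M - 0 * mon (std b) \<in> Igt (wt (std b))" by simp
      then show ?thesis by blast
    qed
  qed
  then show ?thesis using b(1) min by blast
qed

text \<open>A monomial of degree less than \<open>N\<close> has fewer than \<open>N\<close> factors,
  and a factor \<open>key (Suc k)\<close> has degree \<open>n ^ k < N\<close>. So its indices are at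
  most \<open>N\<close> and its weight is at most \<open>N * B\<close>.\<close>

lemma Igt_subset_mpow: "\<exists>l. Igt l \<subseteq> mpow N"
proof -
  define B where "B = Max (\<beta> ` {..N})"
  have B: "\<beta> j \<le> B" if "j \<le> N" for j unfolding B_def using that by (intro Max_ge) auto
  have "0 \<le> B" using B[of 0] \<beta>_0 by simp
  have "mon M \<in> mpow N" if M: "real N * B < wt M" for M
  proof (cases "N \<le> mdeg M")
    case True
    then show ?thesis using approx_mem[OF approx_mon] mpow_antimono by blast
  next
    case False
    have "\<beta> j \<le> B" if j: "j \<in># M" for j
    proof (cases j)
      case 0
      then show ?thesis using B[of 0] by simp
    next
      case (Suc k)
      have "kdeg j \<le> mdeg M" using j by (metis mdeg_simps(2) le_add1 multi_member_split)
      then have "n ^ k < N" using False Suc by simp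
      moreover have "k < n ^ k" using n_ge_2 by (intro power_gt_expt) simp
      ultimately show ?thesis using B[of j] Suc by simp
    qed
    then have "wt M \<le> real (size M) * B"
    proof (induction M)
      case (add j M)
      then have "wt M \<le> real (size M) * B" "\<beta> j \<le> B" by simp_all
      then show ?case by (simp add: algebra_simps)
    qed simp
    also have "\<dots> \<le> real N * B"
      using size_le_mdeg[of M] False \<open>0 \<le> B\<close> by (intro mult_right_mono) auto
    finally show ?thesis using M by simp
  qed
  then have "Igt (real N * B) \<subseteq> mpow N" by (rule Igt_minimal[OF is_ideal_mpow])
  then show ?thesis by blast
qed

text \<open>Pass through the finitely many weights between \<open>l\<close> and \<open>L\<close>,
  beyond which everything lies in \<open>mpow N\<close>. A unit coefficient is recorded; a nonunit
  one pushes its term into the next ideal, so no term is recorded.\<close>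

lemma expansion:
  assumes "f \<in> Igt l"
  shows "\<exists>F u. finite F \<and> (\<forall>p\<in>F. l < wt (std p) \<and> u p dvd 1) \<and> f - (\<Sum>p\<in>F. u p * mon (std p)) \<in> mpow N"
proof -
  obtain L where L: "Igt L \<subseteq> mpow N" using Igt_subset_mpow by blast
  have fin: "finite {p. l < wt (std p) \<and> wt (std p) \<le> L}" for l
    by (rule finite_subset[OF _ finite_wt_std_le[of L]]) auto
  show ?thesis using assms
  proof (induction "card {p. l < wt (std p) \<and> wt (std p) \<le> L}" arbitrary: l f rule: less_induct)
    case less
    obtain b where b: "l < wt (std b)" "\<And>p. l < wt (std p) \<Longrightarrow> wt (std b) \<le> wt (std p)"
      "\<And>f. f \<in> Igt l \<Longrightarrow> \<exists>r. f - r * mon (std b) \<in> Igt (wt (std b))" using next_weight[of l] by blast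
    show ?case
    proof (cases "wt (std b) \<le> L")
      case False
      have "Igt l \<subseteq> Igt L"
      proof (rule Igt_minimal[OF is_ideal_Igt])
        fix M assume "l < wt M"
        then obtain p where "wt (std p) = wt M" "l < wt (std p)" using reduce_mon by metis
        then show "mon M \<in> Igt L" using b(2) False by (intro mon_in_Igt) fastforce
      qed
      then have "f - (\<Sum>p\<in>{}. (1::'a) * mon (std p)) \<in> mpow N" using less.prems L by auto
      then show ?thesis by (intro exI[of _ "{}"] exI[of _ "\<lambda>_. 1"]) auto
    next
      case True
      obtain r where r: "f - r * mon (std b) \<in> Igt (wt (std b))" using b(3) less.prems by blast
      have "{p. wt (std b) < wt (std p) \<and> wt (std p) \<le> L} \<subset> {p. l < wt (std p) \<and> wt (std p) \<le> L}"
        using b(1) True by force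
      then have "card {p. wt (std b) < wt (std p) \<and> wt (std p) \<le> L} < card {p. l < wt (std p) \<and> wt (std p) \<le> L}"
        by (rule psubset_card_mono[OF fin])
      note IH = less.hyps[OF this]
      show ?thesis
      proof (cases "r dvd 1")
        case unit: True
        obtain F u where F: "finite F" "\<forall>p\<in>F. wt (std b) < wt (std p) \<and> u p dvd 1"
          "(f - r * mon (std b)) - (\<Sum>p\<in>F. u p * mon (std p)) \<in> mpow N"
          using IH[OF r] by blast
        have "b \<notin> F" using F(2) by blast
        define w where "w = u(b := r)"
        have "(\<Sum>p\<in>insert b F. w p * mon (std p)) = r * mon (std b) + (\<Sum>p\<in>F. u p * mon (std p))"
          using F(1) \<open>b \<notin> F\<close> unfolding w_def by (subst sum.insert) (auto intro!: sum.cong)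
        then have "f - (\<Sum>p\<in>insert b F. w p * mon (std p)) \<in> mpow N" using F(3) by (simp add: diff_diff_eq)
        moreover have "\<forall>p\<in>insert b F. l < wt (std p) \<and> w p dvd 1"
          using F(2) b(1) unit unfolding w_def by auto
        ultimately show ?thesis using F(1) by (intro exI[of _ "insert b F"] exI[of _ w]) auto
      next
        case False
        then have "r * mon (std b) \<in> Igt (wt (std b))" by (rule nonunit_mult_mon)
        from ideal_add[OF is_ideal_Igt r this] have mem: "f \<in> Igt (wt (std b))" by simp
        obtain F u where F: "finite F" "\<forall>p\<in>F. wt (std b) < wt (std p) \<and> u p dvd 1"
          "f - (\<Sum>p\<in>F. u p * mon (std p)) \<in> mpow N"
          using IH[OF mem] by blast
        then have "\<forall>p\<in>F. l < wt (std p) \<and> u p dvd 1" using b(1) by (meson less_trans)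
        then show ?thesis using F(1,3) by blast
      qed
    qed
  qed
qed

text \<open>Otherwise expanding the element would put a combination of standard monomials with unit
  coefficients, containing \<open>std p\<close>, into a power of the maximal ideal beyond the degree
  of \<open>p\<close>. This contradicts the independence of their initial forms, so the filtration
  really drops at every weight.\<close>

lemma mon_std_notin_Igt:
  assumes "u dvd 1"
  shows "u * mon (std p) \<notin> Igt (wt (std p))"
proof
  assume mem: "u * mon (std p) \<in> Igt (wt (std p))"
  obtain F w where F: "finite F" "\<forall>q\<in>F. wt (std p) < wt (std q) \<and> w q dvd 1"
    "u * mon (std p) - (\<Sum>q\<in>F. w q * mon (std q)) \<in> mpow (Suc (fst p + snd p))"
    using expansion[OF mem, of "Suc (fst p + snd p)"] by blast
  have "p \<notin> F" using F(2) by blast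
  define c where "c q = (if q = p then u else - w q)" for q
  have "(\<Sum>q\<in>F. c q * mon (std q)) = (\<Sum>q\<in>F. - (w q * mon (std q)))"
    using \<open>p \<notin> F\<close> unfolding c_def by (intro sum.cong) auto
  then have "(\<Sum>q\<in>insert p F. c q * mon (std q)) = u * mon (std p) - (\<Sum>q\<in>F. w q * mon (std q))"
    using F(1) \<open>p \<notin> F\<close> by (simp add: c_def sum_negf)
  then have "(\<Sum>q\<in>insert p F. c q * mon (std q)) \<in> mpow (Suc (fst p + snd p))" using F(3) by simp
  moreover have "(\<Sum>q\<in>insert p F. c q * mon (std q)) \<notin> mpow (Suc (fst p + snd p))"
  proof (rule perturbed_monomials_notin_mpow)
    show "c q dvd 1" if "q \<in> insert p F" for q using that F(2) assms unfolding c_def by auto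
    show "mon (std q) - x ^ fst q * y ^ snd q \<in> mpow (Suc (fst q + snd q))" for q by (rule mon_std_near)
  qed (use F(1) in auto)
  ultimately show False by blast
qed

section \<open>Leading standard monomials and the valuation they define\<close>

definition lead :: "'a \<Rightarrow> nat \<times> nat \<Rightarrow> bool" where
  "lead f p \<longleftrightarrow> (\<exists>u. u dvd 1 \<and> f - u * mon (std p) \<in> Igt (wt (std p)))"

lemma lead_mem:
  assumes "lead f p"
  shows "l < wt (std p) \<Longrightarrow> f \<in> Igt l" and "f \<notin> Igt (wt (std p))"
proof -
  obtain u where u: "u dvd 1" "f - u * mon (std p) \<in> Igt (wt (std p))" using assms unfolding lead_def by blast
  show "f \<in> Igt l" if l: "l < wt (std p)"
  proof -
    have "f - u * mon (std p) \<in> Igt l" using u(2) Igt_antimono[of l "wt (std p)"] l by auto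
    from ideal_add[OF is_ideal_Igt this ideal_mult[OF is_ideal_Igt mon_in_Igt[OF l]], of u]
    show ?thesis by simp
  qed
  show "f \<notin> Igt (wt (std p))"
  proof
    assume "f \<in> Igt (wt (std p))"
    from is_ideal_diff[OF is_ideal_Igt this u(2)] have "u * mon (std p) \<in> Igt (wt (std p))" by simp
    then show False using mon_std_notin_Igt[OF u(1)] by blast
  qed
qed

text \<open>As long as the coefficients met are nonunits, \<open>f\<close> stays in smaller and
  smaller ideals of the filtration. It cannot get past \<open>L\<close>, because
  \<open>Igt L\<close> is contained in a power \<open>mpow N\<close> that misses
  \<open>f\<close>.\<close>

lemma lead_exists:
  assumes "f \<noteq> 0"
  shows "\<exists>p. lead f p"
proof -
  obtain N where N: "f \<notin> mpow N" using mpow_separated[OF assms] by blast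
  obtain L where L: "Igt L \<subseteq> mpow N" using Igt_subset_mpow by blast
  have fin: "finite {p. l < wt (std p) \<and> wt (std p) \<le> L}" for l
    by (rule finite_subset[OF _ finite_wt_std_le[of L]]) auto
  have "f \<in> Igt l \<Longrightarrow> \<exists>p. lead f p" for l
  proof (induction "card {p. l < wt (std p) \<and> wt (std p) \<le> L}" arbitrary: l rule: less_induct)
    case less
    obtain b where b: "l < wt (std b)" "\<And>p. l < wt (std p) \<Longrightarrow> wt (std b) \<le> wt (std p)"
      "\<And>f. f \<in> Igt l \<Longrightarrow> \<exists>r. f - r * mon (std b) \<in> Igt (wt (std b))" using next_weight[of l] by blast
    obtain r where r: "f - r * mon (std b) \<in> Igt (wt (std b))" using b(3) less.prems by blast
    show ?case
    proof (cases "r dvd 1")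
      case True
      then show ?thesis using r unfolding lead_def by blast
    next
      case False
      then have "r * mon (std b) \<in> Igt (wt (std b))" by (rule nonunit_mult_mon)
      from ideal_add[OF is_ideal_Igt r this] have mem: "f \<in> Igt (wt (std b))" by simp
      then have "wt (std b) \<le> L" using L N Igt_antimono[of L "wt (std b)"] by fastforce
      then have "{p. wt (std b) < wt (std p) \<and> wt (std p) \<le> L} \<subset> {p. l < wt (std p) \<and> wt (std p) \<le> L}"
        using b(1) by force
      then have "card {p. wt (std b) < wt (std p) \<and> wt (std p) \<le> L} < card {p. l < wt (std p) \<and> wt (std p) \<le> L}"
        by (rule psubset_card_mono[OF fin])
      from less.hyps[OF this mem] show ?thesis .
    qed
  qed
  \<comment> \<open>The empty monomial 1 has weight 0, so any negative bound yields an ideal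
    containing every element.\<close>
  moreover have "f * mon {#} \<in> Igt (- 1)" by (intro ideal_mult is_ideal_Igt mon_in_Igt) simp
  ultimately show ?thesis by simp
qed

lemma lead_unique: "lead f p \<Longrightarrow> lead f q \<Longrightarrow> p = q"
  using lead_mem wt_std_inj by (metis linorder_neqE_linordered_idom)

text \<open>The product of two standard monomials need not be standard, but
  \<open>reduce_mon\<close> replaces it by a standard one of the same weight. The four remaining
  terms of the product all lie in \<open>Igt\<close> of that weight.\<close>

lemma lead_mult:
  assumes "lead f p" "lead g q"
  shows "\<exists>r. lead (f * g) r \<and> wt (std r) = wt (std p) + wt (std q)"
proof -
  obtain u w where u: "u dvd 1" "f - u * mon (std p) \<in> Igt (wt (std p))"
    "w dvd 1" "g - w * mon (std q) \<in> Igt (wt (std q))" using assms unfolding lead_def by blast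
  let ?l = "wt (std p) + wt (std q)"
  obtain r where r: "wt (std r) = wt (std p + std q)" "mon (std p + std q) - mon (std r) \<in> Igt (wt (std p + std q))"
    using reduce_mon by blast
  have e1: "u * (mon (std p) * (g - w * mon (std q))) \<in> Igt ?l"
    by (rule ideal_mult[OF is_ideal_Igt mon_Igt_mult[OF u(4)]])
  have e2: "w * (mon (std q) * (f - u * mon (std p))) \<in> Igt ?l"
    using ideal_mult[OF is_ideal_Igt mon_Igt_mult[OF u(2)], of w "std q"] by (simp only: add.commute)
  have e3: "(f - u * mon (std p)) * (g - w * mon (std q)) \<in> Igt ?l"
  proof -
    have "is_ideal {h. (f - u * mon (std p)) * h \<in> Igt ?l}"
    proof (rule is_idealI)
      show "0 \<in> {h. (f - u * mon (std p)) * h \<in> Igt ?l}" using ideal_zero[OF is_ideal_Igt] by simp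
    next
      fix a b assume "a \<in> {h. (f - u * mon (std p)) * h \<in> Igt ?l}" "b \<in> {h. (f - u * mon (std p)) * h \<in> Igt ?l}"
      then show "a + b \<in> {h. (f - u * mon (std p)) * h \<in> Igt ?l}"
        using ideal_add[OF is_ideal_Igt] by (simp only: distrib_left mem_Collect_eq)
    next
      fix c a assume "a \<in> {h. (f - u * mon (std p)) * h \<in> Igt ?l}"
      then show "c * a \<in> {h. (f - u * mon (std p)) * h \<in> Igt ?l}"
        using ideal_mult[OF is_ideal_Igt] by (simp only: mult.left_commute[of _ c] mem_Collect_eq)
    qed
    then have "Igt (wt (std q)) \<subseteq> {h. (f - u * mon (std p)) * h \<in> Igt ?l}"
    proof (rule Igt_minimal)
      fix M assume "wt (std q) < wt M"
      then have "Igt (wt M + wt (std p)) \<subseteq> Igt ?l" by (intro Igt_antimono) simp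
      then show "mon M \<in> {h. (f - u * mon (std p)) * h \<in> Igt ?l}"
        using mon_Igt_mult[OF u(2), of M] by (auto simp only: mult.commute mem_Collect_eq)
    qed
    then show ?thesis using u(4) by blast
  qed
  have e4: "(u * w) * (mon (std p + std q) - mon (std r)) \<in> Igt ?l"
    using ideal_mult[OF is_ideal_Igt r(2), of "u * w"] by (simp only: wt_simps)
  have "f * g - (u * w) * mon (std r) =
      u * (mon (std p) * (g - w * mon (std q))) + (w * (mon (std q) * (f - u * mon (std p))) +
        ((f - u * mon (std p)) * (g - w * mon (std q)) + (u * w) * (mon (std p + std q) - mon (std r))))"
    by (simp add: algebra_simps)
  then have "f * g - (u * w) * mon (std r) \<in> Igt (wt (std r))"
    using e1 e2 e3 e4 r(1) ideal_add[OF is_ideal_Igt] by simp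
  moreover have "(u * w) dvd 1" using u(1,3) mult_dvd_mono[of u 1 w 1] by simp
  ultimately have "lead (f * g) r" unfolding lead_def by blast
  then show ?thesis using r(1) by (intro exI[of _ r]) simp
qed

definition val :: "'a \<Rightarrow> real" where
  "val f = wt (std (THE p. lead f p))"

lemma val_eq: "lead f p \<Longrightarrow> val f = wt (std p)"
  unfolding val_def using lead_unique by (metis the_equality)

lemma lead_mon_std: "lead (mon (std p)) p"
  unfolding lead_def using ideal_zero[OF is_ideal_Igt] by (intro exI[of _ 1]) simp

lemma mon_std_nonzero: "mon (std p) \<noteq> 0"
  using lead_mem(2)[OF lead_mon_std] ideal_zero[OF is_ideal_Igt] by metis

lemma val_range: "val ` (- {0}) = range (\<lambda>p. wt (std p))"
proof
  show "val ` (- {0}) \<subseteq> range (\<lambda>p. wt (std p))" using lead_exists val_eq by fastforce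
  have "wt (std p) \<in> val ` (- {0})" for p
    using val_eq[OF lead_mon_std[of p]] mon_std_nonzero[of p] by (metis ComplI image_eqI singletonD)
  then show "range (\<lambda>p. wt (std p)) \<subseteq> val ` (- {0})" by blast
qed

lemma dominating_valuation_val: "dominating_valuation x y val"
proof unfold_locales
  fix f g :: 'a assume "f \<noteq> 0" "g \<noteq> 0"
  then obtain p q where pq: "lead f p" "lead g q" using lead_exists by blast
  then obtain r where "lead (f * g) r" "wt (std r) = wt (std p) + wt (std q)" using lead_mult by blast
  then show "val (f * g) = val f + val g" using val_eq pq by metis
next
  fix f g :: 'a assume "f \<noteq> 0" "g \<noteq> 0" "f + g \<noteq> 0"
  then obtain p q r where pq: "lead f p" "lead g q" "lead (f + g) r" using lead_exists by meson
  have "\<not> (wt (std r) < wt (std p) \<and> wt (std r) < wt (std q))"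
    using lead_mem(1)[OF pq(1)] lead_mem(1)[OF pq(2)] lead_mem(2)[OF pq(3)] ideal_add[OF is_ideal_Igt] by blast
  then show "min (val f) (val g) \<le> val (f + g)" using val_eq pq by (metis leI min_le_iff_disj)
next
  have std0: "std (0, 0) = {#}" by (simp add: std_def)
  fix f :: 'a
  show "val f = 0" if "f dvd 1"
  proof -
    have "lead f (0, 0)" unfolding lead_def using that std0 ideal_zero[OF is_ideal_Igt]
      by (intro exI[of _ f]) simp
    then show ?thesis using val_eq[of f "(0, 0)"] std0 by simp
  qed
  show "1 \<le> val f" if "f \<noteq> 0" "\<not> f dvd 1"
  proof -
    obtain p where p: "lead f p" using lead_exists \<open>f \<noteq> 0\<close> by blast
    have "f * mon {#} \<in> Igt (wt {#})" by (rule nonunit_mult_mon[OF that(2)])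
    then have "f \<in> Igt (wt (std (0, 0)))" using std0 by simp
    then have "p \<noteq> (0, 0)" using lead_mem(2)[OF p] by blast
    then have "1 \<le> fst p + snd p" by (cases p) auto
    then have "1 \<le> wt (std p)" using deg_le_wt_std[of p] by linarith
    then show ?thesis using val_eq[OF p] by simp
  qed
next
  have "std (1, 0) = {#0#}" by (simp add: std_def)
  then have "mon (std (1, 0)) = x" "wt (std (1, 0)) = 1" by (simp_all add: \<beta>_0)
  then show "val x = 1" using val_eq[OF lead_mon_std[of "(1, 0)"]] by simp
qed

text \<open>Since standard monomials have distinct weights, values below \<open>m\<close> correspond
  to lattice points with \<open>wt (std p) < m\<close>. The quotients
  \<open>n ^ k / \<beta> (Suc k)\<close> decrease to \<open>s\<close>; so each bounds the slope of a
  staircase from above, and \<open>s\<close> itself gives the triangle.\<close>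

lemma wt_count_limit:
  assumes lim: "(\<lambda>k. real n ^ k / \<beta> (Suc k)) \<longlonglongrightarrow> s"
  shows "(\<lambda>m. real (card (val ` (- {0}) \<inter> {0<..<real m})) / (real m)\<^sup>2) \<longlonglongrightarrow> s / 2"
proof -
  have dec: "decseq (\<lambda>k. real n ^ k / \<beta> (Suc k))"
  proof (rule decseq_SucI)
    fix k
    have "real n ^ Suc k / \<beta> (Suc (Suc k)) \<le> real n ^ Suc k / (real n * \<beta> (Suc k))"
      using \<beta>_growth[of k] \<beta>_pos[of "Suc k"] \<beta>_pos[of "Suc (Suc k)"] n_pos by (intro divide_left_mono) auto
    also have "\<dots> = real n ^ k / \<beta> (Suc k)" using n_pos by simp
    finally show "real n ^ Suc k / \<beta> (Suc (Suc k)) \<le> real n ^ k / \<beta> (Suc k)" .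
  qed
  have le: "s * \<beta> (Suc k) \<le> real (n ^ k)" for k
    using decseq_ge[OF dec lim, of k] \<beta>_pos[of "Suc k"] by (simp add: field_simps)
  have "0 \<le> real n ^ k / \<beta> (Suc k)" for k using \<beta>_pos[of "Suc k"] by simp
  then have s: "0 \<le> s" using LIMSEQ_le_const[OF lim] by blast
  let ?A = "\<lambda>m. {p. wt (std p) < real m}"
  have "(\<lambda>m. real (card (?A m)) / (real m)\<^sup>2) \<longlonglongrightarrow> s / 2"
  proof (rule lattice_count_limit[OF s])
    fix m i d assume lt: "s * real i + real d < s * real m"
    have "s * wt (std (i, d)) \<le> s * real i + real d"
      using wt_digits_le[of s 0 d] le by (simp add: wt_std distrib_left)
    then have "s * wt (std (i, d)) < s * real m" using lt by simp
    then show "(i, d) \<in> ?A m" using s by (simp add: mult_less_cancel_left)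
  next
    fix \<epsilon> :: real assume "0 < \<epsilon>"
    then have "\<forall>\<^sub>F k in sequentially. real n ^ k / \<beta> (Suc k) < s + \<epsilon>" using lim by (intro order_tendstoD) auto
    then obtain k where k: "real n ^ k / \<beta> (Suc k) < s + \<epsilon>" by (auto simp: eventually_sequentially)
    \<comment> \<open>The \<open>k\<close> lowest digits are discarded; the others contribute at
      least \<open>(d div n ^ k) * \<beta> (Suc k)\<close>.\<close>
    have "real i + real (d div n ^ k) * \<beta> (Suc k) < real m" if "(i, d) \<in> ?A m" for m i d
      using that wt_digits_ge[of "d div n ^ k" k] wt_digits_shift[of 1 k d] by (simp add: wt_std)
    then show "\<exists>D c. 1 \<le> D \<and> 0 < c \<and> real D / c < s + \<epsilon> \<and>
        (\<forall>m i d. (i, d) \<in> ?A m \<longrightarrow> real i + real (d div D) * c < real m)"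
      using k n_pos \<beta>_pos[of "Suc k"] by (intro exI[of _ "n ^ k"] exI[of _ "\<beta> (Suc k)"]) auto
  qed
  then show ?thesis
  proof (rule tendsto_quotient_pred)
    fix m :: nat assume m: "1 \<le> m"
    have inj: "inj_on (\<lambda>p. wt (std p)) (?A m)" by (intro inj_onI) (simp only: wt_std_inj)
    have fin: "finite (?A m)" by (rule finite_subset[OF _ finite_wt_std_le[of "real m"]]) auto
    have "wt (std (0, 0)) = 0" by (simp add: std_def)
    then have zero: "(\<lambda>p. wt (std p)) (0, 0) = 0" by simp
    have "(\<lambda>p. wt (std p)) ` ?A m = insert 0 (range (\<lambda>p. wt (std p)) \<inter> {0<..<real m})"
    proof (rule equalityI; rule subsetI)
      fix w assume "w \<in> (\<lambda>p. wt (std p)) ` ?A m"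
      then obtain p where p: "w = wt (std p)" "w < real m" by blast
      show "w \<in> insert 0 (range (\<lambda>p. wt (std p)) \<inter> {0<..<real m})"
      proof (cases "w = 0")
        case False
        then have "0 < w" using p(1) wt_nonneg[of "std p"] by linarith
        then show ?thesis using p by simp
      qed simp
    next
      fix w assume "w \<in> insert 0 (range (\<lambda>p. wt (std p)) \<inter> {0<..<real m})"
      then consider "w = 0" | p where "w = wt (std p)" "w < real m" by auto
      then show "w \<in> (\<lambda>p. wt (std p)) ` ?A m"
      proof cases
        case 1
        then show ?thesis using zero m by (intro image_eqI[of _ _ "(0, 0)"]) simp_all
      qed blast
    qed
    then have "(\<lambda>p. wt (std p)) ` ?A m = insert 0 (val ` (- {0}) \<inter> {0<..<real m})"
      unfolding val_range .
    moreover from this have "finite (val ` (- {0}) \<inter> {0<..<real m})" using fin finite_imageI[OF fin] by (metis finite_insert)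
    ultimately show "card (?A m) = Suc (card (val ` (- {0}) \<inter> {0<..<real m}))"
      using card_image[OF inj] by simp
  qed
qed

end

text \<open>The interval of length \<open>1 / n\<close> to which \<open>\<beta> (Suc k)\<close> is confined contains exactly one
  solution of the recursion, and its distance to \<open>n ^ k * \<tau> k\<close> forces the growth condition.\<close>

lemma key_sequence_exponents:
  fixes \<tau> :: "nat \<Rightarrow> real"
  assumes n: "2 \<le> n" and mono: "incseq \<tau>" and \<tau>1: "1 + 1 / (real n - 1) < \<tau> 0"
    and lim: "(\<lambda>k. 1 / \<tau> k) \<longlonglongrightarrow> s"
  shows "\<exists>(a :: nat \<Rightarrow> nat) \<beta>. \<beta> 0 = 1 \<and> (\<forall>k. real n * \<beta> (Suc k) = real (a k) + \<beta> k) \<and> 1 < \<beta> 1 \<and>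
    (\<forall>k. real n * \<beta> (Suc k) < \<beta> (Suc (Suc k))) \<and> n dvd a 0 \<and>
    (\<lambda>k. real n ^ k / \<beta> (Suc k)) \<longlonglongrightarrow> s"
proof -
  \<comment> \<open>Chosen as the solution of \<open>n * \<delta> = 1 + \<delta>\<close>. With this
    offset \<open>n\<close> times the right end of the interval at \<open>lo k\<close> does not
    exceed \<open>lo (Suc k)\<close>, which is the growth condition.\<close>
  define \<delta> where "\<delta> = 1 / (real n - 1)"
  have \<delta>: "0 < \<delta>" "\<delta> \<le> 1" "real n * \<delta> = 1 + \<delta>" using n unfolding \<delta>_def by (simp_all add: field_simps)
  define lo where "lo k = real n ^ k * \<tau> k - \<delta>" for k
  \<comment> \<open>The least integer for which \<open>(z + b) / n\<close> reaches
    \<open>lo k\<close>; rounding overshoots by less than \<open>1 / n\<close>.\<close>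
  define z where "z k b = \<lceil>real n * lo k - b\<rceil>" for k b
  \<comment> \<open>\<open>B k\<close> will be \<open>\<beta> (Suc k)\<close>; the start corresponds
    to \<open>a 0 = n\<close>.\<close>
  define B where "B = rec_nat (1 + 1 / real n) (\<lambda>k b. (of_int (z (Suc k) b) + b) / real n)"
  have B0: "B 0 = 1 + 1 / real n" and BS: "real n * B (Suc k) = of_int (z (Suc k) (B k)) + B k" for k
    unfolding B_def using n by simp_all
  have bnd: "lo (Suc k) \<le> B (Suc k) \<and> B (Suc k) < lo (Suc k) + 1 / real n" for k
  proof -
    have "real n * lo (Suc k) \<le> real n * B (Suc k)" "real n * B (Suc k) < real n * lo (Suc k) + 1"
      unfolding BS z_def by linarith+
    moreover have "real n * lo (Suc k) + 1 = real n * (lo (Suc k) + 1 / real n)" using n by (simp add: field_simps)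
    ultimately show ?thesis using n by (metis mult_le_cancel_left_pos mult_less_cancel_left_pos of_nat_0_less_iff less_le_trans pos2)
  qed
  have step: "real n * (lo k + 1 / real n) \<le> lo (Suc k)" for k
  proof -
    have "real n * (lo k + 1 / real n) = real n ^ Suc k * \<tau> k - (1 + \<delta>) + 1"
      using n \<delta>(3) unfolding lo_def by (simp add: algebra_simps)
    also have "\<dots> \<le> real n ^ Suc k * \<tau> (Suc k) - \<delta>"
      using incseq_SucD[OF mono, of k] by (simp add: mult_left_mono)
    finally show ?thesis unfolding lo_def .
  qed
  \<comment> \<open>This is the purpose of the bound on \<open>\<tau> 0\<close>: at index 0 the
    value is prescribed and not obtained by rounding.\<close>
  have B0_less: "B 0 < lo 0 + 1 / real n"
    using \<tau>1 unfolding B0 lo_def \<delta>_def[symmetric] by simp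
  have upper: "B k < lo k + 1 / real n" for k using B0_less bnd by (cases k) auto
  have growth: "real n * B k < B (Suc k)" for k
  proof -
    have "real n * B k < real n * (lo k + 1 / real n)" using upper n by (intro mult_strict_left_mono) auto
    then show ?thesis using step[of k] bnd[of k] by linarith
  qed
  have B_ge_1: "1 \<le> B k" for k
  proof (induction k)
    case (Suc k)
    have "1 * B k \<le> real n * B k" using n Suc by (intro mult_right_mono) auto
    then show ?case using growth[of k] Suc by linarith
  qed (simp add: B0)
  have z_nonneg: "0 \<le> z (Suc k) (B k)" for k
  proof -
    have "B k \<le> real n * B k" using n B_ge_1[of k] by simp
    also have "\<dots> < B (Suc k)" by (rule growth)
    also have "\<dots> \<le> real n * B (Suc k)" using n B_ge_1[of "Suc k"] by simp
    finally have "0 < (of_int (z (Suc k) (B k)) :: real)" unfolding BS by simp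
    then show ?thesis by simp
  qed
  define \<beta> where "\<beta> k = (case k of 0 \<Rightarrow> 1 | Suc j \<Rightarrow> B j)" for k
  define a where "a k = (case k of 0 \<Rightarrow> n | Suc j \<Rightarrow> nat (z (Suc j) (B j)))" for k
  have "real n * \<beta> (Suc k) = real (a k) + \<beta> k" for k
  proof (cases k)
    case 0
    then show ?thesis using n by (simp add: \<beta>_def a_def B0 field_simps)
  next
    case (Suc j)
    then show ?thesis using BS[of j] z_nonneg[of j] by (simp add: \<beta>_def a_def)
  qed
  moreover have "1 < \<beta> 1" using n by (simp add: \<beta>_def B0)
  moreover have "(\<lambda>k. real n ^ k / \<beta> (Suc k)) \<longlonglongrightarrow> s"
  proof -
    have \<tau>_ge_1: "1 \<le> \<tau> k" for k
    proof -
      have "\<tau> 0 \<le> \<tau> k" using mono by (simp add: incseqD)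
      then show ?thesis using \<tau>1 \<delta>(1) unfolding \<delta>_def[symmetric] by linarith
    qed
    \<comment> \<open>\<open>B k\<close> differs from \<open>n ^ k * \<tau> k\<close> by at most
      \<open>\<delta> \<le> 1\<close> and is at least \<open>n ^ k\<close>, so the relative error
      tends to zero.\<close>
    have diff: "\<bar>real n ^ Suc k / B (Suc k) - 1 / \<tau> (Suc k)\<bar> \<le> (1 / real n) ^ Suc k" for k
    proof -
      let ?N = "real n ^ Suc k" and ?b = "B (Suc k)" and ?t = "\<tau> (Suc k)"
      have N: "1 \<le> ?N" using n by (intro one_le_power) simp
      have b: "0 \<le> ?N * ?t - ?b" "?N * ?t - ?b \<le> \<delta>"
      proof -
        have "1 / real n \<le> \<delta>" unfolding \<delta>_def using n by (intro divide_left_mono) auto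
        then show "0 \<le> ?N * ?t - ?b" using bnd[of k] unfolding lo_def by linarith
        show "?N * ?t - ?b \<le> \<delta>" using bnd[of k] unfolding lo_def by linarith
      qed
      have lower: "?N \<le> ?b"
      proof -
        have "real n ^ j \<le> B j" for j
        proof (induction j)
          case (Suc j)
          have "real n * real n ^ j \<le> real n * B j" using Suc by (intro mult_left_mono) auto
          then show ?case using growth[of j] by simp
        qed (simp add: B0)
        then show ?thesis .
      qed
      have eq: "?N / ?b - 1 / ?t = (?N * ?t - ?b) / (?b * ?t)"
        using B_ge_1[of "Suc k"] \<tau>_ge_1[of "Suc k"] by (simp add: field_simps)
      have "?N * 1 \<le> ?b * ?t" using lower \<tau>_ge_1[of "Suc k"] N by (intro mult_mono) auto
      then have "(?N * ?t - ?b) / (?b * ?t) \<le> 1 / ?N"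
        using b \<delta>(2) N by (intro frac_le) auto
      moreover have "0 \<le> (?N * ?t - ?b) / (?b * ?t)" using b B_ge_1[of "Suc k"] \<tau>_ge_1[of "Suc k"] by simp
      ultimately show ?thesis unfolding eq by (simp add: power_one_over)
    qed
    have "(\<lambda>k. (1 / real n) ^ Suc k) \<longlonglongrightarrow> 0"
      using n by (intro LIMSEQ_Suc LIMSEQ_realpow_zero) auto
    then have "(\<lambda>k. real n ^ Suc k / B (Suc k) - 1 / \<tau> (Suc k)) \<longlonglongrightarrow> 0"
    proof (rule tendsto_0_le[where K = 1])
      have "norm (real n ^ Suc k / B (Suc k) - 1 / \<tau> (Suc k)) \<le> norm ((1 / real n) ^ Suc k) * 1" for k
      proof -
        have "norm ((1 / real n) ^ Suc k) = (1 / real n) ^ Suc k" by simp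
        then show ?thesis using diff[of k] by (simp only: real_norm_def mult_1_right)
      qed
      then show "\<forall>\<^sub>F k in sequentially. norm (real n ^ Suc k / B (Suc k) - 1 / \<tau> (Suc k)) \<le> norm ((1 / real n) ^ Suc k) * 1"
        by (rule always_eventually[rule_format])
    qed
    from tendsto_add[OF this LIMSEQ_Suc[OF lim]] have "(\<lambda>k. real n ^ Suc k / B (Suc k)) \<longlonglongrightarrow> s" by simp
    then have "(\<lambda>k. real n ^ k / B k) \<longlonglongrightarrow> s" by (rule LIMSEQ_imp_Suc)
    then show ?thesis by (simp add: \<beta>_def)
  qed
  moreover have "\<beta> 0 = 1" "n dvd a 0" by (simp_all add: \<beta>_def a_def)
  moreover have "\<forall>k. real n * \<beta> (Suc k) < \<beta> (Suc (Suc k))" using growth by (simp add: \<beta>_def)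
  ultimately show ?thesis by blast
qed

lemma realizing_valuation_exists:
  assumes rp: "regular_parameters (x :: 'a::idom) y" and s: "0 \<le> s" "s < (1 :: real)"
  obtains v where "dominating_valuation x y v"
    "(\<lambda>m. real (card (v ` (- {0}) \<inter> {0<..<real m})) / (real m)\<^sup>2) \<longlonglongrightarrow> s / 2"
proof -
  obtain n :: nat and \<tau> :: "nat \<Rightarrow> real" where \<tau>: "2 \<le> n" "incseq \<tau>" "1 + 1 / (real n - 1) < \<tau> 0"
    "(\<lambda>k. 1 / \<tau> k) \<longlonglongrightarrow> s"
  proof (cases "s = 0")
    case True
    \<comment> \<open>For limit 0 any increasing unbounded sequence will do; with
      \<open>n = 2\<close> its first term has to exceed 2.\<close>
    have "(\<lambda>k. 1 / (real k + 3)) \<longlonglongrightarrow> 0"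
      using LIMSEQ_ignore_initial_segment[OF lim_1_over_n, of 3] by simp
    then show thesis using that[of 2 "\<lambda>k. real k + 3"] True by (simp add: incseq_def)
  next
    case False
    \<comment> \<open>The constant sequence \<open>1 / s\<close> is admissible once \<open>n\<close>
      is so large that \<open>1 + 1 / (n - 1) < 1 / s\<close>; such \<open>n\<close> exist because
      \<open>s < 1\<close>.\<close>
    then have "0 < 1 / s - 1" using s by (simp add: field_simps)
    then obtain k where k: "inverse (real (Suc k)) < 1 / s - 1" using reals_Archimedean by blast
    then have "1 + 1 / (real (k + 2) - 1) < 1 / s" by (simp add: inverse_eq_divide algebra_simps)
    moreover have "(\<lambda>k. 1 / (1 / s)) \<longlonglongrightarrow> s" by simp
    ultimately show thesis using that[of "k + 2" "\<lambda>_. 1 / s"] by (simp add: incseq_def)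
  qed
  obtain a \<beta> where "\<beta> 0 = 1" "\<And>k. real n * \<beta> (Suc k) = real (a k) + \<beta> k" "1 < \<beta> 1"
    "\<And>k. real n * \<beta> (Suc k) < \<beta> (Suc (Suc k))" "n dvd a 0"
    and lim: "(\<lambda>k. real n ^ k / \<beta> (Suc k)) \<longlonglongrightarrow> s"
    using key_sequence_exponents[OF \<tau>] by blast
  then interpret key_sequence x y n a \<beta>
    using rp \<tau>(1) by (auto intro!: key_sequence.intro key_sequence_axioms.intro)
  show thesis using that[OF dominating_valuation_val wt_count_limit[OF lim]] .
qed

section \<open>Archimedean ordered groups\<close>

primrec nat_mult :: "nat \<Rightarrow> 'g::linordered_ab_group_add \<Rightarrow> 'g" where
  "nat_mult 0 a = 0"
| "nat_mult (Suc n) a = nat_mult n a + a"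

definition int_mult :: "int \<Rightarrow> 'g::linordered_ab_group_add \<Rightarrow> 'g" where
  "int_mult k a = (if 0 \<le> k then nat_mult (nat k) a else - nat_mult (nat (- k)) a)"

lemma nat_mult_add: "nat_mult (m + n) a = nat_mult m a + nat_mult n a"
  by (induction n) (simp_all add: algebra_simps)

lemma nat_mult_nonneg: "0 \<le> a \<Longrightarrow> 0 \<le> nat_mult n a"
  by (induction n) simp_all

lemma nat_mult_pos: "0 < a \<Longrightarrow> 0 < nat_mult (Suc n) a"
  using nat_mult_nonneg[of a n] by (simp add: add_nonneg_pos)

lemma int_mult_Suc: "int_mult (k + 1) a = int_mult k a + a"
proof (cases "0 \<le> k")
  case True
  then have "nat (k + 1) = Suc (nat k)" by simp
  then show ?thesis using True by (simp add: int_mult_def)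
next
  case False
  then have n: "nat (- k) = Suc (nat (- (k + 1)))" by simp
  show ?thesis
  proof (cases "k = - 1")
    case True
    then show ?thesis by (simp add: int_mult_def)
  next
    case k: False
    then have "\<not> 0 \<le> k + 1" using False by simp
    then show ?thesis using False n by (simp add: int_mult_def)
  qed
qed

lemma int_mult_0: "int_mult 0 a = 0"
  by (simp add: int_mult_def)

lemma int_mult_add: "int_mult (k + l) a = int_mult k a + int_mult l a"
proof (induction l rule: int_induct[of _ 0])
  case base
  show ?case by (simp add: int_mult_0)
next
  case (step1 i)
  then show ?case using int_mult_Suc[of "k + i" a] int_mult_Suc[of i a] by (simp add: add.assoc)
next
  case (step2 i)
  then show ?case using int_mult_Suc[of "k + (i - 1)" a] int_mult_Suc[of "i - 1" a]
    by (simp add: add.assoc[symmetric])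
qed

lemma int_mult_strict_mono:
  assumes "0 < a" "k < l"
  shows "int_mult k a < int_mult l a"
proof -
  obtain n where "l = k + int (Suc n)" using assms(2) zless_iff_Suc_zadd by blast
  moreover have "int_mult (int (Suc n)) a = nat_mult (Suc n) a" by (simp only: int_mult_def nat_int of_nat_0_le_iff if_True)
  ultimately show ?thesis using nat_mult_pos[OF assms(1), of n] by (simp only: int_mult_add less_add_same_cancel1)
qed

lemma int_mult_less_iff: "0 < a \<Longrightarrow> int_mult k a < int_mult l a \<longleftrightarrow> k < l"
  using int_mult_strict_mono[of a k l] int_mult_strict_mono[of a l k] by (metis less_asym linorder_neqE)

text \<open>Hoelder's theorem: the embedding is the homogenization of the integral part with respect
  to \<open>g\<close>, which is additive up to a bounded error.\<close>

lemma archimedean_group_embedding: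
  fixes H :: "'g::linordered_ab_group_add set"
  assumes add: "\<And>a b. a \<in> H \<Longrightarrow> b \<in> H \<Longrightarrow> a + b \<in> H" and neg: "\<And>a. a \<in> H \<Longrightarrow> - a \<in> H"
    and arch: "\<And>a b. a \<in> H \<Longrightarrow> b \<in> H \<Longrightarrow> 0 < b \<Longrightarrow> \<exists>n. a \<le> nat_mult n b"
    and g: "g \<in> H" "0 < g"
  shows "\<exists>\<iota> :: 'g \<Rightarrow> real. (\<forall>a\<in>H. \<forall>b\<in>H. \<iota> (a + b) = \<iota> a + \<iota> b) \<and> strict_mono_on H \<iota> \<and> \<iota> g = 1"
proof -
  have "\<exists>k. int_mult k g \<le> a \<and> a < int_mult (k + 1) g" if a: "a \<in> H" for a
  proof -
    obtain m n where mn: "a \<le> nat_mult n g" "- a \<le> nat_mult m g" using arch a neg g by meson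
    have nat: "int_mult (int k) g = nat_mult k g" for k by (simp add: int_mult_def)
    have "int_mult (- int m) g + int_mult (int m) g = 0"
      by (simp only: int_mult_add[symmetric] add.left_inverse int_mult_0)
    then have "int_mult (- int m) g = - nat_mult m g" unfolding nat by (simp only: eq_neg_iff_add_eq_0)
    then have low: "int_mult (- int m) g \<le> a" using mn(2) by (simp only: minus_le_iff)
    \<comment> \<open>Integer multiples are indexed from the lower bound \<open>- m\<close>, so that
      the least element principle for naturals yields the integral part.\<close>
    let ?P = "\<lambda>j. a < int_mult (- int m + int j) g"
    have "int_mult (int n) g < int_mult (int n + 1) g" using g by (simp add: int_mult_less_iff)
    then have "a < int_mult (int n + 1) g" using mn(1) unfolding nat by (rule order.strict_trans1[rotated])
    moreover have "- int m + int (m + n + 1) = int n + 1" by simp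
    ultimately have P: "?P (m + n + 1)" by metis
    define j where "j = (LEAST j. ?P j)"
    have Pj: "?P j" unfolding j_def using P by (rule LeastI)
    have "j \<noteq> 0" using Pj low by (intro notI) simp
    then obtain i where i: "j = Suc i" using not0_implies_Suc by blast
    have "\<not> ?P i" using not_less_Least[of i ?P] i unfolding j_def by simp
    then show ?thesis using Pj unfolding i by (intro exI[of _ "- int m + int i"]) (simp add: algebra_simps)
  qed
  then obtain fl where fl: "\<And>a. a \<in> H \<Longrightarrow> int_mult (fl a) g \<le> a" "\<And>a. a \<in> H \<Longrightarrow> a < int_mult (fl a + 1) g"
    by metis
  have fl_ge: "k \<le> fl a" if "a \<in> H" "int_mult k g \<le> a" for a k
  proof -
    have "int_mult k g < int_mult (fl a + 1) g" using fl(2)[OF that(1)] that(2) by simp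
    then show ?thesis using int_mult_less_iff[OF g(2)] by simp
  qed
  have fl_le: "fl a \<le> k" if "a \<in> H" "a < int_mult (k + 1) g" for a k
  proof -
    have "int_mult (fl a) g < int_mult (k + 1) g" using fl(1)[OF that(1)] that(2) by simp
    then show ?thesis using int_mult_less_iff[OF g(2)] by simp
  qed
  have fl_add: "fl a + fl b \<le> fl (a + b)" "fl (a + b) \<le> fl a + fl b + 1" if "a \<in> H" "b \<in> H" for a b
  proof -
    show "fl a + fl b \<le> fl (a + b)"
      using fl_ge[OF add[OF that], of "fl a + fl b"] add_mono[OF fl(1)[OF that(1)] fl(1)[OF that(2)]]
      by (simp add: int_mult_add)
    have "a + b < int_mult ((fl a + 1) + (fl b + 1)) g"
      using add_strict_mono[OF fl(2)[OF that(1)] fl(2)[OF that(2)]] by (simp only: int_mult_add)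
    moreover have "(fl a + 1) + (fl b + 1) = (fl a + fl b + 1) + 1" by simp
    ultimately show "fl (a + b) \<le> fl a + fl b + 1" using fl_le[OF add[OF that]] by metis
  qed
  \<comment> \<open>\<open>D n a\<close> is the multiple of \<open>a\<close> by
    \<open>2 ^ n\<close>, so \<open>X n a\<close> below is a dyadic approximation. Doubling, rather
    than taking all multiples, makes the approximations increasing.\<close>
  define D where "D n a = ((\<lambda>z. z + z) ^^ n) a" for n and a :: 'g
  have D0: "D 0 a = a" and DSuc: "D (Suc n) a = D n a + D n a" for n a unfolding D_def by simp_all
  have DH: "D n a \<in> H" if "a \<in> H" for n a by (induction n) (use that add D0 DSuc in auto)
  have Dadd: "D n (a + b) = D n a + D n b" for n a b by (induction n) (simp_all add: D0 DSuc algebra_simps)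
  define X where "X n a = real_of_int (fl (D n a)) / 2 ^ n" for n a
  have XSuc: "X n a \<le> X (Suc n) a" "X (Suc n) a \<le> X n a + 1 / 2 ^ Suc n" if "a \<in> H" for n a
  proof -
    have "fl (D n a) + fl (D n a) \<le> fl (D (Suc n) a)" "fl (D (Suc n) a) \<le> fl (D n a) + fl (D n a) + 1"
      unfolding DSuc using fl_add[OF DH[OF that] DH[OF that]] by blast+
    then have "2 * real_of_int (fl (D n a)) \<le> real_of_int (fl (D (Suc n) a))"
      "real_of_int (fl (D (Suc n) a)) \<le> 2 * real_of_int (fl (D n a)) + 1" by linarith+
    then show "X n a \<le> X (Suc n) a" "X (Suc n) a \<le> X n a + 1 / 2 ^ Suc n"
      unfolding X_def by (simp_all add: field_simps)
  qed
  have conv: "convergent (\<lambda>n. X n a)" if a: "a \<in> H" for a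
  proof -
    have bnd: "X n a \<le> X 0 a + 1 - 1 / 2 ^ n" for n
    proof (induction n)
      case (Suc n)
      have "(1 :: real) / 2 ^ n = 1 / 2 ^ Suc n + 1 / 2 ^ Suc n" by simp
      then show ?case using Suc XSuc(2)[OF a, of n] by linarith
    qed simp
    have "X n a \<le> X 0 a + 1" for n
    proof -
      have "0 \<le> (1 :: real) / 2 ^ n" by simp
      then show ?thesis using bnd[of n] by linarith
    qed
    moreover have "incseq (\<lambda>n. X n a)" using XSuc(1)[OF a] by (rule incseq_SucI)
    ultimately obtain L where "(\<lambda>n. X n a) \<longlonglongrightarrow> L" using incseq_convergent by blast
    then show ?thesis by (rule convergentI)
  qed
  define lam where "lam a = lim (\<lambda>n. X n a)" for a
  have lim: "(\<lambda>n. X n a) \<longlonglongrightarrow> lam a" if "a \<in> H" for a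
    unfolding lam_def using conv[OF that] by (simp add: convergent_LIMSEQ_iff)
  have lam_add: "lam (a + b) = lam a + lam b" if ab: "a \<in> H" "b \<in> H" for a b
  proof -
    have "(\<lambda>n. X n (a + b) - (X n a + X n b)) \<longlonglongrightarrow> 0"
    proof (rule tendsto_0_le[where K = 1])
      show "(\<lambda>n. (1 / 2) ^ n :: real) \<longlonglongrightarrow> 0" by (rule LIMSEQ_realpow_zero) auto
      have "norm (X n (a + b) - (X n a + X n b)) \<le> norm ((1 / 2 :: real) ^ n) * 1" for n
      proof -
        have "fl (D n a) + fl (D n b) \<le> fl (D n (a + b))" "fl (D n (a + b)) \<le> fl (D n a) + fl (D n b) + 1"
          unfolding Dadd using fl_add[OF DH[OF ab(1)] DH[OF ab(2)]] by blast+
        then have "0 \<le> real_of_int (fl (D n (a + b))) - (real_of_int (fl (D n a)) + real_of_int (fl (D n b)))"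
          "real_of_int (fl (D n (a + b))) - (real_of_int (fl (D n a)) + real_of_int (fl (D n b))) \<le> 1"
          by linarith+
        then have "\<bar>(real_of_int (fl (D n (a + b))) - (real_of_int (fl (D n a)) + real_of_int (fl (D n b)))) / 2 ^ n\<bar> \<le> 1 / 2 ^ n"
          by (simp add: divide_right_mono)
        then show ?thesis unfolding X_def by (simp add: diff_divide_distrib add_divide_distrib power_one_over)
      qed
      then show "\<forall>\<^sub>F n in sequentially. norm (X n (a + b) - (X n a + X n b)) \<le> norm ((1 / 2 :: real) ^ n) * 1"
        by (rule always_eventually[rule_format])
    qed
    moreover have "(\<lambda>n. X n (a + b) - (X n a + X n b)) \<longlonglongrightarrow> lam (a + b) - (lam a + lam b)"
      by (intro tendsto_diff tendsto_add lim ab add)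
    ultimately have "lam (a + b) - (lam a + lam b) = 0" using LIMSEQ_unique by blast
    then show ?thesis by simp
  qed
  have lam_pos: "0 < lam c" if c: "c \<in> H" "0 < c" for c
  proof -
    \<comment> \<open>As \<open>2 ^ m\<close> is at least \<open>m\<close>, doubling
      \<open>c\<close> \<open>m\<close> times passes \<open>g\<close>; the approximation is positive
      from there on, and so is the limit.\<close>
    obtain m where m: "g \<le> nat_mult m c" using arch[OF g(1) c] by blast
    have "nat_mult n c \<le> D n c \<and> c \<le> D n c" for n
    proof (induction n)
      case (Suc n)
      then have "nat_mult n c + c \<le> D n c + D n c" by (intro add_mono) auto
      moreover have "0 \<le> D n c" using Suc c by (meson less_imp_le order_trans)
      then have "c + 0 \<le> D n c + D n c" using Suc by (intro add_mono) auto
      ultimately show ?case by (simp add: DSuc)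
    qed (use c D0 in simp)
    then have "int_mult 1 g \<le> D m c" using m by (auto simp: int_mult_def intro: order_trans)
    then have "1 \<le> fl (D m c)" by (rule fl_ge[OF DH[OF c(1)]])
    then have "0 < X m c" unfolding X_def by simp
    moreover have "incseq (\<lambda>n. X n c)" using XSuc(1)[OF c(1)] by (rule incseq_SucI)
    then have "X m c \<le> lam c" using lim[OF c(1)] by (rule incseq_le)
    ultimately show ?thesis by simp
  qed
  \<comment> \<open>Division by \<open>lam g\<close> gives the normalization at \<open>g\<close>
    without evaluating \<open>lam g\<close>.\<close>
  let ?i = "\<lambda>a. lam a / lam g"
  have lg: "0 < lam g" using lam_pos g by blast
  have "strict_mono_on H ?i"
  proof (rule strict_mono_onI)
    fix a b assume ab: "a \<in> H" "b \<in> H" "a < b"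
    have c: "b + (- a) \<in> H" using ab add neg by blast
    have "0 < lam (b + - a)" using ab by (intro lam_pos[OF c]) simp
    moreover have "a + (b + - a) = b" by simp
    then have "lam b = lam a + lam (b + - a)" using lam_add[OF ab(1) c] by simp
    ultimately have "lam a < lam b" by simp
    then show "?i a < ?i b" using lg by (simp add: divide_strict_right_mono)
  qed
  moreover have "\<forall>a\<in>H. \<forall>b\<in>H. ?i (a + b) = ?i a + ?i b" using lam_add by (simp add: add_divide_distrib)
  moreover have "?i g = 1" using lg by simp
  ultimately show ?thesis by (intro exI[of _ ?i]) blast
qed

section \<open>Rank one valuations\<close>

lemma valuation_mult: "is_valuation \<nu> \<Longrightarrow> a \<noteq> 0 \<Longrightarrow> b \<noteq> 0 \<Longrightarrow> \<nu> (a * b) = \<nu> a + \<nu> b"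
  unfolding is_valuation_def by blast

lemma valuation_add: "is_valuation \<nu> \<Longrightarrow> a \<noteq> 0 \<Longrightarrow> b \<noteq> 0 \<Longrightarrow> a + b \<noteq> 0 \<Longrightarrow> min (\<nu> a) (\<nu> b) \<le> \<nu> (a + b)"
  unfolding is_valuation_def by blast

lemma valuation_1: "is_valuation \<nu> \<Longrightarrow> \<nu> 1 = 0"
  using valuation_mult[of \<nu> 1 1] by simp

lemma valuation_inverse: "is_valuation \<nu> \<Longrightarrow> a \<noteq> 0 \<Longrightarrow> \<nu> (inverse a) = - \<nu> a"
  using valuation_mult[of \<nu> a "inverse a"] valuation_1[of \<nu>] by (simp add: eq_neg_iff_add_eq_0 add.commute)

lemma value_group_mem: "a \<noteq> 0 \<Longrightarrow> \<nu> a \<in> value_group \<nu>"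
  unfolding value_group_def by blast

lemma value_group_add:
  assumes "is_valuation \<nu>" "s \<in> value_group \<nu>" "t \<in> value_group \<nu>"
  shows "s + t \<in> value_group \<nu>"
proof -
  obtain a b where ab: "s = \<nu> a" "t = \<nu> b" "a \<noteq> 0" "b \<noteq> 0" using assms unfolding value_group_def by auto
  then have "s + t = \<nu> (a * b)" using valuation_mult[OF assms(1)] by simp
  then show ?thesis using ab value_group_mem[of "a * b"] by simp
qed

lemma value_group_neg:
  assumes "is_valuation \<nu>" "s \<in> value_group \<nu>"
  shows "- s \<in> value_group \<nu>"
proof -
  obtain a where a: "s = \<nu> a" "a \<noteq> 0" using assms unfolding value_group_def by auto
  then have "- s = \<nu> (inverse a)" using valuation_inverse[OF assms(1)] by simp
  then show ?thesis using a value_group_mem[of "inverse a"] by simp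
qed

lemma value_group_0: "is_valuation \<nu> \<Longrightarrow> 0 \<in> value_group \<nu>"
  using valuation_1[of \<nu>] value_group_mem[of 1 \<nu>] by simp

lemma isolated_subgroup_0: "is_valuation \<nu> \<Longrightarrow> isolated_subgroup {0} (value_group \<nu>)"
  unfolding isolated_subgroup_def using value_group_0 by auto

text \<open>The elements bounded on both sides by multiples of \<open>b\<close> form an isolated
  subgroup containing \<open>b\<close>. With rank one, \<open>{0}\<close> is the only proper
  isolated subgroup, so this one is everything.\<close>

lemma rank_one_archimedean:
  fixes \<nu> :: "'k::field \<Rightarrow> 'g::linordered_ab_group_add"
  assumes val: "is_valuation \<nu>" and rank: "has_rank_one \<nu>"
    and a: "a \<in> value_group \<nu>" and b: "b \<in> value_group \<nu>" "0 < b"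
  shows "\<exists>n. a \<le> nat_mult n b"
proof -
  let ?K = "{a \<in> value_group \<nu>. \<exists>n. a \<le> nat_mult n b \<and> - a \<le> nat_mult n b}"
  let ?I = "{H. isolated_subgroup H (value_group \<nu>) \<and> H \<noteq> value_group \<nu>}"
  have mono: "nat_mult m b \<le> nat_mult (m + n) b" for m n
    using nat_mult_nonneg[of b n] b(2) by (simp add: nat_mult_add)
  have "isolated_subgroup ?K (value_group \<nu>)"
    unfolding isolated_subgroup_def
  proof (intro conjI ballI impI)
    show "?K \<subseteq> value_group \<nu>" by blast
    have "(0 :: 'g) \<le> nat_mult 0 b \<and> - (0 :: 'g) \<le> nat_mult 0 b" by simp
    then show "0 \<in> ?K" using value_group_0[OF val] by blast
  next
    fix s t assume "s \<in> ?K" "t \<in> ?K"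
    then obtain m n where mn: "s \<in> value_group \<nu>" "t \<in> value_group \<nu>" "s \<le> nat_mult m b" "- s \<le> nat_mult m b"
      "t \<le> nat_mult n b" "- t \<le> nat_mult n b" by blast
    have "s + t \<le> nat_mult (m + n) b" "- s + - t \<le> nat_mult (m + n) b"
      unfolding nat_mult_add using add_mono[OF mn(3,5)] add_mono[OF mn(4,6)] by blast+
    moreover have "- (s + t) = - s + - t" by simp
    ultimately show "s + t \<in> ?K" using value_group_add[OF val mn(1,2)] by (metis (mono_tags, lifting) mem_Collect_eq)
  next
    fix s assume "s \<in> ?K"
    then obtain n where n: "s \<in> value_group \<nu>" "s \<le> nat_mult n b" "- s \<le> nat_mult n b" by blast
    have "- s \<le> nat_mult n b \<and> - (- s) \<le> nat_mult n b" using n by simp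
    then show "- s \<in> ?K" using value_group_neg[OF val n(1)] by blast
  next
    fix s t assume s: "s \<in> value_group \<nu>" and "t \<in> ?K" and st: "0 \<le> s \<and> s \<le> t"
    then obtain n where n: "t \<le> nat_mult n b" by blast
    have "- s \<le> 0" using st by simp
    then have "s \<le> nat_mult n b \<and> - s \<le> nat_mult n b"
      using n st nat_mult_nonneg[of b n] b(2) by (meson less_imp_le order_trans)
    then show "s \<in> ?K" using s by blast
  qed
  moreover have "{0} \<in> ?I" using isolated_subgroup_0[OF val] b by force
  moreover have "b \<in> ?K"
  proof -
    have "b \<le> nat_mult 1 b \<and> - b \<le> nat_mult 1 b" using b(2) by (simp add: less_imp_le less_trans[of "- b" 0 b])
    then show ?thesis using b(1) by blast
  qed
  then have "?K \<noteq> {0}" using b(2) by (metis less_irrefl singletonD)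
  moreover obtain H where "?I = {H}" using rank unfolding has_rank_one_def by (rule card_1_singletonE)
  ultimately have "?K = value_group \<nu>" by (metis (mono_tags, lifting) mem_Collect_eq singletonD)
  then show ?thesis using a by blast
qed

text \<open>A nonzero isolated subgroup contains a positive real number, whose multiples are
  cofinal. The nonzero value \<open>c\<close> makes \<open>{0}\<close> a proper subgroup, so that
  the rank is 1 and not 0.\<close>

lemma has_rank_one_real:
  fixes \<nu> :: "'k::field \<Rightarrow> real"
  assumes val: "is_valuation \<nu>" and c: "c \<in> value_group \<nu>" "c \<noteq> 0"
  shows "has_rank_one \<nu>"
proof -
  have full: "H = value_group \<nu>" if H: "isolated_subgroup H (value_group \<nu>)" "H \<noteq> {0}" for H
  proof -
    have sub: "H \<subseteq> value_group \<nu>" and zero: "0 \<in> H" and add: "\<And>a b. a \<in> H \<Longrightarrow> b \<in> H \<Longrightarrow> a + b \<in> H"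
      and neg: "\<And>a. a \<in> H \<Longrightarrow> - a \<in> H"
      and conv: "\<And>a b. a \<in> value_group \<nu> \<Longrightarrow> b \<in> H \<Longrightarrow> 0 \<le> a \<Longrightarrow> a \<le> b \<Longrightarrow> a \<in> H"
      using H(1) unfolding isolated_subgroup_def by blast+
    obtain b where b: "b \<in> H" "b \<noteq> 0" using zero H(2) by blast
    then obtain d where d: "d \<in> H" "0 < d" using neg[of b] by (cases "0 < b") auto
    have mult: "real n * d \<in> H" for n
    proof (induction n)
      case (Suc n)
      then have "real n * d + d \<in> H" using add d by blast
      then show ?case by (simp add: distrib_right add.commute)
    qed (use zero in simp)
    have pos: "a \<in> H" if a: "a \<in> value_group \<nu>" "0 \<le> a" for a
    proof -
      obtain n where "a < real n * d" using reals_Archimedean3[OF d(2)] by blast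
      then have "a \<le> real n * d" by simp
      then show ?thesis by (rule conv[OF a(1) mult a(2)])
    qed
    have "value_group \<nu> \<subseteq> H"
    proof
      fix a assume a: "a \<in> value_group \<nu>"
      show "a \<in> H"
      proof (cases "0 \<le> a")
        case False
        then have "- a \<in> H" using pos[OF value_group_neg[OF val a]] by simp
        then show ?thesis using neg by fastforce
      qed (use pos a in blast)
    qed
    then show ?thesis using sub by blast
  qed
  have "value_group \<nu> \<noteq> {0}" using c by blast
  then have "{H. isolated_subgroup H (value_group \<nu>) \<and> H \<noteq> value_group \<nu>} = {{0}}"
    using isolated_subgroup_0[OF val] full by blast
  then show ?thesis unfolding has_rank_one_def by simp
qed

section \<open>Passing between values on \<open>R\<close> and valuations of its quotient
  field\<close>

lemma fract_quotient: "\<exists>a b. b \<noteq> 0 \<and> q = to_fract a / to_fract b" for q :: "'a::idom fract"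
proof (cases q)
  case (Fract a b)
  then have "q * to_fract b = to_fract a" by (simp add: to_fract_def eq_fract)
  then have "q = to_fract a / to_fract b" using Fract(2) by (simp add: field_simps)
  then show ?thesis using Fract(2) by blast
qed

context dominating_valuation
begin

lemma fract_valuation:
  obtains \<nu> :: "'a fract \<Rightarrow> real" where "is_valuation \<nu>" "\<And>f. f \<noteq> 0 \<Longrightarrow> \<nu> (to_fract f) = v f"
proof -
  obtain N D :: "'a fract \<Rightarrow> 'a" where ND: "\<And>q. D q \<noteq> 0" "\<And>q. q = to_fract (N q) / to_fract (D q)"
    using fract_quotient by metis
  define \<nu> where "\<nu> q = v (N q) - v (D q)" for q
  \<comment> \<open>Independence of the chosen representatives: cross multiplication gives an
    equation in \<open>R\<close>, to which \<open>v_mult\<close> applies.\<close>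
  have \<nu>: "\<nu> q = v a - v b" if q: "q = to_fract a / to_fract b" "a \<noteq> 0" "b \<noteq> 0" for q a b
  proof -
    have "q \<noteq> 0" using q by simp
    then have N: "N q \<noteq> 0" using ND(2)[of q] by auto
    have "to_fract (N q) / to_fract (D q) = to_fract a / to_fract b" using ND(2)[of q] q(1) by simp
    then have "to_fract (N q) * to_fract b = to_fract a * to_fract (D q)"
      using q(3) ND(1)[of q] by (simp add: frac_eq_eq)
    then have "to_fract (N q * b) = to_fract (a * D q)" by (simp only: to_fract_mult)
    then have "N q * b = a * D q" by (simp only: to_fract_eq_iff)
    then have "v (N q) + v b = v a + v (D q)" using v_mult N q(2,3) ND(1) by metis
    then show ?thesis unfolding \<nu>_def by simp
  qed
  have rep: "\<exists>a b. a \<noteq> 0 \<and> b \<noteq> 0 \<and> q = to_fract a / to_fract b" if "q \<noteq> 0" for q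
  proof -
    obtain a b where "b \<noteq> 0" "q = to_fract a / to_fract b" using fract_quotient by blast
    moreover from this have "a \<noteq> 0" using that by auto
    ultimately show ?thesis by blast
  qed
  have "is_valuation \<nu>"
    unfolding is_valuation_def
  proof (intro conjI allI impI)
    fix p q :: "'a fract" assume nz: "p \<noteq> 0" "q \<noteq> 0"
    obtain a b where a: "a \<noteq> 0" "b \<noteq> 0" "p = to_fract a / to_fract b" using rep[OF nz(1)] by blast
    obtain c d where c: "c \<noteq> 0" "d \<noteq> 0" "q = to_fract c / to_fract d" using rep[OF nz(2)] by blast
    have "p * q = to_fract (a * c) / to_fract (b * d)" unfolding a(3) c(3) by simp
    then have "\<nu> (p * q) = v (a * c) - v (b * d)" using a c by (intro \<nu>) simp_all
    then show "\<nu> (p * q) = \<nu> p + \<nu> q" using \<nu>[OF a(3,1,2)] \<nu>[OF c(3,1,2)] v_mult a c by simp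
    show "min (\<nu> p) (\<nu> q) \<le> \<nu> (p + q)" if s: "p + q \<noteq> 0"
    proof -
      have e: "p + q = to_fract (a * d + c * b) / to_fract (b * d)"
        unfolding a(3) c(3) using a(2) c(2) by (simp add: add_frac_eq)
      have nz: "a * d + c * b \<noteq> 0"
      proof
        assume "a * d + c * b = 0"
        then have "p + q = 0" unfolding e by (simp only: to_fract_0 div_0)
        then show False using s by blast
      qed
      have "b * d \<noteq> 0" using a c by simp
      then have "\<nu> (p + q) = v (a * d + c * b) - v (b * d)" by (rule \<nu>[OF e nz])
      moreover have "min (v (a * d)) (v (c * b)) \<le> v (a * d + c * b)"
        using nz a c by (intro v_add) simp_all
      ultimately show ?thesis using \<nu>[OF a(3,1,2)] \<nu>[OF c(3,1,2)] a c by (simp add: v_mult)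
    qed
  qed
  moreover have "\<nu> (to_fract f) = v f" if "f \<noteq> 0" for f
  proof -
    have "to_fract f = to_fract f / to_fract 1" by simp
    then have "\<nu> (to_fract f) = v f - v 1" using that by (intro \<nu>) simp_all
    then show ?thesis using v_unit[of 1] by simp
  qed
  ultimately show thesis using that by blast
qed

lemma realized_limit:
  assumes m: "\<And>r :: 'a. r \<in> max_ideal \<longleftrightarrow> \<not> r dvd 1"
    and lim: "(\<lambda>n. real (card (v ` (- {0}) \<inter> {0<..<real n})) / (real n)\<^sup>2) \<longlonglongrightarrow> L"
  shows "L \<in> obtained_limits TYPE('a) TYPE(real)"
proof -
  obtain \<nu> :: "'a fract \<Rightarrow> real" where \<nu>: "is_valuation \<nu>" "\<And>f. f \<noteq> 0 \<Longrightarrow> \<nu> (to_fract f) = v f"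
    using fract_valuation by blast
  have S: "value_semigroup \<nu> = v ` (- {0})"
  proof -
    have "value_semigroup \<nu> = (\<lambda>f. \<nu> (to_fract f)) ` (- {0})" unfolding value_semigroup_def by auto
    also have "\<dots> = v ` (- {0})" by (rule image_cong[OF refl]) (simp add: \<nu>(2))
    finally show ?thesis .
  qed
  have one: "1 = \<nu> (to_fract x)" using \<nu>(2)[OF x_nonzero] v_x by simp
  have "1 \<in> value_group \<nu>" unfolding one using x_nonzero by (intro value_group_mem) simp
  then have rank: "has_rank_one \<nu>" using has_rank_one_real[OF \<nu>(1)] by simp
  have "dominates \<nu>"
    unfolding dominates_def
  proof
    show "range to_fract \<subseteq> valuation_ring \<nu>"
    proof clarify
      fix f :: 'a
      show "to_fract f \<in> valuation_ring \<nu>"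
        unfolding valuation_ring_def using \<nu>(2)[of f] v_nonneg[of f] by (cases "f = 0") simp_all
    qed
    have "to_fract f \<in> valuation_ideal \<nu> \<longleftrightarrow> f \<in> max_ideal" for f
    proof (cases "f = 0")
      case True
      then show ?thesis unfolding valuation_ideal_def m by simp
    next
      case False
      then show ?thesis unfolding valuation_ideal_def m
        using \<nu>(2)[of f] v_unit[of f] v_nonunit[of f] by fastforce
    qed
    then show "valuation_ideal \<nu> \<inter> range to_fract = to_fract ` max_ideal" by blast
  qed
  then have "rank_one_dominating \<nu>" unfolding rank_one_dominating_def using \<nu>(1) rank by blast
  moreover have "normalized_embedding \<nu> (\<lambda>s. s)"
    unfolding normalized_embedding_def
  proof (intro conjI ballI impI)
    show "strict_mono_on (value_group \<nu>) (\<lambda>s. s)" by (rule strict_mono_onI)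
    show "1 \<in> (\<lambda>s. s) ` value_semigroup \<nu>" unfolding S image_ident using x_nonzero v_x by force
    fix s assume "s \<in> (\<lambda>s. s) ` value_semigroup \<nu>" "s \<noteq> 0"
    then obtain f where "f \<noteq> 0" "s = v f" "s \<noteq> 0" unfolding S image_ident by blast
    then show "1 \<le> s" using v_unit[of f] v_nonunit[of f] by blast
  qed simp
  moreover have "(\<lambda>n. real (phi \<nu> (\<lambda>s. s) n) / (real n)\<^sup>2) \<longlonglongrightarrow> L"
    using lim unfolding phi_def S image_ident .
  ultimately show ?thesis unfolding obtained_limits_def by blast
qed

end

lemma dominates_values:
  fixes f :: "'a::idom"
  assumes dom: "dominates \<nu>" and m: "\<And>r :: 'a. r \<in> max_ideal \<longleftrightarrow> \<not> r dvd 1" and f: "f \<noteq> 0"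
  shows "f dvd 1 \<Longrightarrow> \<nu> (to_fract f) = 0" and "\<not> f dvd 1 \<Longrightarrow> 0 < \<nu> (to_fract f)"
proof -
  have sub: "range to_fract \<subseteq> valuation_ring \<nu>"
    and eq: "valuation_ideal \<nu> \<inter> range to_fract = to_fract ` max_ideal"
    using dom unfolding dominates_def by blast+
  have "to_fract f \<in> valuation_ring \<nu>" using sub by blast
  then have nn: "0 \<le> \<nu> (to_fract f)" using f unfolding valuation_ring_def by simp
  have "to_fract f \<in> valuation_ideal \<nu> \<longleftrightarrow> to_fract f \<in> to_fract ` max_ideal" unfolding eq[symmetric] by blast
  also have "\<dots> \<longleftrightarrow> f \<in> max_ideal" by auto
  finally have "0 < \<nu> (to_fract f) \<longleftrightarrow> \<not> f dvd 1" using f m unfolding valuation_ideal_def by simp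
  then show "f dvd 1 \<Longrightarrow> \<nu> (to_fract f) = 0" "\<not> f dvd 1 \<Longrightarrow> 0 < \<nu> (to_fract f)"
    using nn by auto
qed

lemma combination_value:
  fixes x y f :: "'a::idom"
  assumes val: "is_valuation \<nu>" and dom: "dominates \<nu>" and m: "\<And>r :: 'a. r \<in> max_ideal \<longleftrightarrow> \<not> r dvd 1"
    and xy: "x \<noteq> 0" "y \<noteq> 0" and f: "f \<noteq> 0" "f = a * x + b * y"
  shows "min (\<nu> (to_fract x)) (\<nu> (to_fract y)) \<le> \<nu> (to_fract f)"
proof -
  have nn: "0 \<le> \<nu> (to_fract c)" if "c \<noteq> 0" for c :: 'a
    using dominates_values[OF dom m that] by (cases "c dvd 1") auto
  have ge: "\<nu> (to_fract z) \<le> \<nu> (to_fract (c * z))" if "c \<noteq> 0" "z \<noteq> 0" for c z :: 'a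
    using valuation_mult[OF val, of "to_fract c" "to_fract z"] nn[of c] that by simp
  show ?thesis
  proof (cases "a = 0 \<or> b = 0")
    case True
    then consider "b \<noteq> 0" "f = b * y" | "a \<noteq> 0" "f = a * x" using f by auto
    then show ?thesis
    proof cases
      case 1
      then show ?thesis using ge[of b y] xy by (simp add: min.coboundedI2)
    next
      case 2
      then show ?thesis using ge[of a x] xy by (simp add: min.coboundedI1)
    qed
  next
    case False
    have "min (\<nu> (to_fract x)) (\<nu> (to_fract y)) \<le> min (\<nu> (to_fract (a * x))) (\<nu> (to_fract (b * y)))"
      using ge[of a x] ge[of b y] xy False by (intro min.mono) blast+
    also have "\<dots> \<le> \<nu> (to_fract (a * x) + to_fract (b * y))"
    proof (rule valuation_add[OF val])
      show "to_fract (a * x) + to_fract (b * y) \<noteq> 0" using f by (simp only: to_fract_add[symmetric] to_fract_eq_0_iff) simp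
    qed (use False xy in simp_all)
    also have "\<dots> = \<nu> (to_fract f)" unfolding f(2) by (simp only: to_fract_add)
    finally show ?thesis .
  qed
qed

text \<open>Every nonunit is a combination of \<open>x\<close> and \<open>y\<close>, so the smaller
  of their two values is the least positive element of the semigroup. Hoelder's embedding is scaled
  to send it to 1.\<close>

lemma normalized_embedding_exists:
  fixes \<nu> :: "'a::idom fract \<Rightarrow> 'g::linordered_ab_group_add"
  assumes \<nu>: "rank_one_dominating \<nu>" and m: "\<And>r :: 'a. r \<in> max_ideal \<longleftrightarrow> \<not> r dvd 1"
    and rp: "regular_parameters (x :: 'a) y"
  shows "\<exists>\<iota>. normalized_embedding \<nu> \<iota>"
proof -
  interpret regular_parameters x y by (rule rp)
  have val: "is_valuation \<nu>" and rank: "has_rank_one \<nu>" and dom: "dominates \<nu>"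
    using \<nu> unfolding rank_one_dominating_def by blast+
  let ?g = "min (\<nu> (to_fract x)) (\<nu> (to_fract y))"
  have pos: "0 < ?g"
    using dominates_values(2)[OF dom m] x_nonzero y_nonzero nonunit_x nonunit_y by simp
  have gS: "?g \<in> value_semigroup \<nu>"
    unfolding value_semigroup_def min_def using x_nonzero y_nonzero by auto
  have S_sub: "value_semigroup \<nu> \<subseteq> value_group \<nu>"
    unfolding value_semigroup_def value_group_def by auto
  have "\<exists>\<iota> :: 'g \<Rightarrow> real. (\<forall>a\<in>value_group \<nu>. \<forall>b\<in>value_group \<nu>. \<iota> (a + b) = \<iota> a + \<iota> b) \<and>
      strict_mono_on (value_group \<nu>) \<iota> \<and> \<iota> ?g = 1"
  proof (rule archimedean_group_embedding)
    show "\<And>a b. a \<in> value_group \<nu> \<Longrightarrow> b \<in> value_group \<nu> \<Longrightarrow> a + b \<in> value_group \<nu>"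
      by (rule value_group_add[OF val])
    show "\<And>a. a \<in> value_group \<nu> \<Longrightarrow> - a \<in> value_group \<nu>" by (rule value_group_neg[OF val])
    show "\<And>a b. a \<in> value_group \<nu> \<Longrightarrow> b \<in> value_group \<nu> \<Longrightarrow> 0 < b \<Longrightarrow> \<exists>n. a \<le> nat_mult n b"
      by (rule rank_one_archimedean[OF val rank])
    show "?g \<in> value_group \<nu>" using gS S_sub by blast
  qed (rule pos)
  then obtain \<iota> :: "'g \<Rightarrow> real" where \<iota>: "\<forall>a\<in>value_group \<nu>. \<forall>b\<in>value_group \<nu>. \<iota> (a + b) = \<iota> a + \<iota> b"
    "strict_mono_on (value_group \<nu>) \<iota>" "\<iota> ?g = 1" by blast
  have "1 \<le> s" if s: "s \<in> \<iota> ` value_semigroup \<nu>" "s \<noteq> 0" for s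
  proof -
    obtain f where f: "f \<noteq> 0" "s = \<iota> (\<nu> (to_fract f))" using s(1) unfolding value_semigroup_def by blast
    have "\<iota> 0 = 0" using \<iota>(1) value_group_0[OF val] by (metis add_0 add_cancel_right_right)
    then have "\<not> f dvd 1" using dominates_values(1)[OF dom m f(1)] f(2) s(2) by metis
    then obtain a b where "f = a * x + b * y" using nonunit_iff by blast
    then have le: "?g \<le> \<nu> (to_fract f)" using combination_value[OF val dom m x_nonzero y_nonzero f(1)] by blast
    have "\<nu> (to_fract f) \<in> value_group \<nu>" using f(1) by (intro value_group_mem) simp
    from mono_onD[OF strict_mono_on_imp_mono_on[OF \<iota>(2)] subsetD[OF S_sub gS] this le]
    have "\<iota> ?g \<le> \<iota> (\<nu> (to_fract f))" .
    then show ?thesis using \<iota>(3) f(2) by simp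
  qed
  moreover have "1 \<in> \<iota> ` value_semigroup \<nu>" using gS \<iota>(3) by (metis image_eqI)
  ultimately have "normalized_embedding \<nu> \<iota>" unfolding normalized_embedding_def using \<iota>(1,2) by blast
  then show ?thesis by blast
qed

text \<open>Some element of value 1 is a combination of \<open>x\<close> and \<open>y\<close>, so
  one of the two parameters has value 1. Taking that one first turns the embedded valuation,
  restricted to \<open>R\<close>, into a \<open>dominating_valuation\<close>.\<close>

lemma normalized_limit:
  fixes \<nu> :: "'a::idom fract \<Rightarrow> 'g::linordered_ab_group_add"
  assumes \<nu>: "rank_one_dominating \<nu>" and \<iota>: "normalized_embedding \<nu> \<iota>"
    and m: "\<And>r :: 'a. r \<in> max_ideal \<longleftrightarrow> \<not> r dvd 1"
    and rp: "regular_parameters (x :: 'a) y" and rp': "regular_parameters y x"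
  shows "\<exists>L. 0 \<le> L \<and> L < 1 / 2 \<and> (\<lambda>n. real (phi \<nu> \<iota> n) / (real n)\<^sup>2) \<longlonglongrightarrow> L"
proof -
  interpret regular_parameters x y by (rule rp)
  have val: "is_valuation \<nu>" and dom: "dominates \<nu>"
    using \<nu> unfolding rank_one_dominating_def by blast+
  have add: "\<And>a b. a \<in> value_group \<nu> \<Longrightarrow> b \<in> value_group \<nu> \<Longrightarrow> \<iota> (a + b) = \<iota> a + \<iota> b"
    and mono: "strict_mono_on (value_group \<nu>) \<iota>" and one: "1 \<in> \<iota> ` value_semigroup \<nu>"
    and least: "\<And>s. s \<in> \<iota> ` value_semigroup \<nu> \<Longrightarrow> s \<noteq> 0 \<Longrightarrow> 1 \<le> s"
    using \<iota> unfolding normalized_embedding_def by blast+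
  define v where "v f = \<iota> (\<nu> (to_fract f))" for f :: 'a
  have mem: "\<nu> (to_fract f) \<in> value_group \<nu>" if "f \<noteq> 0" for f using that by (intro value_group_mem) simp
  have le: "\<iota> a \<le> \<iota> b" if "a \<le> b" "a \<in> value_group \<nu>" "b \<in> value_group \<nu>" for a b
    using mono_onD[OF strict_mono_on_imp_mono_on[OF mono] that(2,3,1)] .
  have min: "\<iota> (min a b) = min (\<iota> a) (\<iota> b)" if "a \<in> value_group \<nu>" "b \<in> value_group \<nu>" for a b
    using le[of a b] le[of b a] that by (cases "a \<le> b") (auto simp: min_absorb1 min_absorb2)
  have S: "\<iota> ` value_semigroup \<nu> = v ` (- {0})"
    unfolding value_semigroup_def v_def by auto
  have \<iota>0: "\<iota> 0 = 0" using add[of 0 0] value_group_0[OF val] by simp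
  have v_mult: "v (f * g) = v f + v g" if "f \<noteq> 0" "g \<noteq> 0" for f g
    unfolding v_def using that valuation_mult[OF val, of "to_fract f" "to_fract g"] add[OF mem mem] by simp
  have v_add: "min (v f) (v g) \<le> v (f + g)" if "f \<noteq> 0" "g \<noteq> 0" "f + g \<noteq> 0" for f g
  proof -
    have nz: "to_fract f + to_fract g \<noteq> 0" using that by (simp only: to_fract_add[symmetric] to_fract_eq_0_iff) simp
    have "min (\<nu> (to_fract f)) (\<nu> (to_fract g)) \<le> \<nu> (to_fract (f + g))"
      using valuation_add[OF val _ _ nz] that by simp
    moreover have "min (\<nu> (to_fract f)) (\<nu> (to_fract g)) \<in> value_group \<nu>"
      using mem that by (simp add: min_def)
    ultimately have "\<iota> (min (\<nu> (to_fract f)) (\<nu> (to_fract g))) \<le> \<iota> (\<nu> (to_fract (f + g)))"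
      using mem[OF that(3)] by (intro le)
    then show ?thesis unfolding v_def min[OF mem[OF that(1)] mem[OF that(2)]] .
  qed
  have v_unit: "v f = 0" if "f dvd 1" for f
  proof -
    have "f \<noteq> 0" using that by auto
    then show ?thesis unfolding v_def using dominates_values(1)[OF dom m _ that] \<iota>0 by simp
  qed
  have v_nonunit: "1 \<le> v f" if f: "f \<noteq> 0" "\<not> f dvd 1" for f
  proof (rule least)
    show "v f \<in> \<iota> ` value_semigroup \<nu>" unfolding S using f by blast
    have "\<iota> 0 < \<iota> (\<nu> (to_fract f))"
      using strict_mono_onD[OF mono value_group_0[OF val] mem[OF f(1)] dominates_values(2)[OF dom m f]] .
    then show "v f \<noteq> 0" unfolding v_def \<iota>0 by simp
  qed
  obtain f where f: "f \<noteq> 0" "v f = 1" using one unfolding S by force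
  then have "\<not> f dvd 1" using v_unit by force
  then obtain a b where "f = a * x + b * y" using nonunit_iff by blast
  then have g: "min (\<nu> (to_fract x)) (\<nu> (to_fract y)) \<le> \<nu> (to_fract f)"
    using combination_value[OF val dom m x_nonzero y_nonzero f(1)] by blast
  have "min (\<nu> (to_fract x)) (\<nu> (to_fract y)) \<in> value_group \<nu>"
    using mem x_nonzero y_nonzero by (simp add: min_def)
  then have "min (v x) (v y) \<le> 1"
    using le[OF g _ mem[OF f(1)]] min[OF mem[OF x_nonzero] mem[OF y_nonzero]] f(2) unfolding v_def by simp
  then have "v x = 1 \<or> v y = 1"
    using v_nonunit[OF x_nonzero nonunit_x] v_nonunit[OF y_nonzero nonunit_y] by (auto simp: min_le_iff_disj)
  then obtain x' y' where "dominating_valuation x' y' v"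
  proof
    assume "v x = 1"
    then have "dominating_valuation x y v"
      using rp v_mult v_add v_unit v_nonunit
      by (auto intro!: dominating_valuation.intro dominating_valuation_axioms.intro)
    then show thesis using that by blast
  next
    assume "v y = 1"
    then have "dominating_valuation y x v"
      using rp' v_mult v_add v_unit v_nonunit
      by (auto intro!: dominating_valuation.intro dominating_valuation_axioms.intro)
    then show thesis using that by blast
  qed
  then interpret dv: dominating_valuation x' y' v .
  obtain L where "0 \<le> L" "L < 1 / 2"
    "(\<lambda>n. real (card (dv.value_set \<inter> {0<..<real n})) / (real n)\<^sup>2) \<longlonglongrightarrow> L"
    by (rule dv.positive_value_set_count_limit)
  then show ?thesis unfolding phi_def S dv.value_set_def by blast
qed

lemma obtained_limits_subset:
  assumes m: "\<And>r :: 'a::idom. r \<in> max_ideal \<longleftrightarrow> \<not> r dvd 1"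
    and xy: "regular_parameters (x :: 'a) y" "regular_parameters y x"
  shows "obtained_limits TYPE('a) TYPE('g::linordered_ab_group_add) \<subseteq> {0..<1/2}"
proof
  fix L assume "L \<in> obtained_limits TYPE('a) TYPE('g)"
  then obtain \<nu> :: "'a fract \<Rightarrow> 'g" and \<iota> where \<nu>: "rank_one_dominating \<nu>" "normalized_embedding \<nu> \<iota>"
    and L: "(\<lambda>n. real (phi \<nu> \<iota> n) / (real n)\<^sup>2) \<longlonglongrightarrow> L"
    unfolding obtained_limits_def by blast
  obtain L' where L': "0 \<le> L'" "L' < 1 / 2" "(\<lambda>n. real (phi \<nu> \<iota> n) / (real n)\<^sup>2) \<longlonglongrightarrow> L'"
    using normalized_limit[OF \<nu> m xy] by blast
  then have "L = L'" using LIMSEQ_unique[OF L] by blast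
  then show "L \<in> {0..<1/2}" using L' by simp
qed

theorem corollary1p3:
  assumes "is_regular_local TYPE('a::idom)"
    and "krull_dim TYPE('a) = 2"
  shows "(\<forall>\<nu> :: 'a fract \<Rightarrow> 'g::linordered_ab_group_add. rank_one_dominating \<nu> \<longrightarrow>
           (\<exists>\<iota>. normalized_embedding \<nu> \<iota>) \<and>
           (\<forall>\<iota>. normalized_embedding \<nu> \<iota> \<longrightarrow>
              convergent (\<lambda>n. real (phi \<nu> \<iota> n) / (real n)\<^sup>2))) \<and>
         obtained_limits TYPE('a) TYPE('g) \<subseteq> {0..<1/2} \<and>
         obtained_limits TYPE('a) TYPE(real) = {0..<1/2}"
proof -
  obtain x y :: 'a where xy: "regular_parameters x y" "regular_parameters y x"
    using regular_local_parameters[OF assms] by blast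
  have loc: "is_local TYPE('a)" using assms(1) unfolding is_regular_local_def by blast
  have m: "r \<in> max_ideal \<longleftrightarrow> \<not> r dvd 1" for r :: 'a
    by (rule mem_max_ideal_iff[OF loc])
  have "{0..<1/2} \<subseteq> obtained_limits TYPE('a) TYPE(real)"
  proof
    fix L :: real assume "L \<in> {0..<1/2}"
    \<comment> \<open>The slope to be realized is \<open>2 * L\<close>, since a slope
      \<open>s\<close> with \<open>\<Delta> = 1\<close> gives the limit
      \<open>s / 2\<close>.\<close>
    then have "0 \<le> 2 * L" "2 * L < 1" by simp_all
    then obtain v where v: "dominating_valuation x y v"
      and lim: "(\<lambda>n. real (card (v ` (- {0}) \<inter> {0<..<real n})) / (real n)\<^sup>2) \<longlonglongrightarrow> 2 * L / 2"
      using realizing_valuation_exists[OF xy(1)] by blast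
    have "2 * L / 2 \<in> obtained_limits TYPE('a) TYPE(real)"
      by (rule dominating_valuation.realized_limit[OF v m lim])
    then show "L \<in> obtained_limits TYPE('a) TYPE(real)" by simp
  qed
  then have real: "obtained_limits TYPE('a) TYPE(real) = {0..<1/2}"
    using obtained_limits_subset[OF m xy] by blast
  have "(\<exists>\<iota>. normalized_embedding \<nu> \<iota>) \<and>
      (\<forall>\<iota>. normalized_embedding \<nu> \<iota> \<longrightarrow> convergent (\<lambda>n. real (phi \<nu> \<iota> n) / (real n)\<^sup>2))"
    if \<nu>: "rank_one_dominating \<nu>" for \<nu> :: "'a fract \<Rightarrow> 'g"
    using normalized_embedding_exists[OF \<nu> m xy(1)] normalized_limit[OF \<nu> _ m xy] convergentI by blast
  then show ?thesis using obtained_limits_subset[OF m xy] real by blast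
qed

end
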